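(* Let $n\ge 2$, $N\ge 1$ and $0<\alpha<1$. Let $a(p,q,r)=(a_1,\dots,a_N)(p,q,r)$ be of class $C^2_{loc}$ in $p\in\mathbb{R}^N$, $q\in\mathbb{R}^n\otimes\mathbb{R}^N$, $r\in\mathrm{Sym}(n)\otimes\mathbb{R}^N$. Assume $a(0)=0$ and $\nabla a(0)=0$. Then for any given $R>0$ the system for $u=(u_1,\dots,u_N):\{|x|\le R\}\to\mathbb{R}^N$ $$\Delta u(x)=a(u(x),\nabla u(x),\nabla^2u(x))$$ has infinitely many solutions of class $C^{2+\alpha}$ in $\{x\in\mathbb{R}^n:|x|\le R\}$ with vanishing order two at the origin. Consequently, all these solutions are not radially symmetric.
   Context: $\mathrm{Sym}(n)$ is the set of real symmetric $n\times n$ matrices; $\nabla a$ is the full gradient in $(p,q,r)$. A solution $u$ is of vanishing order two at the origin if $u(0)=0$, $\nabla u(0)=0$ and $\nabla^2u(0)\ne0$. A map $u$ on the ball is radially symmetric if $u(x)$ depends only on $|x|$. $C^{2+\alpha}$ denotes functions whose second order partial derivatives exist and are Hölder continuous with exponent $\alpha$. *)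

theory Defs
  imports "HOL-Analysis.Analysis"
begin

(* A map u into R^N has gradient q in R^n (x) R^N, with q $ k $ i = d_i u_k, and second gradient
   r in R^n (x) R^n (x) R^N, with r $ k $ i $ j = d_j d_i u_k.  All derivatives are Frechet
   derivatives relative to the set S on which u lives; they are uniquely determined
   at every point of S (boundary points included) when S is a closed ball of positive radius. *)

definition grad :: "(real ^ 'n) set \<Rightarrow> (real ^ 'n \<Rightarrow> real ^ 'm) \<Rightarrow> real ^ 'n \<Rightarrow> real ^ 'n ^ 'm" where
  "grad S u x = jacobian u (at x within S)"

definition grad2 :: "(real ^ 'n) set \<Rightarrow> (real ^ 'n \<Rightarrow> real ^ 'm) \<Rightarrow> real ^ 'n \<Rightarrow> real ^ 'n ^ 'n ^ 'm" where
  "grad2 S u x = (\<chi> k. jacobian (\<lambda>y. grad S u y $ k) (at x within S))"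

definition laplacian :: "(real ^ 'n) set \<Rightarrow> (real ^ 'n \<Rightarrow> real ^ 'm) \<Rightarrow> real ^ 'n \<Rightarrow> real ^ 'm" where
  "laplacian S u x = (\<chi> k. \<Sum>i\<in>UNIV. grad2 S u x $ k $ i $ i)"

definition holder_on :: "real \<Rightarrow> 'a::metric_space set \<Rightarrow> ('a \<Rightarrow> 'b::metric_space) \<Rightarrow> bool" where
  "holder_on \<alpha> S f \<longleftrightarrow> (\<exists>C. \<forall>x\<in>S. \<forall>y\<in>S. dist (f x) (f y) \<le> C * dist x y powr \<alpha>)"

definition C2_holder_on :: "real \<Rightarrow> (real ^ 'n) set \<Rightarrow> (real ^ 'n \<Rightarrow> real ^ 'm) \<Rightarrow> bool" where
  "C2_holder_on \<alpha> S u \<longleftrightarrow>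
     u differentiable_on S \<and>
     (\<forall>k. (\<lambda>x. grad S u x $ k) differentiable_on S) \<and>
     holder_on \<alpha> S (grad2 S u)"

definition vanishing_order_two :: "(real ^ 'n) set \<Rightarrow> (real ^ 'n \<Rightarrow> real ^ 'm) \<Rightarrow> bool" where
  "vanishing_order_two S u \<longleftrightarrow> u 0 = 0 \<and> grad S u 0 = 0 \<and> grad2 S u 0 \<noteq> 0"

definition radially_symmetric_on :: "(real ^ 'n) set \<Rightarrow> (real ^ 'n \<Rightarrow> 'b) \<Rightarrow> bool" where
  "radially_symmetric_on S u \<longleftrightarrow> (\<forall>x\<in>S. \<forall>y\<in>S. norm x = norm y \<longrightarrow> u x = u y)"

(* The domain R^N x (R^n (x) R^N) x (Sym(n) (x) R^N) of the nonlinearity a, as a linear subspace of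
   the ambient product space. *)
definition jet_space :: "((real ^ 'm) \<times> (real ^ 'n ^ 'm) \<times> (real ^ 'n ^ 'n ^ 'm)) set" where
  "jet_space = {(p, q, r). \<forall>k. transpose (r $ k) = r $ k}"

(* Class C^2 on a linear subspace D.  Derivatives are taken relative to D, so values of f off D
   are irrelevant; the linear maps f' z and f'' z are only determined on D, hence the existential
   quantifiers.  (Any choice on D extends to the whole space by precomposing with a projection onto
   D, so this is the intrinsic notion on D.) *)
definition C2_on :: "'a::real_normed_vector set \<Rightarrow> ('a \<Rightarrow> 'b::real_normed_vector) \<Rightarrow> bool" where
  "C2_on D f \<longleftrightarrow>
     (\<exists>(f' :: 'a \<Rightarrow> 'a \<Rightarrow>\<^sub>L 'b) (f'' :: 'a \<Rightarrow> 'a \<Rightarrow>\<^sub>L 'a \<Rightarrow>\<^sub>L 'b).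
        (\<forall>z\<in>D. (f has_derivative blinfun_apply (f' z)) (at z within D)) \<and>
        (\<forall>z\<in>D. (f' has_derivative blinfun_apply (f'' z)) (at z within D)) \<and>
        continuous_on D f'')"

end

theory Submission
  imports Defs
begin

text \<open>Let \<open>M\<^sub>k(s) f(x) = \<integral> k(z) f(x + s z) dz\<close>. For a suitable radial \<open>\<Phi>\<close> supported in the unit ball
  and \<open>b = max 0 (1 - |z|\<^sup>2)\<close> one has \<open>\<partial>\<^sub>s M\<^bsub>b\<^sup>2\<^esub>(s) f = s \<Delta> M\<^bsub>\<Phi>\<^esub>(s) f\<close>, so integrating over the
  scales \<open>s\<close> between 0 and a large one gives an operator \<open>T\<close> with \<open>\<Delta> T f = f - E f\<close>, where \<open>E f\<close> is \<open>f\<close>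
  averaged at the large scale and hence small in Hoelder norm for compactly supported \<open>f\<close>. The second
  derivatives of the kernel have mean zero, which makes the scale integral of \<open>D\<^sup>2 T\<close> converge absolutely
  and map Hoelder functions to Hoelder functions; no singular integrals occur.

  Since \<open>a\<close> vanishes quadratically, \<open>g \<mapsto> \<chi> (a(\<epsilon> J h + J T g) + E g)\<close> is, for small \<open>\<epsilon>\<close>, a contraction of a
  Hoelder ball of radius proportional to \<open>\<epsilon>\<close>. Here \<open>\<chi>\<close> is a cutoff equal to 1 on the ball of radius \<open>R\<close>,
  \<open>J\<close> is the 2-jet, \<open>h = x\<^sub>i x\<^sub>j\<close> with \<open>i \<noteq> j\<close> is harmonic, and \<open>T\<close> is normalised to vanish to first order
  at 0. The fixed point gives the solution \<open>\<epsilon> h + T g\<close>, whose mixed derivative at 0 is comparable to \<open>\<epsilon>\<close>: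
  different scales of \<open>\<epsilon>\<close> give different solutions, and a radial function has no mixed derivative at 0.\<close>

section \<open>Mollification\<close>

text \<open>The right-hand side contains second derivatives, so the iteration has no derivative to
  spare: the approximate inverse must gain exactly two, which forces Hoelder spaces and a Schauder
  estimate. What makes the map contract is the quadratic vanishing of \<open>a\<close>: on jets of
  Hoelder size \<delta>, composition with \<open>a\<close> has a Lipschitz constant of order
  \<delta> in the Hoelder norm. This is where two derivatives of \<open>a\<close> are used.

  The radius is arbitrary, so smallness cannot come from a small ball. The final scale is made
  large, depending on the radius and \<alpha>, until \<open>E\<close> is a contraction; only then is
  \<epsilon> taken small against all other constants. Accordingly \<open>E f\<close> is not inverted
  but moved to the nonlinear side.

  \<open>T\<close> is nonlocal, and jets are controlled only on bounded sets, which is why the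
  source is cut off. Normalising \<open>T\<close> subtracts an affine map and leaves second
  derivatives alone. As \<open>a\<close> is differentiated only relative to symmetric jets, it is
  composed with the projection onto them.\<close>

text \<open>The domain of integration has room for the unit ball translated by a vector of norm at most 2 or
  dilated by a factor of at most 2.\<close>

definition moll :: "('a::euclidean_space \<Rightarrow> real) \<Rightarrow> real \<Rightarrow> ('a \<Rightarrow> 'b::euclidean_space) \<Rightarrow> 'a \<Rightarrow> 'b" where
  "moll k s f x = integral (cbox (- 3 *\<^sub>R One) (3 *\<^sub>R One)) (\<lambda>z. k z *\<^sub>R f (x + s *\<^sub>R z))"

definition kernel :: "('a::euclidean_space \<Rightarrow> real) \<Rightarrow> bool" where
  "kernel k \<longleftrightarrow> continuous_on UNIV k \<and> (\<forall>z. norm z > 1 \<longrightarrow> k z = 0)"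

lemma kernelD: "kernel k \<Longrightarrow> continuous_on UNIV k" "kernel k \<Longrightarrow> norm z > 1 \<Longrightarrow> k z = 0"
  by (auto simp: kernel_def)

lemma norm_le_3_in_cbox:
  fixes z :: "'a::euclidean_space"
  assumes "norm z \<le> 3"
  shows "z \<in> cbox (- 3 *\<^sub>R One) (3 *\<^sub>R One)"
proof -
  have "\<bar>z \<bullet> i\<bar> \<le> 3" if "i \<in> Basis" for i
    using Basis_le_norm[OF that, of z] assms by linarith
  then show ?thesis
    unfolding mem_box by (auto simp: abs_le_iff minus_le_iff)
qed

lemma continuous_on_compose_UNIV:
  "continuous_on UNIV g \<Longrightarrow> continuous_on S h \<Longrightarrow> continuous_on S (\<lambda>x. g (h x))"
  by (rule continuous_on_compose2) auto

text \<open>Both integrals equal integrals over the whole space: \<open>g\<close> lives in the unit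
  ball, and \<open>out\<close> places the preimage of that ball inside the cube as well. Changes of
  variables therefore keep the domain of \<open>moll\<close>.\<close>

lemma integral_affine_compact_support:
  fixes g :: "'a::euclidean_space \<Rightarrow> 'b::euclidean_space"
  assumes g: "continuous_on UNIV g" "\<And>z. norm z > 1 \<Longrightarrow> g z = 0"
    and m: "m > 0" and out: "\<And>z. norm (m *\<^sub>R z + c) \<le> 1 \<Longrightarrow> norm z \<le> 3"
  shows "integral (cbox (- 3 *\<^sub>R One) (3 *\<^sub>R One)) (\<lambda>z. g (m *\<^sub>R z + c))
       = (1 / m ^ DIM('a)) *\<^sub>R integral (cbox (- 3 *\<^sub>R One) (3 *\<^sub>R One)) g"
proof -
  let ?Q = "cbox (- 3 *\<^sub>R One) (3 *\<^sub>R One) :: 'a set"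
  let ?T = "(\<lambda>x. (1 / m) *\<^sub>R x + -((1 / m) *\<^sub>R c)) ` ?Q"
  have "g integrable_on ?Q"
    by (rule integrable_continuous) (rule continuous_on_subset[OF g(1)], simp)
  then have "((\<lambda>x. g(m *\<^sub>R x + c)) has_integral (1 / (\<bar>m\<bar> ^ DIM('a))) *\<^sub>R integral ?Q g) ?T"
    using m by (intro has_integral_affinity) (auto intro: integrable_integral)
  then have "((\<lambda>x. g(m *\<^sub>R x + c)) has_integral (1 / (\<bar>m\<bar> ^ DIM('a))) *\<^sub>R integral ?Q g) UNIV"
  proof (rule has_integral_on_superset)
    fix x assume x: "x \<notin> ?T"
    have "m *\<^sub>R x + c \<notin> ?Q"
    proof
      assume "m *\<^sub>R x + c \<in> ?Q"
      moreover have "x = (1 / m) *\<^sub>R (m *\<^sub>R x + c) + -((1 / m) *\<^sub>R c)"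
        using m by (simp add: scaleR_add_right)
      ultimately show False using x by blast
    qed
    then show "g (m *\<^sub>R x + c) = 0"
      using g(2) norm_le_3_in_cbox[of "m *\<^sub>R x + c"] by (meson linorder_not_le order.trans one_le_numeral)
  qed simp
  then have "((\<lambda>x. if x \<in> ?Q then g(m *\<^sub>R x + c) else 0) has_integral (1 / (\<bar>m\<bar> ^ DIM('a))) *\<^sub>R integral ?Q g) UNIV"
  proof (rule has_integral_eq[rotated])
    fix x :: 'a
    show "g (m *\<^sub>R x + c) = (if x \<in> ?Q then g(m *\<^sub>R x + c) else 0)"
      using g(2)[of "m *\<^sub>R x + c"] out[of x] norm_le_3_in_cbox[of x] by fastforce
  qed
  then show ?thesis
    using m by (simp add: has_integral_restrict_UNIV integral_unique)
qed

text \<open>Moves a shift of the centre from \<open>f\<close> to the kernel, so that position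
  derivatives and Lipschitz estimates fall on \<open>k\<close> while \<open>f\<close> is merely
  continuous. The bound 2 keeps the shifted unit ball within radius 3.\<close>

lemma moll_translate:
  fixes f :: "'a::euclidean_space \<Rightarrow> 'b::euclidean_space"
  assumes k: "kernel k" and f: "continuous_on UNIV f" and w: "norm w \<le> 2"
  shows "moll k s f (x + s *\<^sub>R w) =
    integral (cbox (- 3 *\<^sub>R One) (3 *\<^sub>R One)) (\<lambda>z. k (z - w) *\<^sub>R f (x + s *\<^sub>R z))"
proof -
  let ?g = "\<lambda>y. k y *\<^sub>R f (x + s *\<^sub>R w + s *\<^sub>R y)"
  have "integral (cbox (- 3 *\<^sub>R One) (3 *\<^sub>R One)) (\<lambda>z. ?g (1 *\<^sub>R z + - w))
       = (1 / 1 ^ DIM('a)) *\<^sub>R integral (cbox (- 3 *\<^sub>R One) (3 *\<^sub>R One)) ?g"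
  proof (rule integral_affine_compact_support)
    show "continuous_on UNIV ?g"
      by (intro continuous_intros kernelD k continuous_on_compose_UNIV[OF f])
    show "norm z \<le> 3" if "norm (1 *\<^sub>R z + - w) \<le> 1" for z
      using that w norm_triangle_sub[of z w] by simp
  qed (use k in \<open>auto simp: kernel_def\<close>)
  moreover have "x + s *\<^sub>R w + s *\<^sub>R (z - w) = x + s *\<^sub>R z" for z
    by (simp add: algebra_simps)
  ultimately show ?thesis
    by (simp add: moll_def)
qed

text \<open>The same exchange for dilations: the factor \<open>l\<close> enters only through the
  kernel and the Jacobian, so scale derivatives also fall on \<open>k\<close>.\<close>

lemma moll_scale:
  fixes f :: "'a::euclidean_space \<Rightarrow> 'b::euclidean_space"
  assumes k: "kernel k" and f: "continuous_on UNIV f" and l: "0 < l" "l \<le> 2"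
  shows "moll k (l * s) f x = (1 / l ^ DIM('a)) *\<^sub>R
    integral (cbox (- 3 *\<^sub>R One) (3 *\<^sub>R One)) (\<lambda>z. k ((1 / l) *\<^sub>R z) *\<^sub>R f (x + s *\<^sub>R z))"
proof -
  let ?g = "\<lambda>y. k y *\<^sub>R f (x + (l * s) *\<^sub>R y)"
  have "integral (cbox (- 3 *\<^sub>R One) (3 *\<^sub>R One)) (\<lambda>z. ?g ((1 / l) *\<^sub>R z + 0))
       = (1 / (1 / l) ^ DIM('a)) *\<^sub>R integral (cbox (- 3 *\<^sub>R One) (3 *\<^sub>R One)) ?g"
  proof (rule integral_affine_compact_support)
    show "continuous_on UNIV ?g"
      by (intro continuous_intros kernelD k continuous_on_compose_UNIV[OF f])
    show "norm z \<le> 3" if "norm ((1 / l) *\<^sub>R z + 0) \<le> 1" for z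
      using that l by (simp add: field_simps)
  qed (use k l in \<open>auto simp: kernel_def\<close>)
  then show ?thesis
    using l by (simp add: moll_def power_one_over)
qed

lemma moll_continuous:
  fixes f :: "'a::euclidean_space \<Rightarrow> 'b::euclidean_space"
  assumes "kernel k" and f: "continuous_on UNIV f"
    and "continuous_on A s" "continuous_on A x"
  shows "continuous_on A (\<lambda>a. moll k (s a) f (x a))"
proof -
  have "continuous_on UNIV (\<lambda>(s, x). moll k s f x)"
  proof -
    have "continuous_on UNIV (\<lambda>sx. integral (cbox (- 3 *\<^sub>R One) (3 *\<^sub>R One)) (\<lambda>z. k z *\<^sub>R f (snd sx + fst sx *\<^sub>R z)))"
      by (rule integral_continuous_on_param)
        (auto simp: case_prod_unfold intro!: continuous_intros continuous_on_compose_UNIV[OF f]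
           continuous_on_compose_UNIV[OF kernelD(1)[OF assms(1)]])
    then show ?thesis by (simp add: moll_def case_prod_unfold)
  qed
  from continuous_on_compose_UNIV[OF this, of A "\<lambda>a. (s a, x a)"] show ?thesis
    using assms(3,4) by (simp add: continuous_on_Pair)
qed

lemma has_vector_derivative_scaleR_const:
  "(g has_vector_derivative d) (at h) \<Longrightarrow> ((\<lambda>h. g h *\<^sub>R v) has_vector_derivative d *\<^sub>R v) (at h within S)"
  by (rule has_vector_derivative_at_within)
    (rule bounded_linear.has_vector_derivative[OF bounded_linear_scaleR_left])

section \<open>Derivatives of mollifications in position and in scale\<close>

text \<open>By \<open>moll_translate\<close>, moving the centre by \<open>h *\<^sub>R e\<close>
  evaluates the kernel at \<open>z - (h / s) *\<^sub>R e\<close>; differentiation under the integral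
  then produces the factor \<open>- 1 / s\<close>.\<close>

lemma moll_directional_derivative:
  fixes f :: "'a::euclidean_space \<Rightarrow> 'b::euclidean_space"
  assumes k: "kernel k" and k': "kernel k'"
    and D: "\<And>z t. ((\<lambda>t. k (z + t *\<^sub>R e)) has_vector_derivative k' (z + t *\<^sub>R e)) (at t)"
    and f: "continuous_on UNIV f" and s: "s > 0"
  shows "((\<lambda>t. moll k s f (x + t *\<^sub>R e)) has_vector_derivative (- 1 / s) *\<^sub>R moll k' s f (x + t0 *\<^sub>R e)) (at t0)"
proof -
  let ?Q = "cbox (- 3 *\<^sub>R One) (3 *\<^sub>R One) :: 'a set"
  define x0 where "x0 = x + t0 *\<^sub>R e"
  \<comment> \<open>For increments up to \<open>r\<close> the shift of the kernel stays within the
    range of \<open>moll_translate\<close>. The summand 1 covers \<open>e = 0\<close>.\<close>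
  define r where "r = s / (norm e + 1)"
  have r: "r > 0" using s by (auto simp: r_def intro!: divide_pos_pos add_nonneg_pos)
  have re: "norm ((h / s) *\<^sub>R e) \<le> 2" if "\<bar>h\<bar> \<le> r" for h
  proof -
    have "\<bar>h\<bar> * norm e \<le> r * norm e" using that by (intro mult_right_mono) auto
    also have "\<dots> \<le> s" proof -
      have "norm e / (norm e + 1) \<le> 1" by (simp add: divide_le_eq add_nonneg_pos)
      then have "s * (norm e / (norm e + 1)) \<le> s * 1" using s by (intro mult_left_mono) auto
      then show ?thesis by (simp add: r_def)
    qed
    finally show ?thesis using s by (simp add: field_simps)
  qed
  have "((\<lambda>h. integral ?Q (\<lambda>z. k (z - (h / s) *\<^sub>R e) *\<^sub>R f (x0 + s *\<^sub>R z))) has_vector_derivative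
      integral ?Q (\<lambda>z. ((-1/s) * k' (z - (0 / s) *\<^sub>R e)) *\<^sub>R f (x0 + s *\<^sub>R z))) (at 0 within {-r..r})"
  proof (rule leibniz_rule_vector_derivative)
    fix h z
    have der: "((\<lambda>h. k (z + (- h / s) *\<^sub>R e)) has_vector_derivative (- 1 / s) *\<^sub>R k' (z + (- h / s) *\<^sub>R e)) (at h)"
    proof -
      have "((\<lambda>h. - h / s) has_real_derivative - 1 / s) (at h)"
        using s by (auto intro!: derivative_eq_intros)
      then have "((\<lambda>h. - h / s) has_vector_derivative - 1 / s) (at h)"
        by (simp only: has_real_derivative_iff_has_vector_derivative)
      from vector_diff_chain_at[OF this D[of z "- h / s"]] show ?thesis
        by (simp only: o_def)
    qed
    show "((\<lambda>h. k (z - (h / s) *\<^sub>R e) *\<^sub>R f (x0 + s *\<^sub>R z)) has_vector_derivative ((-1/s) * k' (z - (h / s) *\<^sub>R e)) *\<^sub>R f (x0 + s *\<^sub>R z)) (at h within {-r..r})"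
      using has_vector_derivative_scaleR_const[OF der] by simp
    show "(\<lambda>z. k (z - (h / s) *\<^sub>R e) *\<^sub>R f (x0 + s *\<^sub>R z)) integrable_on ?Q"
      by (intro integrable_continuous continuous_intros continuous_on_compose_UNIV[OF f] continuous_on_compose_UNIV[OF kernelD(1)[OF k]])
  next
    show "continuous_on ({- r..r} \<times> ?Q) (\<lambda>(h, z). ((-1/s) * k' (z - (h / s) *\<^sub>R e)) *\<^sub>R f (x0 + s *\<^sub>R z))"
      unfolding case_prod_unfold using s
      by (intro continuous_intros continuous_on_compose_UNIV[OF f] continuous_on_compose_UNIV[OF kernelD(1)[OF k']]) auto
  qed (use r in auto)
  also have "integral ?Q (\<lambda>z. ((-1/s) * k' (z - (0 / s) *\<^sub>R e)) *\<^sub>R f (x0 + s *\<^sub>R z)) = (- 1 / s) *\<^sub>R moll k' s f x0"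
    unfolding moll_def by (simp add: integral_cmul[symmetric])
  finally have "((\<lambda>h. moll k s f (x0 + h *\<^sub>R e)) has_vector_derivative (- 1 / s) *\<^sub>R moll k' s f x0) (at 0 within {-r..r})"
  proof (rule has_vector_derivative_transform[rotated 2])
    fix h assume "h \<in> {-r..r}"
    then show "moll k s f (x0 + h *\<^sub>R e) = integral ?Q (\<lambda>z. k (z - (h / s) *\<^sub>R e) *\<^sub>R f (x0 + s *\<^sub>R z))"
      using moll_translate[OF k f re[of h], of s x0] s by (simp add: abs_le_iff minus_le_iff)
  qed (use r in auto)
  then have "((\<lambda>h. moll k s f (x0 + h *\<^sub>R e)) has_vector_derivative (- 1 / s) *\<^sub>R moll k' s f x0) (at 0)"
    using r by (simp add: at_within_Icc_at)
  then have "(((\<lambda>h. moll k s f (x0 + h *\<^sub>R e)) \<circ> (\<lambda>t. t - t0)) has_vector_derivative 1 *\<^sub>R (- 1 / s) *\<^sub>R moll k' s f x0) (at t0)"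
    by (intro vector_diff_chain_at) (auto intro!: derivative_eq_intros)
  then show ?thesis by (simp add: o_def x0_def algebra_simps)
qed

text \<open>Here \<open>k'\<close> is the radial derivative of \<open>k\<close>. With
  \<open>n\<close> the dimension, differentiating \<open>k (z / l) / l ^ n\<close> at
  \<open>l = 1\<close> gives minus the divergence of the field \<open>k z *\<^sub>R z\<close>, which
  is the kernel on the right.\<close>

lemma moll_scale_derivative:
  fixes f :: "'a::euclidean_space \<Rightarrow> 'b::euclidean_space"
  assumes k: "kernel k" and k': "kernel k'"
    and D: "\<And>z t. t > 0 \<Longrightarrow> ((\<lambda>t. k (t *\<^sub>R z)) has_vector_derivative (1 / t) * k' (t *\<^sub>R z)) (at t)"
    and f: "continuous_on UNIV f" and s: "s > 0"
  shows "((\<lambda>t. moll k t f x) has_vector_derivative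
     (1 / s) *\<^sub>R moll (\<lambda>z. - real DIM('a) * k z - k' z) s f x) (at s)"
proof -
  let ?Q = "cbox (- 3 *\<^sub>R One) (3 *\<^sub>R One) :: 'a set"
  let ?n = "real DIM('a)"
  have int: "(\<lambda>z. k z *\<^sub>R f (x + s *\<^sub>R z)) integrable_on ?Q" "(\<lambda>z. k' z *\<^sub>R f (x + s *\<^sub>R z)) integrable_on ?Q"
    by (intro integrable_continuous continuous_intros continuous_on_compose_UNIV[OF f] continuous_on_compose_UNIV[OF kernelD(1)[OF k]]
          continuous_on_compose_UNIV[OF kernelD(1)[OF k']])+
  have "((\<lambda>l. integral ?Q (\<lambda>z. k ((1 / l) *\<^sub>R z) *\<^sub>R f (x + s *\<^sub>R z))) has_vector_derivative
      integral ?Q (\<lambda>z. ((- 1 / 1) * k' ((1/1) *\<^sub>R z)) *\<^sub>R f (x + s *\<^sub>R z))) (at 1 within {1/2..2})"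
  proof (rule leibniz_rule_vector_derivative[where
      fx = "\<lambda>l z. ((- 1 / l) * k' ((1 / l) *\<^sub>R z)) *\<^sub>R f (x + s *\<^sub>R z)"])
    fix l :: real and z assume "l \<in> {1/2..2}"
    then have l: "l > 0" by auto
    have der: "((\<lambda>h. k ((1 / h) *\<^sub>R z)) has_vector_derivative (- 1 / l^2) *\<^sub>R ((1 / (1/l)) * k' ((1 / l) *\<^sub>R z))) (at l)"
    proof -
      have "((\<lambda>h. 1 / h) has_real_derivative - 1 / l^2) (at l)"
        using l by (auto intro!: derivative_eq_intros simp: power2_eq_square)
      then have "((\<lambda>h. 1 / h) has_vector_derivative - 1 / l^2) (at l)"
        by (simp only: has_real_derivative_iff_has_vector_derivative)
      from vector_diff_chain_at[OF this D[of "1 / l" z]] l show ?thesis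
        by (simp only: o_def) simp
    qed
    show "((\<lambda>h. k ((1 / h) *\<^sub>R z) *\<^sub>R f (x + s *\<^sub>R z)) has_vector_derivative ((- 1 / l) * k' ((1/l) *\<^sub>R z)) *\<^sub>R f (x + s *\<^sub>R z)) (at l within {1/2..2})"
    proof -
      have "(- 1 / l^2) *\<^sub>R ((1 / (1/l)) * k' ((1 / l) *\<^sub>R z)) = (- 1 / l) * k' ((1/l) *\<^sub>R z)"
        using l by (simp add: power2_eq_square)
      with has_vector_derivative_scaleR_const[OF der] show ?thesis
        by (simp only:)
    qed
    show "(\<lambda>z. k ((1 / l) *\<^sub>R z) *\<^sub>R f (x + s *\<^sub>R z)) integrable_on ?Q"
      by (intro integrable_continuous continuous_intros continuous_on_compose_UNIV[OF f] continuous_on_compose_UNIV[OF kernelD(1)[OF k]])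
  next
    show "continuous_on ({1/2..2} \<times> ?Q) (\<lambda>(l, z). ((-1/l) * k' ((1/l) *\<^sub>R z)) *\<^sub>R f (x + s *\<^sub>R z))"
      unfolding case_prod_unfold
      by (intro continuous_intros continuous_on_compose_UNIV[OF f] continuous_on_compose_UNIV[OF kernelD(1)[OF k']]) auto
  qed auto
  then have 1: "((\<lambda>l. integral ?Q (\<lambda>z. k ((1 / l) *\<^sub>R z) *\<^sub>R f (x + s *\<^sub>R z))) has_vector_derivative
      - moll k' s f x) (at 1)"
    by (simp add: at_within_Icc_at moll_def)
  have "((\<lambda>l. (1 / l ^ DIM('a)) *\<^sub>R integral ?Q (\<lambda>z. k ((1 / l) *\<^sub>R z) *\<^sub>R f (x + s *\<^sub>R z))) has_vector_derivative
      - moll k' s f x - ?n *\<^sub>R moll k s f x) (at 1)"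
  proof -
    have "((\<lambda>l::real. 1 / l ^ DIM('a)) has_field_derivative - ?n) (at 1)"
      by (auto intro!: derivative_eq_intros)
    from has_vector_derivative_scaleR[OF this 1] show ?thesis
      by (simp add: moll_def)
  qed
  also have "- moll k' s f x - ?n *\<^sub>R moll k s f x = moll (\<lambda>z. - ?n * k z - k' z) s f x"
  proof -
    have "moll (\<lambda>z. - ?n * k z - k' z) s f x
        = integral ?Q (\<lambda>z. (- ?n) *\<^sub>R (k z *\<^sub>R f (x + s *\<^sub>R z)) - k' z *\<^sub>R f (x + s *\<^sub>R z))"
      unfolding moll_def by (simp only: scaleR_diff_left scaleR_scaleR)
    also have "\<dots> = (- ?n) *\<^sub>R moll k s f x - moll k' s f x"

      unfolding moll_def by (simp only: integral_diff[OF integrable_cmul[OF int(1)] int(2)] integral_cmul)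
    finally show ?thesis by simp
  qed
  finally have "((\<lambda>l. moll k (l * s) f x) has_vector_derivative moll (\<lambda>z. - ?n * k z - k' z) s f x) (at 1)"
    by (rule has_vector_derivative_transform_within_open[of _ _ _ "{0<..<2}"]) (auto simp: moll_scale[OF k f])
  then have "(((\<lambda>l. moll k (l * s) f x) \<circ> (\<lambda>t. t / s)) has_vector_derivative (1 / s) *\<^sub>R moll (\<lambda>z. - ?n * k z - k' z) s f x) (at s)"
    using s by (intro vector_diff_chain_at) (auto intro!: derivative_eq_intros)
  then show ?thesis using s by (simp add: o_def)
qed

section \<open>The kernels\<close>

definition bump :: "'a::euclidean_space \<Rightarrow> real" where
  "bump z = max 0 (1 - (norm z)\<^sup>2)"

text \<open>The radial \<open>\<Phi>\<close> of the overview. Its gradient is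
  \<open>- (bump z)\<^sup>2 *\<^sub>R z\<close>, so its Laplacian is minus the divergence of
  \<open>(bump z)\<^sup>2 *\<^sub>R z\<close>, exactly what \<open>moll_scale_derivative\<close>
  makes of the squared bump. The third power leaves a factor \<open>bump\<close> after two
  derivatives, hence a Lipschitz kernel.\<close>

definition kern0 :: "'a::euclidean_space \<Rightarrow> real" where
  "kern0 z = (bump z)^3 / 6"

definition kern1 :: "'a::euclidean_space \<Rightarrow> 'a \<Rightarrow> real" where
  "kern1 e z = - (z \<bullet> e) * (bump z)\<^sup>2"

definition kern2 :: "'a::euclidean_space \<Rightarrow> 'a \<Rightarrow> 'a \<Rightarrow> real" where
  "kern2 e e' z = - (e \<bullet> e') * (bump z)\<^sup>2 + 4 * (z \<bullet> e) * (z \<bullet> e') * bump z"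

lemma bump_eq_0: "norm z > 1 \<Longrightarrow> bump z = 0"
  using power_mono[of 1 "norm z" 2] by (simp add: bump_def)

lemma bump_bounds: "0 \<le> bump z" "bump z \<le> 1"
  by (auto simp: bump_def)

lemma continuous_on_bump [continuous_intros]:
  "continuous_on S h \<Longrightarrow> continuous_on S (\<lambda>x. bump (h x))"
  unfolding bump_def by (intro continuous_intros)

lemma kernel_bump_power2: "kernel (\<lambda>z. (bump z)\<^sup>2)"
  by (auto simp: kernel_def bump_eq_0 intro!: continuous_intros)

lemma kernel_kern0: "kernel kern0"
  by (auto simp: kernel_def kern0_def[abs_def] bump_eq_0 intro!: continuous_intros)

lemma kernel_kern1: "kernel (kern1 e)"
  by (auto simp: kernel_def kern1_def[abs_def] bump_eq_0 intro!: continuous_intros)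

lemma kernel_kern2: "kernel (kern2 e e')"
  by (auto simp: kernel_def kern2_def[abs_def] bump_eq_0 intro!: continuous_intros)

lemma kern2_commute: "kern2 e e' = kern2 e' e"
  by (auto simp: kern2_def inner_commute)

text \<open>From exponent 2 on, the kink of the positive part at 0 disappears: the difference
  quotient there is again a positive power of the positive part.\<close>

lemma has_real_derivative_pos_part_power:
  "((\<lambda>t::real. (max 0 t) ^ Suc (Suc k)) has_real_derivative real (Suc (Suc k)) * (max 0 t) ^ Suc k) (at t)"
proof -
  consider "t < 0" | "t > 0" | "t = 0" by linarith
  then show ?thesis
  proof cases
    case 1
    have "((\<lambda>t::real. 0) has_real_derivative 0) (at t)" by simp
    then have "((\<lambda>t::real. (max 0 t) ^ Suc (Suc k)) has_real_derivative 0) (at t)"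
      by (rule has_field_derivative_transform_within_open[of _ _ _ "{..<0}"]) (use 1 in auto)
    then show ?thesis using 1 by simp
  next
    case 2
    have "((\<lambda>t::real. t ^ Suc (Suc k)) has_real_derivative real (Suc (Suc k)) * t ^ Suc k) (at t)"
      by (rule derivative_eq_intros refl | simp)+
    then have "((\<lambda>t::real. (max 0 t) ^ Suc (Suc k)) has_real_derivative real (Suc (Suc k)) * t ^ Suc k) (at t)"
      by (rule has_field_derivative_transform_within_open[of _ _ _ "{0<..}"]) (use 2 in auto)
    then show ?thesis using 2 by simp
  next
    case 3
    have *: "((\<lambda>h::real. (max 0 h) ^ Suc k) \<longlongrightarrow> (max 0 0) ^ Suc k) (at 0)"
      by (intro tendsto_intros)
    have "((\<lambda>h::real. ((max 0 (0 + h)) ^ Suc (Suc k) - (max 0 0) ^ Suc (Suc k)) / h) \<longlongrightarrow> 0) (at 0)"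
    proof (rule Lim_transform_eventually[of "\<lambda>h. (max 0 h) ^ Suc k"])
      show "((\<lambda>h::real. (max 0 h) ^ Suc k) \<longlongrightarrow> 0) (at 0)" using * by simp
      show "\<forall>\<^sub>F h::real in at 0. (max 0 h) ^ Suc k = (max 0 (0 + h) ^ Suc (Suc k) - (max 0 0) ^ Suc (Suc k)) / h"
        by (intro always_eventually allI) (simp add: max_def)
    qed
    then show ?thesis using 3 by (simp add: DERIV_def)
  qed
qed

lemma bump_power_derivative:
  assumes "(h has_vector_derivative d) (at t)"
  shows "((\<lambda>t. bump (h t) ^ Suc (Suc k)) has_real_derivative
     real (Suc (Suc k)) * bump (h t) ^ Suc k * (- 2 * (h t \<bullet> d))) (at t)"
proof -
  have "((\<lambda>t. 1 - h t \<bullet> h t) has_vector_derivative - 2 * (h t \<bullet> d)) (at t)"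
    using assms unfolding has_vector_derivative_def
    by (auto intro!: derivative_eq_intros simp: inner_commute algebra_simps)
  then have "((\<lambda>t. 1 - (norm (h t))\<^sup>2) has_real_derivative - 2 * (h t \<bullet> d)) (at t)"
    by (simp add: has_real_derivative_iff_has_vector_derivative power2_norm_eq_inner)
  from DERIV_chain2[OF has_real_derivative_pos_part_power this] show ?thesis
    by (simp add: bump_def)
qed

lemma line_has_vector_derivative: "((\<lambda>t. z + t *\<^sub>R e) has_vector_derivative e) (at t)"
  by (auto intro!: derivative_eq_intros simp: has_vector_derivative_def)

lemma inner_line_derivative: "((\<lambda>t. (z + t *\<^sub>R e') \<bullet> e) has_real_derivative e' \<bullet> e) (at t)"
  by (auto intro!: derivative_eq_intros simp: inner_add_left)

lemma kern0_derivative: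
  "((\<lambda>t. kern0 (z + t *\<^sub>R e)) has_vector_derivative kern1 e (z + t *\<^sub>R e)) (at t)"
proof -
  have "((\<lambda>t. bump (z + t *\<^sub>R e) ^ Suc (Suc 1) / 6) has_real_derivative kern1 e (z + t *\<^sub>R e)) (at t)"
    by (rule DERIV_cdivide[OF bump_power_derivative[OF line_has_vector_derivative], THEN DERIV_cong])
      (simp add: kern1_def power2_eq_square)
  then show ?thesis
    by (simp add: kern0_def eval_nat_numeral has_real_derivative_iff_has_vector_derivative)
qed

lemma kern1_derivative:
  "((\<lambda>t. kern1 e (z + t *\<^sub>R e')) has_vector_derivative kern2 e e' (z + t *\<^sub>R e')) (at t)"
proof -
  have "((\<lambda>t. - ((z + t *\<^sub>R e') \<bullet> e) * bump (z + t *\<^sub>R e') ^ Suc (Suc 0)) has_real_derivative kern2 e e' (z + t *\<^sub>R e')) (at t)"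
    by (rule DERIV_mult[OF DERIV_minus[OF inner_line_derivative] bump_power_derivative[OF line_has_vector_derivative], THEN DERIV_cong])
      (simp add: kern2_def power2_eq_square inner_commute algebra_simps)
  then show ?thesis
    by (simp add: kern1_def eval_nat_numeral has_real_derivative_iff_has_vector_derivative)
qed

lemma bump_scale_derivative:
  assumes "t > 0"
  shows "((\<lambda>t. (bump (t *\<^sub>R z))\<^sup>2) has_vector_derivative (1 / t) * (- 4 * (norm (t *\<^sub>R z))\<^sup>2 * bump (t *\<^sub>R z))) (at t)"
proof -
  have "((\<lambda>t. t *\<^sub>R z) has_vector_derivative z) (at t)"
    by (auto intro!: derivative_eq_intros simp: has_vector_derivative_def)
  from bump_power_derivative[OF this, of 0]
  have "((\<lambda>t. (bump (t *\<^sub>R z))\<^sup>2) has_vector_derivative 2 * bump (t *\<^sub>R z) * (- 2 * (t *\<^sub>R z \<bullet> z))) (at t)"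
    by (simp add: eval_nat_numeral has_real_derivative_iff_has_vector_derivative)
  also have "2 * bump (t *\<^sub>R z) * (- 2 * (t *\<^sub>R z \<bullet> z)) = (1 / t) * (- 4 * (norm (t *\<^sub>R z))\<^sup>2 * bump (t *\<^sub>R z))"
    using assms by (simp add: power2_norm_eq_inner del: norm_scaleR)
  finally show ?thesis .
qed

text \<open>The trace of the Hessian of \<open>kern0\<close>, written in the form
  \<open>- n * k - k'\<close> with \<open>k\<close> the squared bump and \<open>k'\<close> its
  radial derivative from \<open>bump_scale_derivative\<close>, so that it matches
  \<open>moll_scale_derivative\<close> literally.\<close>

lemma sum_kern2:
  "(\<Sum>b\<in>Basis. kern2 b b z) = - real DIM('a) * (bump z)\<^sup>2 - (- 4 * (norm z)\<^sup>2 * bump z)"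
  for z :: "'a::euclidean_space"
proof -
  have "(norm z)\<^sup>2 = (\<Sum>b\<in>Basis. (z \<bullet> b) * (z \<bullet> b))"
    by (simp add: power2_norm_eq_inner euclidean_inner[of z z])
  then have "(norm z)\<^sup>2 * (4 * bump z) = (\<Sum>b\<in>Basis. 4 * (z \<bullet> b) * (z \<bullet> b) * bump z)"
    by (simp only: sum_distrib_right) (simp only: mult_ac)
  then show ?thesis
    by (simp add: kern2_def sum_subtractf inner_same_Basis)
qed

section \<open>Lipschitz constants, bounds and integrals of the kernels\<close>

text \<open>\<open>bump\<close> decreases with the norm, so only \<open>norm z \<le> norm w\<close>
  with \<open>norm z \<le> 1\<close> has content. There a difference of squares factors, with
  \<open>norm w\<close> replaced by 1 if it is larger, and the sum of the norms is at most
  2.\<close>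

lemma bump_lipschitz: "\<bar>bump z - bump w\<bar> \<le> 2 * norm (z - w)"
proof -
  have *: "bump z - bump w \<le> 2 * norm (z - w)" for z w :: 'a
  proof (cases "norm z \<le> 1")
    case True
    show ?thesis
    proof (cases "norm w \<ge> norm z")
      case True
      have "(1 - (norm z)\<^sup>2) - bump w \<le> 2 * (norm w - norm z)"
      proof (cases "norm w \<le> 1")
        case True
        have "(norm w)\<^sup>2 - (norm z)\<^sup>2 = (norm w + norm z) * (norm w - norm z)"
          by (simp add: power2_eq_square algebra_simps)
        also have "\<dots> \<le> 2 * (norm w - norm z)"
          using True \<open>norm z \<le> 1\<close> \<open>norm w \<ge> norm z\<close> by (intro mult_right_mono) auto
        finally show ?thesis by (simp add: bump_def)
      next
        case False
        have "(1 - (norm z)\<^sup>2) = (1 + norm z) * (1 - norm z)"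
          by (simp add: power2_eq_square algebra_simps)
        also have "\<dots> \<le> 2 * (1 - norm z)" using \<open>norm z \<le> 1\<close> by (intro mult_right_mono) auto
        also have "\<dots> \<le> 2 * (norm w - norm z)" using False by simp
        finally show ?thesis using bump_bounds(1)[of w] by simp
      qed
      moreover have "bump z = 1 - (norm z)\<^sup>2"
        using \<open>norm z \<le> 1\<close> power_le_one[of "norm z" 2] by (simp add: bump_def)
      ultimately have "bump z - bump w \<le> 2 * (norm w - norm z)" by simp
      also have "\<dots> \<le> 2 * norm (z - w)" using norm_triangle_ineq2[of w z] by (simp add: norm_minus_commute)
      finally show ?thesis .
    next
      case False
      then have "bump z \<le> bump w" unfolding bump_def using power_mono[of "norm w" "norm z" 2] by (intro max.mono) auto
      then show ?thesis by (smt (verit) norm_ge_zero)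
    qed
  next
    case False
    then show ?thesis using bump_eq_0[of z] bump_bounds(1)[of w] by (smt (verit) norm_ge_zero)
  qed
  from *[of z w] *[of w z] show ?thesis by (simp add: abs_le_iff norm_minus_commute)
qed

lemma bump_power2_lipschitz: "\<bar>(bump z)\<^sup>2 - (bump w)\<^sup>2\<bar> \<le> 4 * norm (z - w)"
proof -
  have "\<bar>(bump z)\<^sup>2 - (bump w)\<^sup>2\<bar> = (bump z + bump w) * \<bar>bump z - bump w\<bar>"
    using bump_bounds[of z] bump_bounds[of w] by (simp add: square_diff_square_factored power2_eq_square abs_mult)
  also have "\<dots> \<le> 2 * (2 * norm (z - w))"
    using bump_bounds[of z] bump_bounds[of w] bump_lipschitz[of z w] by (intro mult_mono) auto
  finally show ?thesis by simp
qed

lemma quadratic_bump_bound: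
  "\<bar>(z \<bullet> e) * (z \<bullet> e') * bump z\<bar> \<le> norm e * norm e' * bump z"
proof (cases "norm z \<le> 1")
  case True
  have "\<bar>z \<bullet> e\<bar> \<le> norm e" "\<bar>z \<bullet> e'\<bar> \<le> norm e'"
    using Cauchy_Schwarz_ineq2[of z e] Cauchy_Schwarz_ineq2[of z e'] True
      mult_right_mono[OF True, of "norm e"] mult_right_mono[OF True, of "norm e'"] by auto
  then show ?thesis using bump_bounds(1)[of z]
    by (auto simp: abs_mult intro!: mult_mono)
qed (simp add: bump_eq_0)

text \<open>Inside the ball one factor is changed at a time, which costs 1 for each linear factor
  and 2 for \<open>bump\<close>. If one point lies outside, the product vanishes there and the bound
  for \<open>bump\<close> alone is enough.\<close>

lemma quadratic_bump_lipschitz: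
  "\<bar>(z \<bullet> e) * (z \<bullet> e') * bump z - (w \<bullet> e) * (w \<bullet> e') * bump w\<bar> \<le> 4 * norm e * norm e' * norm (z - w)"
proof -
  let ?q = "\<lambda>z. (z \<bullet> e) * (z \<bullet> e') * bump z"
  have out: "\<bar>?q z - ?q w\<bar> \<le> 4 * norm e * norm e' * norm (z - w)" if "norm w > 1" for z w
  proof -
    have "\<bar>?q z - ?q w\<bar> \<le> norm e * norm e' * (bump z - bump w)"
      using quadratic_bump_bound[of z e e'] that by (simp add: bump_eq_0)
    also have "\<dots> \<le> norm e * norm e' * (2 * norm (z - w))"
      using bump_lipschitz[of z w] by (intro mult_left_mono) auto
    also have "\<dots> \<le> 4 * norm e * norm e' * norm (z - w)" by simp
    finally show ?thesis .
  qed
  consider "norm w > 1" | "norm z > 1" | "norm z \<le> 1" "norm w \<le> 1" by linarith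
  then show ?thesis
  proof cases
    case 1 then show ?thesis by (rule out)
  next
    case 2 then show ?thesis using out[of z w] by (metis abs_minus_commute norm_minus_commute)
  next
    case 3
    have b: "\<bar>v \<bullet> e\<bar> \<le> norm v * norm e" for v e :: 'a by (rule Cauchy_Schwarz_ineq2)
    have b1: "\<bar>v \<bullet> e\<bar> \<le> norm e" if "norm v \<le> 1" for v e :: 'a
      using b[of v e] mult_right_mono[OF that, of "norm e"] by auto
    have "?q z - ?q w = ((z - w) \<bullet> e) * (z \<bullet> e') * bump z + (w \<bullet> e) * ((z - w) \<bullet> e') * bump z + (w \<bullet> e) * (w \<bullet> e') * (bump z - bump w)"
      by (simp add: inner_diff_left algebra_simps)
    also have "\<bar>\<dots>\<bar> \<le> \<bar>(z - w) \<bullet> e\<bar> * \<bar>z \<bullet> e'\<bar> * \<bar>bump z\<bar> + \<bar>w \<bullet> e\<bar> * \<bar>(z - w) \<bullet> e'\<bar> * \<bar>bump z\<bar> + \<bar>w \<bullet> e\<bar> * \<bar>w \<bullet> e'\<bar> * \<bar>bump z - bump w\<bar>"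
      by (rule order_trans[OF abs_triangle_ineq] add_mono)+ (simp_all add: abs_mult)
    also have "\<dots> \<le> (norm (z - w) * norm e) * norm e' * 1 + norm e * (norm (z - w) * norm e') * 1 + norm e * norm e' * (2 * norm (z - w))"
      using 3 bump_bounds[of z] bump_lipschitz[of z w]
      by (intro add_mono mult_mono b b1) auto
    finally show ?thesis by (simp add: algebra_simps)
  qed
qed

lemma kern2_bound: "\<bar>kern2 e e' z\<bar> \<le> 5 * norm e * norm e'"
proof -
  have "\<bar>kern2 e e' z\<bar> \<le> \<bar>e \<bullet> e'\<bar> * (bump z)\<^sup>2 + 4 * \<bar>(z \<bullet> e) * (z \<bullet> e') * bump z\<bar>"
    unfolding kern2_def by (rule order_trans[OF abs_triangle_ineq]) (simp add: abs_mult mult.assoc)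
  also have "\<dots> \<le> (norm e * norm e') * 1 + 4 * (norm e * norm e' * 1)"
    using bump_bounds[of z] Cauchy_Schwarz_ineq2[of e e']
    by (intro add_mono mult_mono order_trans[OF quadratic_bump_bound]) (auto simp: power_le_one)
  finally show ?thesis by simp
qed

lemma kern2_lipschitz: "\<bar>kern2 e e' z - kern2 e e' w\<bar> \<le> 20 * norm e * norm e' * norm (z - w)"
proof -
  have "kern2 e e' z - kern2 e e' w = - (e \<bullet> e') * ((bump z)\<^sup>2 - (bump w)\<^sup>2)
     + 4 * ((z \<bullet> e) * (z \<bullet> e') * bump z - (w \<bullet> e) * (w \<bullet> e') * bump w)"
    by (simp add: kern2_def algebra_simps)
  then have "\<bar>kern2 e e' z - kern2 e e' w\<bar> \<le> \<bar>e \<bullet> e'\<bar> * \<bar>(bump z)\<^sup>2 - (bump w)\<^sup>2\<bar> + 4 * \<bar>(z \<bullet> e) * (z \<bullet> e') * bump z - (w \<bullet> e) * (w \<bullet> e') * bump w\<bar>"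
    using abs_triangle_ineq[of "- (e \<bullet> e') * ((bump z)\<^sup>2 - (bump w)\<^sup>2)" "4 * ((z \<bullet> e) * (z \<bullet> e') * bump z - (w \<bullet> e) * (w \<bullet> e') * bump w)"]
    by (simp only: abs_mult) simp
  also have "\<dots> \<le> (norm e * norm e') * (4 * norm (z - w)) + 4 * (4 * norm e * norm e' * norm (z - w))"
    by (intro add_mono mult_mono mult_left_mono bump_power2_lipschitz quadratic_bump_lipschitz Cauchy_Schwarz_ineq2) auto
  finally show ?thesis by simp
qed

text \<open>A mollification of the constant 1 does not depend on its centre, so its derivative,
  which is this integral up to sign, vanishes.\<close>

lemma integral_kern2:
  "integral (cbox (- 3 *\<^sub>R One) (3 *\<^sub>R One)) (kern2 e e' :: 'a::euclidean_space \<Rightarrow> real) = 0"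
proof -
  let ?f = "\<lambda>_::'a. 1::real"
  have "((\<lambda>t. moll (kern1 e) 1 ?f (0 + t *\<^sub>R e')) has_vector_derivative (- 1 / 1) *\<^sub>R moll (kern2 e e') 1 ?f (0 + 0 *\<^sub>R e')) (at 0)"
    by (intro moll_directional_derivative kernel_kern1 kernel_kern2 kern1_derivative) auto
  moreover have "((\<lambda>t. moll (kern1 e) 1 ?f (0 + t *\<^sub>R e')) has_vector_derivative 0) (at 0)"
    by (simp add: moll_def)
  ultimately have "(- 1 / 1) *\<^sub>R moll (kern2 e e') 1 ?f (0 + 0 *\<^sub>R e') = 0"
    by (rule vector_derivative_unique_at)
  then show ?thesis by (simp add: moll_def)
qed

lemma integral_bump_power2_pos:
  "integral (cbox (- 3 *\<^sub>R One) (3 *\<^sub>R One)) (\<lambda>z::'a::euclidean_space. (bump z)\<^sup>2) > 0"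
proof -
  let ?Q = "cbox (- 3 *\<^sub>R One) (3 *\<^sub>R One) :: 'a set"
  have c: "continuous_on ?Q (\<lambda>z::'a. (bump z)\<^sup>2)" by (intro continuous_intros)
  have "integral ?Q (\<lambda>z. (bump z)\<^sup>2) \<ge> 0"
    by (intro integral_nonneg integrable_continuous c) auto
  moreover have "integral ?Q (\<lambda>z. (bump z)\<^sup>2) \<noteq> 0"
  proof
    assume 0: "integral ?Q (\<lambda>z. (bump z)\<^sup>2) = 0"
    have "((\<lambda>z. (bump z)\<^sup>2) has_integral 0) ?Q"
      using integrable_integral[OF integrable_continuous[OF c]] 0 by simp
    then have "(bump (0::'a))\<^sup>2 = 0"
      by (rule has_integral_0_cbox_imp_0[OF c, rotated 1]) (auto simp: mem_box box_ne_empty)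
    then show False by (simp add: bump_def)
  qed
  ultimately show ?thesis by linarith
qed

section \<open>Hoelder bounds for potentials\<close>

text \<open>One constant bounds both the sup norm and the Hoelder seminorm, so each estimate carries
  a single number. A predicate on plain functions takes the place of a norm, since \<open>X\<close>
  varies between the whole space and balls.\<close>

definition hoelder_le :: "real \<Rightarrow> 'a::metric_space set \<Rightarrow> real \<Rightarrow> ('a \<Rightarrow> 'b::real_normed_vector) \<Rightarrow> bool" where
  "hoelder_le \<alpha> X C f \<longleftrightarrow> (\<forall>x\<in>X. norm (f x) \<le> C) \<and> (\<forall>x\<in>X. \<forall>y\<in>X. norm (f x - f y) \<le> C * dist x y powr \<alpha>)"

lemma hoelder_leD:
  assumes "hoelder_le \<alpha> X C f"
  shows "x \<in> X \<Longrightarrow> norm (f x) \<le> C" "x \<in> X \<Longrightarrow> y \<in> X \<Longrightarrow> norm (f x - f y) \<le> C * dist x y powr \<alpha>"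
  using assms by (auto simp: hoelder_le_def)

lemma hoelder_le_continuous_on:
  assumes f: "hoelder_le \<alpha> X C f" and "\<alpha> > 0"
  shows "continuous_on X f"
  unfolding continuous_on_def
proof
  fix x assume x: "x \<in> X"
  have "((\<lambda>y. C * dist y x powr \<alpha>) \<longlongrightarrow> C * dist x x powr \<alpha>) (at x within X)"
    using \<open>\<alpha> > 0\<close> by (intro tendsto_intros tendsto_powr') auto
  then have "((\<lambda>y. C * dist y x powr \<alpha>) \<longlongrightarrow> 0) (at x within X)" using \<open>\<alpha> > 0\<close> by simp
  then have "((\<lambda>y. f y - f x) \<longlongrightarrow> 0) (at x within X)"
    by (rule Lim_null_comparison[rotated])
      (use hoelder_leD(2)[OF f _ x] in \<open>auto simp: eventually_at intro!: exI[of _ 1]\<close>)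
  then show "(f \<longlongrightarrow> f x) (at x within X)" by (simp add: LIM_zero_iff)
qed

abbreviation kernel_box_volume :: "'a::euclidean_space itself \<Rightarrow> real" where
  "kernel_box_volume _ \<equiv> measure lborel (cbox (- 3 *\<^sub>R One) (3 *\<^sub>R One) :: 'a set)"

lemma moll_integrable:
  fixes f :: "'a::euclidean_space \<Rightarrow> 'b::euclidean_space"
  assumes "kernel k" "continuous_on UNIV f"
  shows "(\<lambda>z. k (z - w) *\<^sub>R f (x + s *\<^sub>R z)) integrable_on cbox a b"
  by (intro integrable_continuous continuous_intros continuous_on_compose_UNIV[OF assms(2)] continuous_on_compose_UNIV[OF kernelD(1)[OF assms(1)]])

lemma moll_diff:
  fixes f g :: "'a::euclidean_space \<Rightarrow> 'b::euclidean_space"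
  assumes "kernel k" "continuous_on UNIV f" "continuous_on UNIV g"
  shows "moll k s (\<lambda>x. f x - g x) x = moll k s f x - moll k s g x"
  unfolding moll_def
  using moll_integrable[OF assms(1,2), of 0] moll_integrable[OF assms(1,3), of 0]
  by (simp add: scaleR_diff_right integral_diff)

lemma moll_sum_kernel:
  fixes f :: "'a::euclidean_space \<Rightarrow> 'b::euclidean_space"
  assumes "finite I" "\<And>i. i \<in> I \<Longrightarrow> kernel (k i)" "continuous_on UNIV f"
  shows "moll (\<lambda>z. \<Sum>i\<in>I. k i z) s f x = (\<Sum>i\<in>I. moll (k i) s f x)"
  unfolding moll_def scaleR_sum_left
  by (rule integral_sum[OF assms(1)]) (use moll_integrable[OF assms(2,3), of _ 0] in simp)

lemma moll_scale_kernel: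
  "moll (\<lambda>z. c * k z) s f x = c *\<^sub>R moll k s f x"
  unfolding moll_def by (simp flip: scaleR_scaleR)

section \<open>Cancellation estimates for kernels of mean zero\<close>

text \<open>A shifted kernel still has mean zero, so a constant may be subtracted from
  \<open>f\<close>. The constant is \<open>f x\<close> although the centre is
  \<open>x + s *\<^sub>R w\<close>: this common base point lets two centres be compared under one
  integral.\<close>

lemma moll_mean_zero:
  fixes f :: "'a::euclidean_space \<Rightarrow> 'b::euclidean_space"
  assumes k: "kernel k" and f: "continuous_on UNIV f" and w: "norm w \<le> 2"
    and mean: "integral (cbox (- 3 *\<^sub>R One) (3 *\<^sub>R One)) k = 0"
  shows "moll k s f (x + s *\<^sub>R w) =
    integral (cbox (- 3 *\<^sub>R One) (3 *\<^sub>R One)) (\<lambda>z. k (z - w) *\<^sub>R (f (x + s *\<^sub>R z) - f x))"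
proof -
  let ?Q = "cbox (- 3 *\<^sub>R One) (3 *\<^sub>R One) :: 'a set"
  have k0: "integral ?Q (\<lambda>z. k (z - w)) = 0"
    using moll_translate[OF k _ w, of "\<lambda>_. 1::real" s x] mean by (simp add: moll_def)
  have ki: "(\<lambda>z. k (z - w)) integrable_on ?Q"
    using moll_integrable[OF k, of "\<lambda>_. 1::real" w] by simp
  have "integral ?Q (\<lambda>z. k (z - w) *\<^sub>R (f (x + s *\<^sub>R z) - f x)) =
     integral ?Q (\<lambda>z. k (z - w) *\<^sub>R f (x + s *\<^sub>R z)) - integral ?Q (\<lambda>z. k (z - w) *\<^sub>R f x)"
    unfolding scaleR_diff_right
    by (rule integral_diff[OF moll_integrable[OF k f]]) (use integrable_on_scaleR_left[OF ki] in simp)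
  also have "integral ?Q (\<lambda>z. k (z - w) *\<^sub>R f x) = integral ?Q (\<lambda>z. k (z - w)) *\<^sub>R f x"
    by (rule integral_unique, rule has_integral_scaleR_left, rule integrable_integral[OF ki])
  finally show ?thesis using k0 moll_translate[OF k f w, of s x] by simp
qed

text \<open>The mean zero replaces values of \<open>f\<close> by increments over distances at most
  \<open>s\<close>. The gain \<open>s powr \<alpha>\<close> is what makes the weight
  \<open>1 / s\<close> integrable near scale 0.\<close>

lemma moll_bound:
  fixes f :: "'a::euclidean_space \<Rightarrow> 'b::euclidean_space"
  assumes k: "kernel k" and B: "\<And>z. \<bar>k z\<bar> \<le> B"
    and mean: "integral (cbox (- 3 *\<^sub>R One) (3 *\<^sub>R One)) k = 0"
    and f: "hoelder_le \<alpha> UNIV C f" and "\<alpha> > 0" and s: "s > 0"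
  shows "norm (moll k s f x) \<le> (B * (C * s powr \<alpha>)) * kernel_box_volume TYPE('a)"
proof -
  let ?Q = "cbox (- 3 *\<^sub>R One) (3 *\<^sub>R One) :: 'a set"
  have cf: "continuous_on UNIV f" by (rule hoelder_le_continuous_on[OF f \<open>\<alpha> > 0\<close>])
  have C: "C \<ge> 0" using hoelder_leD(1)[OF f, of 0] by (smt (verit) UNIV_I norm_ge_zero)
  have B0: "B \<ge> 0" using B[of 0] by linarith
  have "moll k s f x = integral ?Q (\<lambda>z. k z *\<^sub>R (f (x + s *\<^sub>R z) - f x))"
    using moll_mean_zero[OF k cf _ mean, of 0 s x] by simp
  also have "norm \<dots> \<le> (B * (C * s powr \<alpha>)) * measure lborel ?Q"
  proof (rule integrable_bound)
    show "(\<lambda>z. k z *\<^sub>R (f (x + s *\<^sub>R z) - f x)) integrable_on ?Q"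
      by (intro integrable_continuous continuous_intros continuous_on_compose_UNIV[OF cf] continuous_on_compose_UNIV[OF kernelD(1)[OF k]])
    fix z
    show "norm (k z *\<^sub>R (f (x + s *\<^sub>R z) - f x)) \<le> B * (C * s powr \<alpha>)"
    proof (cases "norm z > 1")
      case True then show ?thesis using k B0 C by (simp add: kernel_def)
    next
      case False
      have "norm (f (x + s *\<^sub>R z) - f x) \<le> C * dist (x + s *\<^sub>R z) x powr \<alpha>"
        by (rule hoelder_leD(2)[OF f]) auto
      also have "\<dots> \<le> C * s powr \<alpha>"
        using False s C \<open>\<alpha> > 0\<close> by (intro mult_left_mono powr_mono2) (auto simp: dist_norm mult_le_cancel_left2)
      finally show ?thesis using B[of z] B0 by (simp add: mult_mono)
    qed
  qed (use B0 C in auto)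
  finally show ?thesis .
qed

text \<open>With the common base point only the difference of two shifted kernels remains. It has
  size \<open>L * dist x y / s\<close> and lives within radius 2, where \<open>f\<close> varies by
  at most a multiple of \<open>s powr \<alpha>\<close>. The resulting
  \<open>s powr (\<alpha> - 1)\<close> is integrable against \<open>1 / s\<close> towards large
  scales.\<close>

lemma moll_lipschitz:
  fixes f :: "'a::euclidean_space \<Rightarrow> 'b::euclidean_space"
  assumes k: "kernel k" and L: "\<And>z w. \<bar>k z - k w\<bar> \<le> L * norm (z - w)"
    and mean: "integral (cbox (- 3 *\<^sub>R One) (3 *\<^sub>R One)) k = 0"
    and f: "hoelder_le \<alpha> UNIV C f" and \<alpha>: "0 < \<alpha>" "\<alpha> \<le> 1" and s: "s > 0" and xy: "dist x y \<le> s"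
  shows "norm (moll k s f x - moll k s f y) \<le> (L * (dist x y / s) * (C * (2 * s powr \<alpha>))) * kernel_box_volume TYPE('a)"
proof -
  let ?Q = "cbox (- 3 *\<^sub>R One) (3 *\<^sub>R One) :: 'a set"
  define w where "w = (1 / s) *\<^sub>R (y - x)"
  have w: "norm w = dist x y / s" using s by (simp add: w_def dist_norm norm_minus_commute)
  then have w1: "norm w \<le> 1" using xy s by simp
  have y: "y = x + s *\<^sub>R w" using s by (simp add: w_def)
  have cf: "continuous_on UNIV f" by (rule hoelder_le_continuous_on[OF f \<open>\<alpha> > 0\<close>])
  have C: "C \<ge> 0" using hoelder_leD(1)[OF f, of 0] by (smt (verit) UNIV_I norm_ge_zero)
  have "0 \<le> L * norm w" using L[of w 0] by simp
  have i: "(\<lambda>z. k (z - w) *\<^sub>R (f (x + s *\<^sub>R z) - f x)) integrable_on ?Q" for w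
    by (intro integrable_continuous continuous_intros continuous_on_compose_UNIV[OF cf] continuous_on_compose_UNIV[OF kernelD(1)[OF k]])
  have i': "(\<lambda>z. (k z - k (z - w)) *\<^sub>R (f (x + s *\<^sub>R z) - f x)) integrable_on ?Q"
    by (intro integrable_continuous continuous_intros continuous_on_compose_UNIV[OF cf] continuous_on_compose_UNIV[OF kernelD(1)[OF k]])
  have "moll k s f x - moll k s f y =
     integral ?Q (\<lambda>z. k (z - 0) *\<^sub>R (f (x + s *\<^sub>R z) - f x)) - integral ?Q (\<lambda>z. k (z - w) *\<^sub>R (f (x + s *\<^sub>R z) - f x))"
    unfolding y using moll_mean_zero[OF k cf _ mean, of 0 s x] moll_mean_zero[OF k cf _ mean, of w s x] w1
    by simp
  also have "\<dots> = integral ?Q (\<lambda>z. (k z - k (z - w)) *\<^sub>R (f (x + s *\<^sub>R z) - f x))"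
    by (subst integral_diff[OF i i, symmetric]) (simp add: scaleR_diff_left)
  also have "norm \<dots> \<le> (L * norm w * (C * (2 * s powr \<alpha>))) * measure lborel ?Q"
  proof (rule integrable_bound[OF _ i'])
    fix z
    show "norm ((k z - k (z - w)) *\<^sub>R (f (x + s *\<^sub>R z) - f x)) \<le> L * norm w * (C * (2 * s powr \<alpha>))"
    proof (cases "norm z > 2")
      case True
      then have "norm (z - w) > 1" using w1 norm_triangle_ineq2[of z w] by linarith
      then show ?thesis using k C True \<open>0 \<le> L * norm w\<close> by (simp add: kernel_def)
    next
      case False
      have "norm (f (x + s *\<^sub>R z) - f x) \<le> C * dist (x + s *\<^sub>R z) x powr \<alpha>"
        by (rule hoelder_leD(2)[OF f]) auto
      also have "\<dots> \<le> C * (2 * s) powr \<alpha>"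
        using False s C \<open>\<alpha> > 0\<close> by (intro mult_left_mono powr_mono2) (auto simp: dist_norm)
      also have "\<dots> \<le> C * (2 * s powr \<alpha>)"
        using powr_mono[of \<alpha> 1 2] s C \<alpha> by (intro mult_left_mono) (auto simp: powr_mult)
      finally have "norm (f (x + s *\<^sub>R z) - f x) \<le> C * (2 * s powr \<alpha>)" .
      moreover have "\<bar>k z - k (z - w)\<bar> \<le> L * norm w" using L[of z "z - w"] by simp
      ultimately show ?thesis using \<open>0 \<le> L * norm w\<close> unfolding norm_scaleR real_norm_def by (intro mult_mono) auto
    qed
  qed (use C \<open>0 \<le> L * norm w\<close> in auto)
  finally show ?thesis using w by simp
qed

text \<open>With \<open>s = \<sigma> ^ p\<close>, these are \<open>\<integral> s M(s) f ds\<close> and its first and second directional derivatives. The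
  substitution makes all integrands continuous up to \<open>\<sigma> = 0\<close> once \<open>p * \<alpha> \<ge> 2\<close>; at \<open>\<sigma> = 0\<close> itself the
  convention \<open>p / 0 = 0\<close> gives the right value.\<close>

definition pot0 :: "nat \<Rightarrow> real \<Rightarrow> ('a::euclidean_space \<Rightarrow> 'b::euclidean_space) \<Rightarrow> 'a \<Rightarrow> 'b" where
  "pot0 p S f x = integral {0..S} (\<lambda>\<sigma>. (p * \<sigma> ^ (2 * p - 1)) *\<^sub>R moll kern0 (\<sigma> ^ p) f x)"

definition pot1 :: "nat \<Rightarrow> real \<Rightarrow> 'a \<Rightarrow> ('a::euclidean_space \<Rightarrow> 'b::euclidean_space) \<Rightarrow> 'a \<Rightarrow> 'b" where
  "pot1 p S e f x = integral {0..S} (\<lambda>\<sigma>. (- p * \<sigma> ^ (p - 1)) *\<^sub>R moll (kern1 e) (\<sigma> ^ p) f x)"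

definition pot2 :: "nat \<Rightarrow> real \<Rightarrow> 'a \<Rightarrow> 'a \<Rightarrow> ('a::euclidean_space \<Rightarrow> 'b::euclidean_space) \<Rightarrow> 'a \<Rightarrow> 'b" where
  "pot2 p S e e' f x = integral {0..S} (\<lambda>\<sigma>. (p / \<sigma>) *\<^sub>R moll (kern2 e e') (\<sigma> ^ p) f x)"

lemma pot0_derivative:
  fixes f :: "'a::euclidean_space \<Rightarrow> 'b::euclidean_space"
  assumes f: "continuous_on UNIV f" and p: "p \<ge> 2"
  shows "((\<lambda>t. pot0 p S f (x + t *\<^sub>R e)) has_vector_derivative pot1 p S e f (x + t0 *\<^sub>R e)) (at t0)"
proof -
  have "((\<lambda>t. integral (cbox 0 S) (\<lambda>\<sigma>. (p * \<sigma> ^ (2 * p - 1)) *\<^sub>R moll kern0 (\<sigma> ^ p) f (x + t *\<^sub>R e))) has_vector_derivative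
      integral (cbox 0 S) (\<lambda>\<sigma>. (- p * \<sigma> ^ (p - 1)) *\<^sub>R moll (kern1 e) (\<sigma> ^ p) f (x + t0 *\<^sub>R e))) (at t0 within UNIV)"
  proof (rule leibniz_rule_vector_derivative[where
       fx = "\<lambda>t \<sigma>. (- p * \<sigma> ^ (p - 1)) *\<^sub>R moll (kern1 e) (\<sigma> ^ p) f (x + t *\<^sub>R e)"])
    fix t \<sigma> :: real assume "\<sigma> \<in> cbox 0 S"
    then consider "\<sigma> = 0" | "\<sigma> > 0" by fastforce
    then show "((\<lambda>t. (p * \<sigma> ^ (2 * p - 1)) *\<^sub>R moll kern0 (\<sigma> ^ p) f (x + t *\<^sub>R e)) has_vector_derivative
      (- p * \<sigma> ^ (p - 1)) *\<^sub>R moll (kern1 e) (\<sigma> ^ p) f (x + t *\<^sub>R e)) (at t within UNIV)"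
    proof cases
      case 1 then show ?thesis using p by (simp add: power_0_left)
    next
      case 2
      have "2 * p - 1 = p - 1 + p" using p by simp
      then have "\<sigma> ^ (2 * p - 1) / \<sigma> ^ p = \<sigma> ^ (p - 1)" using 2 by (simp only: power_add) simp
      then have eq: "(p * \<sigma> ^ (2 * p - 1)) *\<^sub>R (- 1 / \<sigma> ^ p) *\<^sub>R v = (- p * \<sigma> ^ (p - 1)) *\<^sub>R v" for v :: 'b
        by (simp add: divide_inverse mult.assoc)
      show ?thesis
        using bounded_linear.has_vector_derivative[OF bounded_linear_scaleR_right[of "p * \<sigma> ^ (2 * p - 1)"]
            moll_directional_derivative[OF kernel_kern0 kernel_kern1 kern0_derivative f, of "\<sigma> ^ p" x e t], unfolded eq] 2
        by (simp only: zero_less_power)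
    qed
  next
    show "(\<lambda>\<sigma>. (p * \<sigma> ^ (2 * p - 1)) *\<^sub>R moll kern0 (\<sigma> ^ p) f (x + t *\<^sub>R e)) integrable_on cbox 0 S" for t
      by (intro integrable_continuous continuous_intros moll_continuous[OF kernel_kern0 f])
    show "continuous_on (UNIV \<times> cbox 0 S) (\<lambda>(t, \<sigma>). (- p * \<sigma> ^ (p - 1)) *\<^sub>R moll (kern1 e) (\<sigma> ^ p) f (x + t *\<^sub>R e))"
      unfolding case_prod_unfold by (intro continuous_intros moll_continuous[OF kernel_kern1 f])
  qed auto
  then show ?thesis by (simp add: pot0_def[abs_def] pot1_def)
qed

text \<open>Joint continuity up to \<open>\<sigma> = 0\<close> is what differentiation under the
  scale integral needs. By \<open>moll_bound\<close> the integrand is of order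
  \<open>\<sigma> powr (p * \<alpha> - 1)\<close> uniformly in the position, and this exponent is at
  least 1.\<close>

lemma pot2_integrand_continuous:
  fixes f :: "'a::euclidean_space \<Rightarrow> 'b::euclidean_space"
  assumes f: "hoelder_le \<alpha> UNIV C f" and \<alpha>: "0 < \<alpha>" and p: "p * \<alpha> \<ge> 2"
  shows "continuous_on (UNIV \<times> {0..}) (\<lambda>(x, \<sigma>). (p / \<sigma>) *\<^sub>R moll (kern2 e e') (\<sigma> ^ p) f x)"
  unfolding continuous_on_def case_prod_unfold
proof safe
  fix x0 :: 'a and \<sigma>0 :: real assume "0 \<le> \<sigma>0"
  have cf: "continuous_on UNIV f" by (rule hoelder_le_continuous_on[OF f \<open>\<alpha> > 0\<close>])
  let ?G = "\<lambda>z. (p / snd z) *\<^sub>R moll (kern2 e e') (snd z ^ p) f (fst z)"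
  have p0: "p > 0" using p by (cases p) auto
  from \<open>0 \<le> \<sigma>0\<close> consider "\<sigma>0 > 0" | "\<sigma>0 = 0" by linarith
  then have "(?G \<longlongrightarrow> ?G (x0, \<sigma>0)) (at (x0, \<sigma>0) within UNIV \<times> {0..})"
  proof cases
    case 1
    have "continuous_on (UNIV \<times> {0<..}) ?G"
      by (intro continuous_intros moll_continuous[OF kernel_kern2 cf]) auto
    moreover have "open (UNIV \<times> {0::real<..} :: ('a \<times> real) set)" by (intro open_Times) auto
    ultimately have "isCont ?G (x0, \<sigma>0)"
      using 1 by (auto simp: continuous_on_eq_continuous_at)
    then show ?thesis unfolding isCont_def
      by (rule tendsto_within_subset) simp
  next
    case 2
    define K where "K = p * (5 * norm e * norm e' * C * kernel_box_volume TYPE('a))"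
    have C: "C \<ge> 0" using hoelder_leD(1)[OF f, of 0] by (smt (verit) UNIV_I norm_ge_zero)
    have "((\<lambda>z. K * snd z powr (p * \<alpha> - 1)) \<longlongrightarrow> K * snd (x0, \<sigma>0) powr (p * \<alpha> - 1)) (at (x0, \<sigma>0) within UNIV \<times> {0..})"
      using p by (intro tendsto_intros tendsto_powr') (auto simp: eventually_at_filter intro!: always_eventually)
    then have "((\<lambda>z. K * snd z powr (p * \<alpha> - 1)) \<longlongrightarrow> 0) (at (x0, \<sigma>0) within UNIV \<times> {0..})"
      using 2 p by simp
    then have "(?G \<longlongrightarrow> 0) (at (x0, \<sigma>0) within UNIV \<times> {0..})"
    proof (rule Lim_null_comparison[rotated])
      have "norm (?G (x, \<sigma>)) \<le> K * \<sigma> powr (p * \<alpha> - 1)" if "\<sigma> \<ge> 0" for x \<sigma>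
      proof (cases "\<sigma> = 0")
        case False
        then have s: "\<sigma> > 0" using that by simp
        have "norm (?G (x, \<sigma>)) = p / \<sigma> * norm (moll (kern2 e e') (\<sigma> ^ p) f x)" using s by simp
        also have "\<dots> \<le> p / \<sigma> * ((5 * norm e * norm e' * (C * (\<sigma> ^ p) powr \<alpha>)) * kernel_box_volume TYPE('a))"
          using s by (intro mult_left_mono moll_bound[OF kernel_kern2 kern2_bound integral_kern2 f \<alpha>]) auto
        also have "\<dots> = K * ((\<sigma> ^ p) powr \<alpha> / \<sigma>)" by (simp add: K_def)
        also have "(\<sigma> ^ p) powr \<alpha> / \<sigma> = \<sigma> powr (p * \<alpha> - 1)"
          using s by (simp add: powr_realpow[symmetric] powr_powr powr_diff)
        finally show ?thesis .
      qed simp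
      then show "\<forall>\<^sub>F z in at (x0, \<sigma>0) within UNIV \<times> {0..}. norm (?G z) \<le> K * snd z powr (p * \<alpha> - 1)"
        by (auto simp: eventually_at_filter intro!: always_eventually)
    qed
    then show ?thesis using 2 by simp
  qed
  then show "((\<lambda>x. (p / snd x) *\<^sub>R moll (kern2 e e') (snd x ^ p) f (fst x)) \<longlongrightarrow>
       (p / snd (x0, \<sigma>0)) *\<^sub>R moll (kern2 e e') (snd (x0, \<sigma>0) ^ p) f (fst (x0, \<sigma>0))) (at (x0, \<sigma>0) within UNIV \<times> {0..})" .
qed

lemma pot1_derivative:
  fixes f :: "'a::euclidean_space \<Rightarrow> 'b::euclidean_space"
  assumes f: "hoelder_le \<alpha> UNIV C f" and \<alpha>: "0 < \<alpha>" and p: "p * \<alpha> \<ge> 2" and p2: "p \<ge> 2"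
  shows "((\<lambda>t. pot1 p S e f (x + t *\<^sub>R e')) has_vector_derivative pot2 p S e e' f (x + t0 *\<^sub>R e')) (at t0)"
proof -
  have cf: "continuous_on UNIV f" by (rule hoelder_le_continuous_on[OF f \<open>\<alpha> > 0\<close>])
  have "((\<lambda>t. integral (cbox 0 S) (\<lambda>\<sigma>. (- p * \<sigma> ^ (p - 1)) *\<^sub>R moll (kern1 e) (\<sigma> ^ p) f (x + t *\<^sub>R e'))) has_vector_derivative
      integral (cbox 0 S) (\<lambda>\<sigma>. (p / \<sigma>) *\<^sub>R moll (kern2 e e') (\<sigma> ^ p) f (x + t0 *\<^sub>R e'))) (at t0 within UNIV)"
  proof (rule leibniz_rule_vector_derivative[where
       fx = "\<lambda>t \<sigma>. (p / \<sigma>) *\<^sub>R moll (kern2 e e') (\<sigma> ^ p) f (x + t *\<^sub>R e')"])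
    fix t \<sigma> :: real assume "\<sigma> \<in> cbox 0 S"
    then consider "\<sigma> = 0" | "\<sigma> > 0" by fastforce
    then show "((\<lambda>t. (- p * \<sigma> ^ (p - 1)) *\<^sub>R moll (kern1 e) (\<sigma> ^ p) f (x + t *\<^sub>R e')) has_vector_derivative
      (p / \<sigma>) *\<^sub>R moll (kern2 e e') (\<sigma> ^ p) f (x + t *\<^sub>R e')) (at t within UNIV)"
    proof cases
      case 1 then show ?thesis using p2 by (simp add: power_0_left)
    next
      case 2
      have "\<sigma> ^ p = \<sigma> * \<sigma> ^ (p - 1)" using p2 by (cases p) auto
      then have "\<sigma> ^ (p - 1) / \<sigma> ^ p = 1 / \<sigma>" using 2 by simp
      then have eq: "(- p * \<sigma> ^ (p - 1)) *\<^sub>R (- 1 / \<sigma> ^ p) *\<^sub>R v = (p / \<sigma>) *\<^sub>R v" for v :: 'b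
        by (simp add: divide_inverse mult.assoc)
      show ?thesis
        using bounded_linear.has_vector_derivative[OF bounded_linear_scaleR_right[of "- p * \<sigma> ^ (p - 1)"]
            moll_directional_derivative[OF kernel_kern1 kernel_kern2 kern1_derivative cf, of "\<sigma> ^ p" e x e' t], unfolded eq] 2
        by (simp only: zero_less_power)
    qed
  next
    show "(\<lambda>\<sigma>. (- p * \<sigma> ^ (p - 1)) *\<^sub>R moll (kern1 e) (\<sigma> ^ p) f (x + t *\<^sub>R e')) integrable_on cbox 0 S" for t
      by (intro integrable_continuous continuous_intros moll_continuous[OF kernel_kern1 cf])
    have "continuous_on (UNIV \<times> cbox 0 S) (\<lambda>z. (\<lambda>(x, \<sigma>). (p / \<sigma>) *\<^sub>R moll (kern2 e e') (\<sigma> ^ p) f x) (x + fst z *\<^sub>R e', snd z))"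
      by (rule continuous_on_compose2[OF pot2_integrand_continuous[OF f \<alpha> p]]) (auto intro!: continuous_intros)
    then show "continuous_on (UNIV \<times> cbox 0 S) (\<lambda>(t, \<sigma>). (p / \<sigma>) *\<^sub>R moll (kern2 e e') (\<sigma> ^ p) f (x + t *\<^sub>R e'))"
      by (simp add: case_prod_unfold)
  qed auto
  then show ?thesis by (simp add: pot1_def[abs_def] pot2_def)
qed

section \<open>Hoelder estimate for the second derivatives of the potential\<close>

text \<open>Under \<open>s = \<sigma> ^ p\<close> this is the integral of
  \<open>s powr (a - 1)\<close> over scales up to \<open>S ^ p\<close>.\<close>

lemma powr_integral_from_0:
  assumes "a > 0" "S \<ge> 0" "p > 0"
  shows "((\<lambda>\<sigma>::real. A * (p * \<sigma> powr (p * a - 1))) has_integral A * (S powr (p * a) / a)) {0..S}"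
proof (rule has_integral_mult_right)
  have "((\<lambda>\<sigma>::real. p * \<sigma> powr (p * a - 1)) has_integral S powr (p * a) / a - 0 powr (p * a) / a) {0..S}"
  proof (rule fundamental_theorem_of_calculus_interior[OF \<open>S \<ge> 0\<close>])
    show "continuous_on {0..S} (\<lambda>\<sigma>. \<sigma> powr (p * a) / a)"
      using assms by (intro continuous_intros continuous_on_powr') auto
    fix \<sigma> assume "\<sigma> \<in> {0<..<S}"
    then show "((\<lambda>\<sigma>. \<sigma> powr (p * a) / a) has_vector_derivative p * \<sigma> powr (p * a - 1)) (at \<sigma>)"
      unfolding has_real_derivative_iff_has_vector_derivative[symmetric]
      using assms by (auto intro!: derivative_eq_intros)
  qed
  then show "((\<lambda>\<sigma>::real. p * \<sigma> powr (p * a - 1)) has_integral S powr (p * a) / a) {0..S}"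
    using assms by simp
qed

lemma powr_integral_tail:
  assumes "a < 0" "0 < \<tau>" "\<tau> \<le> S" "p > 0"
  shows "((\<lambda>\<sigma>::real. A * (p * \<sigma> powr (p * a - 1))) has_integral A * ((\<tau> powr (p * a) - S powr (p * a)) / - a)) {\<tau>..S}"
proof (rule has_integral_mult_right)
  have "((\<lambda>\<sigma>::real. p * \<sigma> powr (p * a - 1)) has_integral S powr (p * a) / a - \<tau> powr (p * a) / a) {\<tau>..S}"
  proof (rule fundamental_theorem_of_calculus[OF \<open>\<tau> \<le> S\<close>])
    fix \<sigma> assume "\<sigma> \<in> {\<tau>..S}"
    then show "((\<lambda>\<sigma>. \<sigma> powr (p * a) / a) has_vector_derivative p * \<sigma> powr (p * a - 1)) (at \<sigma> within {\<tau>..S})"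
      unfolding has_real_derivative_iff_has_vector_derivative[symmetric]
      using assms by (auto intro!: derivative_eq_intros)
  qed
  also have "S powr (p * a) / a - \<tau> powr (p * a) / a = (\<tau> powr (p * a) - S powr (p * a)) / - a"
    using assms by (simp add: field_simps)
  finally show "((\<lambda>\<sigma>::real. p * \<sigma> powr (p * a - 1)) has_integral (\<tau> powr (p * a) - S powr (p * a)) / - a) {\<tau>..S}" .
qed

lemma pot2_integrand_integrable:
  fixes f :: "'a::euclidean_space \<Rightarrow> 'b::euclidean_space"
  assumes f: "hoelder_le \<alpha> UNIV C f" and \<alpha>: "0 < \<alpha>" and p: "p * \<alpha> \<ge> 2" and "0 \<le> u"
  shows "(\<lambda>\<sigma>. (p / \<sigma>) *\<^sub>R moll (kern2 e e') (\<sigma> ^ p) f x) integrable_on {u..v}"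
proof -
  have "continuous_on {u..v} (\<lambda>\<sigma>. (\<lambda>(x, \<sigma>). (p / \<sigma>) *\<^sub>R moll (kern2 e e') (\<sigma> ^ p) f x) (x, \<sigma>))"
    by (rule continuous_on_compose2[OF pot2_integrand_continuous[OF f \<alpha> p]]) (use \<open>0 \<le> u\<close> in \<open>auto intro!: continuous_intros\<close>)
  then show ?thesis by (intro integrable_continuous_real) simp
qed

lemma pot2_head_bound:
  fixes f :: "'a::euclidean_space \<Rightarrow> 'b::euclidean_space"
  assumes f: "hoelder_le \<alpha> UNIV C f" and \<alpha>: "0 < \<alpha>" and p: "p * \<alpha> \<ge> 2" and S: "0 \<le> S"
    and e: "norm e \<le> 1" "norm e' \<le> 1"
  shows "norm (integral {0..S} (\<lambda>\<sigma>. (p / \<sigma>) *\<^sub>R moll (kern2 e e') (\<sigma> ^ p) f x))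
    \<le> 5 * C * kernel_box_volume TYPE('a) * (S powr (p * \<alpha>) / \<alpha>)"
proof -
  define A where "A = 5 * C * kernel_box_volume TYPE('a)"
  have p0: "p > 0" using p by (cases p) auto
  have C: "C \<ge> 0" using hoelder_leD(1)[OF f, of 0] by (smt (verit) UNIV_I norm_ge_zero)
  have I: "((\<lambda>\<sigma>. A * (p * \<sigma> powr (p * \<alpha> - 1))) has_integral A * (S powr (p * \<alpha>) / \<alpha>)) {0..S}"
    by (rule powr_integral_from_0) (use \<alpha> S p0 in auto)
  have "norm (integral {0..S} (\<lambda>\<sigma>. (p / \<sigma>) *\<^sub>R moll (kern2 e e') (\<sigma> ^ p) f x))
     \<le> integral {0..S} (\<lambda>\<sigma>. A * (p * \<sigma> powr (p * \<alpha> - 1)))"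
  proof (rule integral_norm_bound_integral)
    fix \<sigma> assume "\<sigma> \<in> {0..S}"
    then consider "\<sigma> = 0" | "\<sigma> > 0" by fastforce
    then show "norm ((p / \<sigma>) *\<^sub>R moll (kern2 e e') (\<sigma> ^ p) f x) \<le> A * (p * \<sigma> powr (p * \<alpha> - 1))"
    proof cases
      case 2
      have "norm e * norm e' \<le> 1" using e by (simp add: mult_le_one)
      then have kb: "\<bar>kern2 e e' z\<bar> \<le> 5" for z using kern2_bound[of e e' z] by linarith
      have "norm ((p / \<sigma>) *\<^sub>R moll (kern2 e e') (\<sigma> ^ p) f x) = p / \<sigma> * norm (moll (kern2 e e') (\<sigma> ^ p) f x)" using 2 by simp
      also have "\<dots> \<le> p / \<sigma> * ((5 * (C * (\<sigma> ^ p) powr \<alpha>)) * kernel_box_volume TYPE('a))"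
        using 2 by (intro mult_left_mono moll_bound[OF kernel_kern2 kb integral_kern2 f \<alpha>]) auto
      also have "\<dots> = A * (p * ((\<sigma> ^ p) powr \<alpha> / \<sigma>))" by (simp add: A_def)
      also have "(\<sigma> ^ p) powr \<alpha> / \<sigma> = \<sigma> powr (p * \<alpha> - 1)"
        using 2 by (simp add: powr_realpow[symmetric] powr_powr powr_diff)
      finally show ?thesis .
    qed simp
  qed (use I pot2_integrand_integrable[OF f \<alpha> p] in \<open>auto intro: has_integral_integrable\<close>)
  also have "\<dots> = A * (S powr (p * \<alpha>) / \<alpha>)" using I by (rule integral_unique)
  finally show ?thesis by (simp only: A_def)
qed

text \<open>\<open>\<tau>\<close> is the parameter at which the scale equals
  \<open>dist x y\<close>. Above it the integrand is of order
  \<open>dist x y * s powr (\<alpha> - 2)\<close>, whose integral up to infinity is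
  \<open>dist x y powr \<alpha> / (1 - \<alpha>)\<close>; hence a bound independent of
  \<open>S\<close>. The factor 40 is the kernel's Lipschitz constant 20 times the 2 of
  \<open>moll_lipschitz\<close>.\<close>

lemma pot2_tail_bound:
  fixes f :: "'a::euclidean_space \<Rightarrow> 'b::euclidean_space"
  assumes f: "hoelder_le \<alpha> UNIV C f" and \<alpha>: "0 < \<alpha>" "\<alpha> < 1" and p: "p * \<alpha> \<ge> 2"
    and e: "norm e \<le> 1" "norm e' \<le> 1" and xy: "x \<noteq> y" and \<tau>: "\<tau> = dist x y powr (1 / p)" "\<tau> \<le> S"
  shows "norm (integral {\<tau>..S} (\<lambda>\<sigma>. (p / \<sigma>) *\<^sub>R moll (kern2 e e') (\<sigma> ^ p) f x)
     - integral {\<tau>..S} (\<lambda>\<sigma>. (p / \<sigma>) *\<^sub>R moll (kern2 e e') (\<sigma> ^ p) f y))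
    \<le> 40 * C * kernel_box_volume TYPE('a) * (dist x y powr \<alpha> / (1 - \<alpha>))"
proof -
  define d where "d = dist x y"
  define A where "A = 40 * C * kernel_box_volume TYPE('a)"
  let ?G = "\<lambda>x \<sigma>. (p / \<sigma>) *\<^sub>R moll (kern2 e e') (\<sigma> ^ p) f x"
  have d: "d > 0" using xy by (simp add: d_def)
  have p0: "p > 0" using p by (cases p) auto
  have t0: "\<tau> > 0" using \<tau> xy by simp
  have tp: "\<tau> ^ p = d" using \<tau> d p0 by (simp add: d_def powr_realpow[symmetric] powr_powr)
  have C: "C \<ge> 0" using hoelder_leD(1)[OF f, of 0] by (smt (verit) UNIV_I norm_ge_zero)
  have A: "A \<ge> 0" unfolding A_def by (intro mult_nonneg_nonneg C measure_nonneg) auto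
  have int: "?G x integrable_on {\<tau>..S}" for x
    by (rule pot2_integrand_integrable[OF f \<open>0 < \<alpha>\<close> p]) (use t0 in simp)
  have I: "((\<lambda>\<sigma>. (A * d) * (p * \<sigma> powr (p * (\<alpha> - 1) - 1))) has_integral (A * d) * ((\<tau> powr (p * (\<alpha> - 1)) - S powr (p * (\<alpha> - 1))) / - (\<alpha> - 1))) {\<tau>..S}"
    by (rule powr_integral_tail) (use \<alpha> t0 \<tau> p0 in auto)
  have "norm (integral {\<tau>..S} (?G x) - integral {\<tau>..S} (?G y)) = norm (integral {\<tau>..S} (\<lambda>\<sigma>. ?G x \<sigma> - ?G y \<sigma>))"
    by (simp add: integral_diff int)
  also have "\<dots> \<le> integral {\<tau>..S} (\<lambda>\<sigma>. (A * d) * (p * \<sigma> powr (p * (\<alpha> - 1) - 1)))"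
  proof (rule integral_norm_bound_integral)
    fix \<sigma> assume s: "\<sigma> \<in> {\<tau>..S}"
    then have s0: "\<sigma> > 0" using t0 by auto
    have "norm e * norm e' \<le> 1" using e by (simp add: mult_le_one)
    then have "20 * norm e * norm e' * norm (z - w) \<le> 20 * norm (z - w)" for z w :: 'a
      by (metis mult.assoc mult_left_mono mult_right_mono norm_ge_zero mult.right_neutral zero_le_numeral)
    then have kl: "\<bar>kern2 e e' z - kern2 e e' w\<bar> \<le> 20 * norm (z - w)" for z w
      using kern2_lipschitz[of e e' z w] order_trans by blast
    have ds: "dist x y \<le> \<sigma> ^ p" using power_mono[of \<tau> \<sigma> p] s t0 tp by (simp add: d_def)
    have "norm (?G x \<sigma> - ?G y \<sigma>) = p / \<sigma> * norm (moll (kern2 e e') (\<sigma> ^ p) f x - moll (kern2 e e') (\<sigma> ^ p) f y)"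
      using s0 by (simp flip: scaleR_diff_right)
    also have "\<dots> \<le> p / \<sigma> * ((20 * (dist x y / \<sigma> ^ p) * (C * (2 * (\<sigma> ^ p) powr \<alpha>))) * kernel_box_volume TYPE('a))"
      using s0 \<alpha> ds by (intro mult_left_mono moll_lipschitz[OF kernel_kern2 kl integral_kern2 f]) auto
    also have "\<dots> = (A * d) * (p * ((\<sigma> ^ p) powr \<alpha> / \<sigma> ^ p / \<sigma>))" by (simp add: A_def d_def mult_ac)
    also have "(\<sigma> ^ p) powr \<alpha> / \<sigma> ^ p / \<sigma> = \<sigma> powr (p * (\<alpha> - 1) - 1)"
      using s0 by (simp add: powr_realpow[symmetric] powr_powr powr_diff right_diff_distrib)
    finally show "norm (?G x \<sigma> - ?G y \<sigma>) \<le> (A * d) * (p * \<sigma> powr (p * (\<alpha> - 1) - 1))" .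
  qed (use I int in \<open>auto intro: has_integral_integrable integrable_diff\<close>)
  also have "\<dots> = (A * d) * ((\<tau> powr (p * (\<alpha> - 1)) - S powr (p * (\<alpha> - 1))) / - (\<alpha> - 1))" using I by (rule integral_unique)
  also have "\<dots> \<le> (A * d) * (\<tau> powr (p * (\<alpha> - 1)) / - (\<alpha> - 1))"
    using A d \<alpha> by (intro mult_left_mono divide_right_mono) auto
  also have "\<tau> powr (p * (\<alpha> - 1)) = d powr (\<alpha> - 1)" using \<tau> p0 by (simp add: d_def powr_powr)
  also have "(A * d) * (d powr (\<alpha> - 1) / - (\<alpha> - 1)) = A * (d powr \<alpha> / (1 - \<alpha>))"
    using d by (simp add: powr_diff)
  finally show ?thesis by (simp only: A_def d_def)
qed

text \<open>Scales below \<open>dist x y\<close> are estimated by the cancellation in the kernel, scales above by its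
  Lipschitz continuity.\<close>

lemma pot2_hoelder:
  fixes f :: "'a::euclidean_space \<Rightarrow> 'b::euclidean_space"
  assumes f: "hoelder_le \<alpha> UNIV C f" and \<alpha>: "0 < \<alpha>" "\<alpha> < 1" and p: "p * \<alpha> \<ge> 2" and S: "1 \<le> S"
    and e: "norm e \<le> 1" "norm e' \<le> 1"
  shows "hoelder_le \<alpha> UNIV ((kernel_box_volume TYPE('a) * (S powr (p * \<alpha>) * 10 / \<alpha> + 40 / (1 - \<alpha>))) * C) (pot2 p S e e' f)"
proof -
  let ?G = "\<lambda>x \<sigma>. (p / \<sigma>) *\<^sub>R moll (kern2 e e') (\<sigma> ^ p) f x"
  let ?V = "kernel_box_volume TYPE('a)"
  have p0: "p > 0" using p by (cases p) auto
  have C: "C \<ge> 0" using hoelder_leD(1)[OF f, of 0] by (smt (verit) UNIV_I norm_ge_zero)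
  note head = pot2_head_bound[OF f \<alpha>(1) p _ e]
  have S1: "S powr (p * \<alpha>) \<ge> 1" using S p \<alpha> by (intro ge_one_powr_ge_zero) auto
  define P where "P = ?V * C"
  have P: "P \<ge> 0" unfolding P_def by (intro mult_nonneg_nonneg C measure_nonneg)
  have K: "(?V * (S powr (p * \<alpha>) * 10 / \<alpha> + 40 / (1 - \<alpha>))) * C = P * (S powr (p * \<alpha>) / \<alpha>) * 10 + P * (40 / (1 - \<alpha>))"
    by (simp add: P_def algebra_simps)
  have P1: "P * (40 / (1 - \<alpha>)) \<ge> 0" "P * (S powr (p * \<alpha>) / \<alpha>) \<ge> 0" using P \<alpha> by auto
  show ?thesis
    unfolding hoelder_le_def K
  proof (intro conjI ballI)
    fix x
    show "norm (pot2 p S e e' f x) \<le> P * (S powr (p * \<alpha>) / \<alpha>) * 10 + P * (40 / (1 - \<alpha>))"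
    proof -
      have "norm (pot2 p S e e' f x) \<le> 5 * (P * (S powr (p * \<alpha>) / \<alpha>))"
        using head[of S x] S by (simp add: pot2_def P_def mult_ac)
      moreover have "5 * u \<le> u * 10 + v" if "v \<ge> 0" "u \<ge> 0" for u v :: real using that by linarith
      ultimately show ?thesis using P1 by (meson order_trans)
    qed
    fix y
    show "norm (pot2 p S e e' f x - pot2 p S e e' f y) \<le> (P * (S powr (p * \<alpha>) / \<alpha>) * 10 + P * (40 / (1 - \<alpha>))) * dist x y powr \<alpha>"
    proof (cases "x = y")
      case False
      define d where "d = dist x y"
      have d: "d > 0" using False by (simp add: d_def)
      define \<tau> where "\<tau> = d powr (1 / p)"
      have t0: "\<tau> > 0" using d by (simp add: \<tau>_def)
      have tp: "\<tau> powr (p * \<alpha>) = d powr \<alpha>" using p0 by (simp add: \<tau>_def powr_powr)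
      have h: "norm (integral {0..u} (?G x) - integral {0..u} (?G y)) \<le> 10 * (P * (u powr (p * \<alpha>) / \<alpha>))" if "0 \<le> u" for u
    proof -
      have "norm (integral {0..u} (?G z)) \<le> 5 * (P * (u powr (p * \<alpha>) / \<alpha>))" for z
        using head[OF that, of z] by (simp add: P_def mult_ac)
      then have "norm (integral {0..u} (?G x)) + norm (integral {0..u} (?G y))
          \<le> 5 * (P * (u powr (p * \<alpha>) / \<alpha>)) + 5 * (P * (u powr (p * \<alpha>) / \<alpha>))"
        by (intro add_mono)
      also have "\<dots> = 10 * (P * (u powr (p * \<alpha>) / \<alpha>))" by simp
      finally show ?thesis
        using norm_triangle_ineq4 order_trans by blast
    qed
      have h2: "norm (pot2 p S e e' f x - pot2 p S e e' f y) \<le> 10 * (P * (d powr \<alpha> / \<alpha>)) + 40 * P * (d powr \<alpha> / (1 - \<alpha>))"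
      proof (cases "\<tau> \<le> S")
        \<comment> \<open>Every scale in the integral lies below \<open>dist x y\<close>, so the
          cancellation bound alone yields the power of the distance.\<close>
        case False
        have "S powr (p * \<alpha>) \<le> \<tau> powr (p * \<alpha>)" using False S p by (intro powr_mono2) auto
        then have "10 * (P * (S powr (p * \<alpha>) / \<alpha>)) \<le> 10 * (P * (d powr \<alpha> / \<alpha>))"
          unfolding tp using P \<alpha> by (intro mult_left_mono divide_right_mono) auto
        moreover have "40 * P * (d powr \<alpha> / (1 - \<alpha>)) \<ge> 0" using P \<alpha> by auto
        ultimately show ?thesis using h[of S] S unfolding pot2_def by simp
      next
        case True
        have c: "pot2 p S e e' f z = integral {0..\<tau>} (?G z) + integral {\<tau>..S} (?G z)" for z
          unfolding pot2_def
          by (rule Henstock_Kurzweil_Integration.integral_combine[symmetric])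
            (use t0 True pot2_integrand_integrable[OF f \<alpha>(1) p] in auto)
        have "norm (pot2 p S e e' f x - pot2 p S e e' f y) \<le> norm (integral {0..\<tau>} (?G x) - integral {0..\<tau>} (?G y)) + norm (integral {\<tau>..S} (?G x) - integral {\<tau>..S} (?G y))"
          unfolding c by (rule norm_diff_triangle_ineq)
        also have "\<dots> \<le> 10 * (P * (d powr \<alpha> / \<alpha>)) + 40 * P * (d powr \<alpha> / (1 - \<alpha>))"
        proof (rule add_mono)
          show "norm (integral {0..\<tau>} (?G x) - integral {0..\<tau>} (?G y)) \<le> 10 * (P * (d powr \<alpha> / \<alpha>))"
            using h[of \<tau>] t0 unfolding tp by simp
          have "norm (integral {\<tau>..S} (?G x) - integral {\<tau>..S} (?G y)) \<le> 40 * C * ?V * (d powr \<alpha> / (1 - \<alpha>))"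
            unfolding d_def by (rule pot2_tail_bound[OF f \<alpha> p e False _ True]) (simp add: \<tau>_def d_def)
          also have "\<dots> = 40 * P * (d powr \<alpha> / (1 - \<alpha>))" by (simp only: P_def mult_ac)
          finally show "norm (integral {\<tau>..S} (?G x) - integral {\<tau>..S} (?G y)) \<le> 40 * P * (d powr \<alpha> / (1 - \<alpha>))" .
        qed
        finally show ?thesis .
      qed
      also have "\<dots> = (P * (1 / \<alpha>) * 10 + P * (40 / (1 - \<alpha>))) * d powr \<alpha>" by (simp add: algebra_simps)
      also have "\<dots> \<le> (P * (S powr (p * \<alpha>) / \<alpha>) * 10 + P * (40 / (1 - \<alpha>))) * d powr \<alpha>"
        using P S1 \<alpha> by (intro mult_right_mono add_mono mult_left_mono divide_right_mono) auto
      finally show ?thesis by (simp only: d_def)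
    qed simp
  qed
qed

lemma pot_diff:
  fixes f g :: "'a::euclidean_space \<Rightarrow> 'b::euclidean_space"
  assumes f: "hoelder_le \<alpha> UNIV C f" and g: "hoelder_le \<alpha> UNIV C' g" and \<alpha>: "0 < \<alpha>" and p: "p * \<alpha> \<ge> 2"
  shows "pot0 p S (\<lambda>x. f x - g x) x = pot0 p S f x - pot0 p S g x"
    and "pot1 p S e (\<lambda>x. f x - g x) x = pot1 p S e f x - pot1 p S e g x"
    and "pot2 p S e e' (\<lambda>x. f x - g x) x = pot2 p S e e' f x - pot2 p S e e' g x"
proof -
  note c = hoelder_le_continuous_on[OF f \<alpha>] hoelder_le_continuous_on[OF g \<alpha>]
  note d = moll_diff[OF kernel_kern0 c] moll_diff[OF kernel_kern1 c] moll_diff[OF kernel_kern2 c]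
  show "pot0 p S (\<lambda>x. f x - g x) x = pot0 p S f x - pot0 p S g x"
    unfolding pot0_def d scaleR_diff_right
    by (rule integral_diff; intro integrable_continuous_real continuous_intros moll_continuous[OF kernel_kern0] c)
  show "pot1 p S e (\<lambda>x. f x - g x) x = pot1 p S e f x - pot1 p S e g x"
    unfolding pot1_def d scaleR_diff_right
    by (rule integral_diff; intro integrable_continuous_real continuous_intros moll_continuous[OF kernel_kern1] c)
  show "pot2 p S e e' (\<lambda>x. f x - g x) x = pot2 p S e e' f x - pot2 p S e e' g x"
    unfolding pot2_def d scaleR_diff_right
    by (rule integral_diff; rule pot2_integrand_integrable[OF f \<alpha> p] pot2_integrand_integrable[OF g \<alpha> p]) auto
qed

lemma kernel_scale: "kernel k \<Longrightarrow> kernel (\<lambda>z. c * k z)"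
  by (auto simp: kernel_def intro!: continuous_intros)

text \<open>The kernel is linear in its direction, and the potential inherits this. Such linearity
  is what lets finitely many continuous partial derivatives determine the Frechet
  derivative.\<close>

lemma pot1_sum:
  fixes f :: "'a::euclidean_space \<Rightarrow> 'b::euclidean_space"
  assumes f: "continuous_on UNIV f"
  shows "pot1 p S e f x = (\<Sum>b\<in>Basis. (e \<bullet> b) *\<^sub>R pot1 p S b f x)"
proof -
  have "kern1 e = (\<lambda>z. \<Sum>b\<in>Basis. (e \<bullet> b) * kern1 b z)"
  proof
    fix z :: 'a
    have "z \<bullet> e = (\<Sum>b\<in>Basis. (e \<bullet> b) * (z \<bullet> b))"
      by (simp add: euclidean_inner[of _ e] mult_ac)
    then show "kern1 e z = (\<Sum>b\<in>Basis. (e \<bullet> b) * kern1 b z)"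
      by (simp add: kern1_def sum_negf sum_distrib_left mult_ac)
  qed
  then have "moll (kern1 e) s f x = (\<Sum>b\<in>Basis. (e \<bullet> b) *\<^sub>R moll (kern1 b) s f x)" for s
    using moll_sum_kernel[of Basis "\<lambda>b z. (e \<bullet> b) * kern1 b z", OF _ kernel_scale[OF kernel_kern1] f]
    by (simp add: moll_scale_kernel)
  then have "pot1 p S e f x = integral {0..S} (\<lambda>\<sigma>. \<Sum>b\<in>Basis. (e \<bullet> b) *\<^sub>R ((- real p * \<sigma> ^ (p - 1)) *\<^sub>R moll (kern1 b) (\<sigma> ^ p) f x))"
    unfolding pot1_def by (simp add: scaleR_sum_right mult.commute)
  also have "\<dots> = (\<Sum>b\<in>Basis. integral {0..S} (\<lambda>\<sigma>. (e \<bullet> b) *\<^sub>R ((- real p * \<sigma> ^ (p - 1)) *\<^sub>R moll (kern1 b) (\<sigma> ^ p) f x)))"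
    by (intro integral_sum integrable_continuous_real continuous_intros moll_continuous[OF kernel_kern1 f]) auto
  finally show ?thesis by (simp only: pot1_def integral_cmul)
qed

lemma pot2_commute: "pot2 p S e e' f = pot2 p S e' e f"
  unfolding pot2_def by (subst kern2_commute) (rule refl)

lemma pot2_sum:
  fixes f :: "'a::euclidean_space \<Rightarrow> 'b::euclidean_space"
  assumes f: "hoelder_le \<alpha> UNIV C f" and \<alpha>: "0 < \<alpha>" and p: "p * \<alpha> \<ge> 2"
  shows "pot2 p S e' e f x = (\<Sum>b\<in>Basis. (e \<bullet> b) *\<^sub>R pot2 p S e' b f x)"
proof -
  have cf: "continuous_on UNIV f" by (rule hoelder_le_continuous_on[OF f \<alpha>])
  have "kern2 e' e = (\<lambda>z. \<Sum>b\<in>Basis. (e \<bullet> b) * kern2 e' b z)"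
  proof
    fix z :: 'a
    have 1: "e' \<bullet> e = (\<Sum>b\<in>Basis. (e \<bullet> b) * (e' \<bullet> b))" "z \<bullet> e = (\<Sum>b\<in>Basis. (e \<bullet> b) * (z \<bullet> b))"
      by (simp_all add: euclidean_inner[of _ e] mult_ac)
    show "kern2 e' e z = (\<Sum>b\<in>Basis. (e \<bullet> b) * kern2 e' b z)"
      by (simp add: kern2_def 1 distrib_left right_diff_distrib sum.distrib sum_subtractf sum_negf sum_distrib_left sum_distrib_right mult_ac)
  qed
  then have "moll (kern2 e' e) s f x = (\<Sum>b\<in>Basis. (e \<bullet> b) *\<^sub>R moll (kern2 e' b) s f x)" for s
    using moll_sum_kernel[of Basis "\<lambda>b z. (e \<bullet> b) * kern2 e' b z", OF _ kernel_scale[OF kernel_kern2] cf]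
    by (simp add: moll_scale_kernel)
  then have "pot2 p S e' e f x = integral {0..S} (\<lambda>\<sigma>. \<Sum>b\<in>Basis. (e \<bullet> b) *\<^sub>R ((p / \<sigma>) *\<^sub>R moll (kern2 e' b) (\<sigma> ^ p) f x))"
    unfolding pot2_def by (simp add: scaleR_sum_right mult.commute)
  also have "\<dots> = (\<Sum>b\<in>Basis. integral {0..S} (\<lambda>\<sigma>. (e \<bullet> b) *\<^sub>R ((p / \<sigma>) *\<^sub>R moll (kern2 e' b) (\<sigma> ^ p) f x)))"
    by (intro integral_sum integrable_cmul pot2_integrand_integrable[OF f \<alpha> p]) auto
  finally show ?thesis by (simp only: pot2_def integral_cmul)
qed

text \<open>Along \<open>s = \<sigma> ^ p\<close>, the trace of the second-derivative kernel is the radial derivative of the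
  approximate identity, so the Laplacian telescopes to the difference of the two end scales.\<close>

lemma pot2_trace:
  fixes f :: "'a::euclidean_space \<Rightarrow> 'b::euclidean_space"
  assumes f: "hoelder_le \<alpha> UNIV C f" and \<alpha>: "0 < \<alpha>" and p: "p * \<alpha> \<ge> 2" and S: "0 \<le> S"
  shows "(\<Sum>b\<in>Basis. pot2 p S b b f x) = moll (\<lambda>z. (bump z)\<^sup>2) (S ^ p) f x
     - integral (cbox (- 3 *\<^sub>R One) (3 *\<^sub>R One)) (\<lambda>z::'a. (bump z)\<^sup>2) *\<^sub>R f x"
proof -
  have cf: "continuous_on UNIV f" by (rule hoelder_le_continuous_on[OF f \<alpha>])
  have p0: "p > 0" using p by (cases p) auto
  let ?k = "\<lambda>z::'a. (bump z)\<^sup>2"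
  let ?k' = "\<lambda>z::'a. - 4 * (norm z)\<^sup>2 * bump z"
  have k': "kernel ?k'" by (auto simp: kernel_def bump_eq_0 intro!: continuous_intros)
  have tr: "moll (\<lambda>z. - real DIM('a) * ?k z - ?k' z) s f x = (\<Sum>b\<in>Basis. moll (kern2 b b) s f x)" for s
    unfolding sum_kern2[symmetric] by (rule moll_sum_kernel) (auto intro: kernel_kern2 cf)
  have "((\<lambda>\<sigma>. \<Sum>b\<in>Basis. (p / \<sigma>) *\<^sub>R moll (kern2 b b) (\<sigma> ^ p) f x) has_integral moll ?k (S ^ p) f x - moll ?k (0 ^ p) f x) {0..S}"
  proof (rule fundamental_theorem_of_calculus_interior[OF S])
    show "continuous_on {0..S} (\<lambda>\<sigma>. moll ?k (\<sigma> ^ p) f x)"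
      by (intro moll_continuous[OF kernel_bump_power2 cf] continuous_intros)
    fix \<sigma> assume "\<sigma> \<in> {0<..<S}"
    then have s: "\<sigma> > 0" by simp
    have "((\<lambda>\<sigma>. \<sigma> ^ p) has_real_derivative p * \<sigma> ^ (p - 1)) (at \<sigma>)"
      by (auto intro!: derivative_eq_intros)
    then have "((\<lambda>\<sigma>. \<sigma> ^ p) has_vector_derivative p * \<sigma> ^ (p - 1)) (at \<sigma>)"
      by (simp only: has_real_derivative_iff_has_vector_derivative)
    from vector_diff_chain_at[OF this moll_scale_derivative[OF kernel_bump_power2 k' bump_scale_derivative cf], of x] s
    have "((\<lambda>\<sigma>. moll ?k (\<sigma> ^ p) f x) has_vector_derivative (p * \<sigma> ^ (p - 1)) *\<^sub>R (1 / \<sigma> ^ p) *\<^sub>R (\<Sum>b\<in>Basis. moll (kern2 b b) (\<sigma> ^ p) f x)) (at \<sigma>)"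
      by (simp only: o_def tr zero_less_power)
    moreover have "(p * \<sigma> ^ (p - 1)) * (1 / \<sigma> ^ p) = p / \<sigma>"
      using s p0 by (cases p) auto
    ultimately show "((\<lambda>\<sigma>. moll ?k (\<sigma> ^ p) f x) has_vector_derivative (\<Sum>b\<in>Basis. (p / \<sigma>) *\<^sub>R moll (kern2 b b) (\<sigma> ^ p) f x)) (at \<sigma>)"
      by (simp only: scaleR_sum_right scaleR_scaleR)
  qed
  then have "integral {0..S} (\<lambda>\<sigma>. \<Sum>b\<in>Basis. (p / \<sigma>) *\<^sub>R moll (kern2 b b) (\<sigma> ^ p) f x) = moll ?k (S ^ p) f x - moll ?k (0 ^ p) f x"
    by (rule integral_unique)
  moreover have "integral {0..S} (\<lambda>\<sigma>. \<Sum>b\<in>Basis. (p / \<sigma>) *\<^sub>R moll (kern2 b b) (\<sigma> ^ p) f x) = (\<Sum>b\<in>Basis. pot2 p S b b f x)"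
    unfolding pot2_def by (intro integral_sum pot2_integrand_integrable[OF f \<alpha> p]) auto
  moreover have "moll ?k 0 f x = integral (cbox (- 3 *\<^sub>R One) (3 *\<^sub>R One)) ?k *\<^sub>R f x"
    unfolding moll_def scaleR_zero_left add_0_right
    by (rule integral_unique, rule has_integral_scaleR_left, rule integrable_integral)
      (intro integrable_continuous continuous_intros)
  ultimately show ?thesis using p0 by (simp add: power_0_left)
qed

section \<open>Differentiability and Hoelder bounds deduced from derivatives\<close>

text \<open>Continuous partial derivatives give differentiability: along the segment from
  \<open>x\<close> to \<open>y\<close>, subtracting the linear candidate leaves a curve of small
  speed, to which the mean value inequality applies.\<close>

lemma has_derivative_of_directional_derivatives:
  fixes F :: "'a::euclidean_space \<Rightarrow> 'b::euclidean_space"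
  assumes dir: "\<And>x e t. ((\<lambda>t. F (x + t *\<^sub>R e)) has_vector_derivative D e (x + t *\<^sub>R e)) (at t)"
    and lin: "\<And>e x. D e x = (\<Sum>b\<in>Basis. (e \<bullet> b) *\<^sub>R D b x)"
    and cont: "\<And>b. b \<in> Basis \<Longrightarrow> continuous_on UNIV (D b)"
  shows "(F has_derivative (\<lambda>h. D h x)) (at x)"
  unfolding has_derivative_at_alt
proof (intro conjI allI impI)
  have "linear (\<lambda>h. D h x)"
  proof -
    have "linear (\<lambda>h. \<Sum>b\<in>Basis. (h \<bullet> b) *\<^sub>R D b x)"
      by (rule linearI) (simp_all add: inner_add_left scaleR_add_left sum.distrib scaleR_sum_right)
    then show ?thesis by (simp only: lin[of _ x, symmetric])
  qed
  then show "bounded_linear (\<lambda>h. D h x)" by (rule linear_conv_bounded_linear[THEN iffD1])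
  fix \<epsilon> :: real assume "\<epsilon> > 0"
  define \<eta> where "\<eta> = \<epsilon> / real DIM('a)"
  have "\<eta> > 0" using \<open>\<epsilon> > 0\<close> by (simp add: \<eta>_def)
  have "\<forall>\<^sub>F y in nhds x. \<forall>b\<in>Basis. dist (D b y) (D b x) < \<eta>"
  proof (intro eventually_ball_finite ballI)
    fix b :: 'a assume "b \<in> Basis"
    then have "isCont (D b) x" using cont continuous_on_eq_continuous_at[OF open_UNIV] by blast
    then show "\<forall>\<^sub>F y in nhds x. dist (D b y) (D b x) < \<eta>"
      using \<open>\<eta> > 0\<close> unfolding isCont_def tendsto_at_iff_tendsto_nhds by (rule tendstoD)
  qed simp
  then obtain d where d0: "d > 0" and d1: "\<forall>y. dist y x < d \<longrightarrow> (\<forall>b\<in>Basis. dist (D b y) (D b x) < \<eta>)"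
    unfolding eventually_nhds_metric by blast
  have d: "norm (D b y - D b x) \<le> \<eta>" if "dist y x < d" "b \<in> Basis" for y b
  proof -
    have "dist (D b y) (D b x) < \<eta>" using d1 that by blast
    then show ?thesis by (simp add: dist_norm)
  qed
  have "norm (F y - F x - D (y - x) x) \<le> \<epsilon> * norm (y - x)" if y: "norm (y - x) < d" for y
  proof -
    let ?h = "y - x"
    define G where "G t = F (x + t *\<^sub>R ?h) - t *\<^sub>R D ?h x" for t
    have "norm (G 1 - G 0) \<le> (\<epsilon> * norm ?h) * norm (1 - (0::real))"
    proof (rule differentiable_bound[where f = G and S = "{0..1}" and f' = "\<lambda>t s. s *\<^sub>R (D ?h (x + t *\<^sub>R ?h) - D ?h x)"])
      fix t :: real assume t: "t \<in> {0..1}"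
      have "(G has_vector_derivative (D ?h (x + t *\<^sub>R ?h) - D ?h x)) (at t)"
        unfolding G_def
        using has_vector_derivative_scaleR_const[OF has_vector_derivative_id, of "D ?h x" t UNIV]
        by (intro has_vector_derivative_diff[OF dir[of x ?h t]]) simp
      then show "(G has_derivative (\<lambda>s. s *\<^sub>R (D ?h (x + t *\<^sub>R ?h) - D ?h x))) (at t within {0..1})"
        using has_vector_derivative_at_within has_vector_derivative_def by blast
      have "norm (t *\<^sub>R ?h) \<le> norm ?h" using t by (simp add: mult_left_le_one_le)
      then have dd: "dist (x + t *\<^sub>R ?h) x < d" using y by (simp add: dist_norm)
      have "D ?h (x + t *\<^sub>R ?h) - D ?h x = (\<Sum>b\<in>Basis. (?h \<bullet> b) *\<^sub>R (D b (x + t *\<^sub>R ?h) - D b x))"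
        unfolding lin[of ?h "x + t *\<^sub>R ?h"] lin[of ?h x] by (simp only: sum_subtractf scaleR_diff_right)
      also have "norm \<dots> \<le> (\<Sum>b\<in>(Basis::'a set). norm ?h * \<eta>)"
        by (rule sum_norm_le) (use d[OF dd] Basis_le_norm \<open>\<eta> > 0\<close> in \<open>auto intro!: mult_mono\<close>)
      also have "\<dots> = \<epsilon> * norm ?h" by (simp add: \<eta>_def)
      finally have "norm (D ?h (x + t *\<^sub>R ?h) - D ?h x) \<le> \<epsilon> * norm ?h" .
      then show "onorm (\<lambda>s. s *\<^sub>R (D ?h (x + t *\<^sub>R ?h) - D ?h x)) \<le> \<epsilon> * norm ?h"
        by (intro onorm_le) (simp add: mult.commute mult_left_mono)
    qed auto
    then show ?thesis by (simp add: G_def algebra_simps)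
  qed
  then show "\<exists>d>0. \<forall>y. norm (y - x) < d \<longrightarrow> norm (F y - F x - D (y - x) x) \<le> \<epsilon> * norm (y - x)"
    using d0 by blast
qed

lemma dist_le_powr:
  assumes "x \<in> cball 0 \<rho>" "y \<in> cball 0 \<rho>" "0 < \<alpha>" "\<alpha> < 1"
  shows "dist x y \<le> (2 * \<rho>) powr (1 - \<alpha>) * dist x y powr \<alpha>"
proof (cases "dist x y = 0")
  case False
  have "dist x y \<le> 2 * \<rho>" using assms dist_triangle2[of x y 0] by (simp add: dist_commute)
  then have "dist x y powr (1 - \<alpha>) * dist x y powr \<alpha> \<le> (2 * \<rho>) powr (1 - \<alpha>) * dist x y powr \<alpha>"
    using assms by (intro mult_right_mono powr_mono2) auto
  then show ?thesis using False by (simp flip: powr_add)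
qed simp

text \<open>Since \<open>F\<close> vanishes at 0, a bound for the derivative on the ball controls
  size and oscillation alike, and \<open>dist_le_powr\<close> trades Lipschitz for Hoelder. Used
  twice, it descends from second derivatives to the function, so the lower-order potentials need no
  kernel estimates of their own.\<close>

lemma hoelder_le_of_derivative_bound:
  fixes F :: "'a::euclidean_space \<Rightarrow> 'b::euclidean_space"
  assumes D: "\<And>x. (F has_derivative F' x) (at x)" and F0: "F 0 = 0"
    and M: "\<And>x h. x \<in> cball 0 \<rho> \<Longrightarrow> norm (F' x h) \<le> M * norm h"
    and \<alpha>: "0 < \<alpha>" "\<alpha> < 1" and \<rho>: "\<rho> > 0"
  shows "hoelder_le \<alpha> (cball 0 \<rho>) ((\<rho> + (2 * \<rho>) powr (1 - \<alpha>)) * M) F"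
proof -
  obtain b :: 'a where "b \<in> Basis" using nonempty_Basis by blast
  then have M0: "M \<ge> 0" using M[of 0 b] \<rho> by simp (metis norm_ge_zero order_trans)
  have lip: "norm (F x - F y) \<le> M * norm (x - y)" if "x \<in> cball 0 \<rho>" "y \<in> cball 0 \<rho>" for x y
    by (rule differentiable_bound[of "cball 0 \<rho>" F F'])
      (use D M that M0 in \<open>auto intro!: onorm_le intro: has_derivative_at_withinI\<close>)
  have p: "(2 * \<rho>) powr (1 - \<alpha>) \<ge> 0" by simp
  show ?thesis
    unfolding hoelder_le_def
  proof (intro conjI ballI)
    fix x :: 'a assume x: "x \<in> cball 0 \<rho>"
    have "norm (F x) \<le> M * norm x" using lip[OF x, of 0] \<rho> F0 by simp
    also have "\<dots> \<le> M * (\<rho> + (2 * \<rho>) powr (1 - \<alpha>))" using x M0 p by (intro mult_left_mono) (auto intro: add_increasing2)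
    finally show "norm (F x) \<le> (\<rho> + (2 * \<rho>) powr (1 - \<alpha>)) * M" by (simp add: mult.commute)
    fix y :: 'a assume y: "y \<in> cball 0 \<rho>"
    have "norm (F x - F y) \<le> M * dist x y" using lip[OF x y] by (simp add: dist_norm)
    also have "\<dots> \<le> M * ((\<rho> + (2 * \<rho>) powr (1 - \<alpha>)) * dist x y powr \<alpha>)"
      using dist_le_powr[OF x y \<alpha>] M0 \<rho> by (intro mult_left_mono) (auto simp: distrib_right intro: add_increasing)
    finally show "norm (F x - F y) \<le> (\<rho> + (2 * \<rho>) powr (1 - \<alpha>)) * M * dist x y powr \<alpha>"
      by (simp add: mult_ac)
  qed
qed

section \<open>Decay of averages at large scales\<close>

text \<open>In the variable of integration the support of \<open>f\<close> fits into a cube of side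
  \<open>2 * \<rho> / s\<close>. As that side is at most 1, the volume is at most the side.\<close>

lemma moll_large_scale_bound:
  fixes f :: "'a::euclidean_space \<Rightarrow> 'b::euclidean_space"
  assumes k: "kernel k" and k1: "\<And>z. \<bar>k z\<bar> \<le> 1" and f: "continuous_on UNIV f"
    and C: "\<And>x. norm (f x) \<le> C" and supp: "\<And>x. norm x > \<rho> \<Longrightarrow> f x = 0"
    and s: "s > 0" "2 * \<rho> \<le> s" and \<rho>: "\<rho> \<ge> 0"
  shows "norm (moll k s f x) \<le> C * (2 * \<rho> / s)"
proof -
  let ?Q = "cbox (- 3 *\<^sub>R One) (3 *\<^sub>R One) :: 'a set"
  \<comment> \<open>The point \<open>a\<close> is mapped to the origin by
    \<open>x + s *\<^sub>R a\<close>, so a cube around it contains every \<open>z\<close> at which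
    \<open>f\<close> can be nonzero.\<close>
  define a where "a = (- 1 / s) *\<^sub>R x"
  define B where "B = cbox (a - (\<rho> / s) *\<^sub>R One) (a + (\<rho> / s) *\<^sub>R One)"
  let ?F = "\<lambda>z. k z *\<^sub>R f (x + s *\<^sub>R z)"
  have C0: "C \<ge> 0" using C[of 0] norm_ge_zero order_trans by blast
  have out: "?F z = 0" if "z \<notin> B" for z
  proof -
    have "norm (x + s *\<^sub>R z) > \<rho>"
    proof (rule ccontr)
      assume "\<not> norm (x + s *\<^sub>R z) > \<rho>"
      moreover have "x + s *\<^sub>R z = s *\<^sub>R (z - a)" using s by (simp add: a_def algebra_simps)
      ultimately have "s * norm (z - a) \<le> \<rho>" using s by simp
      then have n: "norm (z - a) \<le> \<rho> / s" using s by (simp add: pos_le_divide_eq mult.commute)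
      have "z \<in> B" unfolding B_def mem_box
      proof
        fix i :: 'a assume i: "i \<in> Basis"
        have "\<bar>(z - a) \<bullet> i\<bar> \<le> \<rho> / s" using Basis_le_norm[OF i, of "z - a"] n by linarith
        then show "(a - (\<rho> / s) *\<^sub>R One) \<bullet> i \<le> z \<bullet> i \<and> z \<bullet> i \<le> (a + (\<rho> / s) *\<^sub>R One) \<bullet> i"
          using i by (auto simp: inner_diff_left inner_add_left abs_le_iff)
      qed
      with that show False by simp
    qed
    then show ?thesis using supp by simp
  qed
  obtain u v where uv: "?Q \<inter> B = cbox u v" unfolding B_def Int_interval by blast
  have "moll k s f x = integral (?Q \<inter> B) ?F"
  proof -
    have "?F = (\<lambda>z. if z \<in> B then ?F z else 0)"
    proof
      fix z show "?F z = (if z \<in> B then ?F z else 0)"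
        by (cases "z \<in> B") (simp_all only: if_True if_False out not_False_eq_True)
    qed
    then have "moll k s f x = integral ?Q (\<lambda>z. if z \<in> B then ?F z else 0)" unfolding moll_def by (rule arg_cong)
    then show ?thesis by (simp only: integral_restrict_Int Int_commute)
  qed
  also have "norm \<dots> \<le> C * measure lborel (cbox u v)"
    unfolding uv
  proof (rule integrable_bound[OF C0])
    show "?F integrable_on cbox u v" using moll_integrable[OF k f, of 0] by simp
    show "norm (?F z) \<le> C" for z using mult_mono[OF k1[of z] C[of "x + s *\<^sub>R z"]] by simp
  qed
  also have "\<dots> \<le> C * measure lborel B"
    using C0 uv[symmetric] unfolding B_def by (intro mult_left_mono content_subset) auto
  also have "measure lborel B = (2 * \<rho> / s) ^ DIM('a)"
    unfolding B_def using \<rho> s by (subst content_cbox) (auto simp: inner_diff_left inner_add_left)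
  also have "C * (2 * \<rho> / s) ^ DIM('a) \<le> C * (2 * \<rho> / s) ^ 1"
    using C0 \<rho> s by (intro mult_left_mono power_decreasing) (auto simp: DIM_positive Suc_leI)
  finally show ?thesis by simp
qed

text \<open>Moving the centre shifts the kernel by distance over scale, which supplies the decay
  \<open>1 / s\<close>; from \<open>f\<close> only the sup norm enters.\<close>

lemma moll_large_scale_lipschitz:
  fixes f :: "'a::euclidean_space \<Rightarrow> 'b::euclidean_space"
  assumes k: "kernel k" and L: "\<And>z w. \<bar>k z - k w\<bar> \<le> L * norm (z - w)" and f: "continuous_on UNIV f"
    and C: "\<And>x. norm (f x) \<le> C" and s: "s > 0" and xy: "dist x y \<le> s"
  shows "norm (moll k s f x - moll k s f y) \<le> (L * (dist x y / s) * C) * kernel_box_volume TYPE('a)"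
proof -
  let ?Q = "cbox (- 3 *\<^sub>R One) (3 *\<^sub>R One) :: 'a set"
  define w where "w = (1 / s) *\<^sub>R (y - x)"
  have w: "norm w = dist x y / s" using s by (simp add: w_def dist_norm norm_minus_commute)
  then have w1: "norm w \<le> 1" using xy s by simp
  have y: "y = x + s *\<^sub>R w" using s by (simp add: w_def)
  have C0: "C \<ge> 0" using C[of 0] norm_ge_zero order_trans by blast
  have Lw: "0 \<le> L * norm w" using L[of w 0] by simp
  have "moll k s f x - moll k s f y =
     integral ?Q (\<lambda>z. k (z - 0) *\<^sub>R f (x + s *\<^sub>R z)) - integral ?Q (\<lambda>z. k (z - w) *\<^sub>R f (x + s *\<^sub>R z))"
    unfolding y using moll_translate[OF k f, of 0 s x] moll_translate[OF k f, of w s x] w1 by simp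
  also have "\<dots> = integral ?Q (\<lambda>z. (k z - k (z - w)) *\<^sub>R f (x + s *\<^sub>R z))"
    by (subst integral_diff[OF moll_integrable[OF k f] moll_integrable[OF k f], symmetric]) (simp add: scaleR_diff_left)
  also have "norm \<dots> \<le> (L * norm w * C) * measure lborel ?Q"
  proof (rule integrable_bound)
    show "(\<lambda>z. (k z - k (z - w)) *\<^sub>R f (x + s *\<^sub>R z)) integrable_on ?Q"
      unfolding scaleR_diff_left using integrable_diff[OF moll_integrable[OF k f, of 0] moll_integrable[OF k f]] by simp
    show "norm ((k z - k (z - w)) *\<^sub>R f (x + s *\<^sub>R z)) \<le> L * norm w * C" for z

    proof -
      have "\<bar>k z - k (z - w)\<bar> \<le> L * norm w" using L[of z "z - w"] by simp
      then show ?thesis using C Lw by (simp add: mult_mono)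
    qed
  qed (use C0 Lw in auto)
  finally show ?thesis using w by simp
qed

lemma moll_large_scale_hoelder:
  fixes f :: "'a::euclidean_space \<Rightarrow> 'b::euclidean_space"
  assumes f: "hoelder_le \<alpha> UNIV C f" and supp: "\<And>x. norm x > \<rho> \<Longrightarrow> f x = 0"
    and \<alpha>: "0 < \<alpha>" "\<alpha> < 1" and \<rho>: "\<rho> > 0" and s: "s \<ge> 2 * \<rho>"
  shows "hoelder_le \<alpha> (cball 0 \<rho>) (((2 * \<rho> + 4 * kernel_box_volume TYPE('a) * (2 * \<rho>) powr (1 - \<alpha>)) / s) * C)
     (moll (\<lambda>z. (bump z)\<^sup>2) s f)"
proof -
  define V where "V = kernel_box_volume TYPE('a)"
  define q where "q = (2 * \<rho>) powr (1 - \<alpha>)"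
  have cf: "continuous_on UNIV f" by (rule hoelder_le_continuous_on[OF f \<alpha>(1)])
  have C: "norm (f x) \<le> C" for x using hoelder_leD(1)[OF f] by simp
  have C0: "C \<ge> 0" using C[of 0] norm_ge_zero order_trans by blast
  have s0: "s > 0" using s \<rho> by linarith
  have V0: "V \<ge> 0" unfolding V_def by (rule measure_nonneg)
  have q0: "q \<ge> 0" by (simp add: q_def)
  have K: "(2 * \<rho> + 4 * V * q) / s * C = C * (2 * \<rho> / s) + 4 * (q / s) * C * V"
    by (simp add: add_divide_distrib algebra_simps)
  have nn: "C * (2 * \<rho> / s) \<ge> 0" "4 * (q / s) * C * V \<ge> 0" using C0 s0 \<rho> V0 q0 by auto
  show ?thesis
    unfolding hoelder_le_def V_def[symmetric] q_def[symmetric] K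
  proof (intro conjI ballI)
    fix x :: 'a assume x: "x \<in> cball 0 \<rho>"
    have "norm (moll (\<lambda>z. (bump z)\<^sup>2) s f x) \<le> C * (2 * \<rho> / s)"
      by (rule moll_large_scale_bound[OF kernel_bump_power2 _ cf C supp s0 s])
        (use bump_bounds \<rho> in \<open>auto intro: power_le_one\<close>)
    then show "norm (moll (\<lambda>z. (bump z)\<^sup>2) s f x) \<le> C * (2 * \<rho> / s) + 4 * (q / s) * C * V"
      using nn by linarith
    fix y :: 'a assume y: "y \<in> cball 0 \<rho>"
    have "dist x y \<le> s" using x y s dist_triangle2[of x y 0] by (simp add: dist_commute)
    then have "norm (moll (\<lambda>z. (bump z)\<^sup>2) s f x - moll (\<lambda>z. (bump z)\<^sup>2) s f y) \<le> (4 * (dist x y / s) * C) * V"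
      unfolding V_def by (intro moll_large_scale_lipschitz[OF kernel_bump_power2 bump_power2_lipschitz cf C s0])
    also have "\<dots> \<le> (4 * ((q * dist x y powr \<alpha>) / s) * C) * V"
      using dist_le_powr[OF x y \<alpha>] V0 C0 s0
      by (intro mult_right_mono mult_left_mono divide_right_mono) (auto simp: q_def)
    also have "\<dots> = (4 * (q / s) * C * V) * dist x y powr \<alpha>" by simp
    also have "\<dots> \<le> (C * (2 * \<rho> / s) + 4 * (q / s) * C * V) * dist x y powr \<alpha>"
      using nn by (intro mult_right_mono) auto
    finally show "norm (moll (\<lambda>z. (bump z)\<^sup>2) s f x - moll (\<lambda>z. (bump z)\<^sup>2) s f y) \<le> (C * (2 * \<rho> / s) + 4 * (q / s) * C * V) * dist x y powr \<alpha>" .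
  qed
qed

section \<open>An approximate inverse of the Laplacian\<close>

definition bump_mass :: "'a::euclidean_space itself \<Rightarrow> real" where
  "bump_mass _ = integral (cbox (- 3 *\<^sub>R One) (3 *\<^sub>R One)) (\<lambda>z::'a. (bump z)\<^sup>2)"

text \<open>The minus sign answers \<open>pot2_trace\<close>, where \<open>f\<close> appears with
  the factor minus the mass.\<close>

definition sol2 :: "nat \<Rightarrow> real \<Rightarrow> 'a \<Rightarrow> 'a \<Rightarrow> ('a::euclidean_space \<Rightarrow> 'b::euclidean_space) \<Rightarrow> 'a \<Rightarrow> 'b" where
  "sol2 p S e e' f x = (- 1 / bump_mass TYPE('a)) *\<^sub>R pot2 p S e e' f x"

definition sol1 :: "nat \<Rightarrow> real \<Rightarrow> 'a \<Rightarrow> ('a::euclidean_space \<Rightarrow> 'b::euclidean_space) \<Rightarrow> 'a \<Rightarrow> 'b" where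
  "sol1 p S e f x = (- 1 / bump_mass TYPE('a)) *\<^sub>R (pot1 p S e f x - pot1 p S e f 0)"

text \<open>\<open>pot1 p S x f 0\<close> is the derivative of \<open>pot0 p S f\<close> at 0 in direction \<open>x\<close>.\<close>

definition sol0 :: "nat \<Rightarrow> real \<Rightarrow> ('a::euclidean_space \<Rightarrow> 'b::euclidean_space) \<Rightarrow> 'a \<Rightarrow> 'b" where
  "sol0 p S f x = (- 1 / bump_mass TYPE('a)) *\<^sub>R (pot0 p S f x - pot0 p S f 0 - pot1 p S x f 0)"

definition smoothing :: "nat \<Rightarrow> real \<Rightarrow> ('a::euclidean_space \<Rightarrow> 'b::euclidean_space) \<Rightarrow> 'a \<Rightarrow> 'b" where
  "smoothing p S f x = (1 / bump_mass TYPE('a)) *\<^sub>R moll (\<lambda>z. (bump z)\<^sup>2) (S ^ p) f x"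

lemma hoelder_le_scaleR:
  assumes "hoelder_le \<alpha> X C f"
  shows "hoelder_le \<alpha> X (\<bar>c\<bar> * C) (\<lambda>x. c *\<^sub>R f x)"
  unfolding hoelder_le_def
proof (intro conjI ballI)
  fix x y assume x: "x \<in> X"
  show "norm (c *\<^sub>R f x) \<le> \<bar>c\<bar> * C" using hoelder_leD(1)[OF assms x] by (simp add: mult_left_mono)
  assume y: "y \<in> X"
  have "norm (c *\<^sub>R f x - c *\<^sub>R f y) = \<bar>c\<bar> * norm (f x - f y)" by (simp flip: scaleR_diff_right)
  then show "norm (c *\<^sub>R f x - c *\<^sub>R f y) \<le> \<bar>c\<bar> * C * dist x y powr \<alpha>"
    using hoelder_leD(2)[OF assms x y] by (simp add: mult_left_mono mult.assoc)
qed

lemma hoelder_le_mono: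
  assumes "hoelder_le \<alpha> X C f" "C \<le> C'" "Y \<subseteq> X"
  shows "hoelder_le \<alpha> Y C' f"
  unfolding hoelder_le_def
proof (intro conjI ballI)
  fix x y assume x: "x \<in> Y"
  show "norm (f x) \<le> C'" using hoelder_leD(1)[OF assms(1), of x] x assms by (auto intro: order_trans)
  assume y: "y \<in> Y"
  have "norm (f x - f y) \<le> C * dist x y powr \<alpha>" using hoelder_leD(2)[OF assms(1), of x y] x y assms(3) by auto
  also have "\<dots> \<le> C' * dist x y powr \<alpha>" using assms(2) by (intro mult_right_mono) auto
  finally show "norm (f x - f y) \<le> C' * dist x y powr \<alpha>" .
qed

lemma bump_mass_pos: "bump_mass TYPE('a::euclidean_space) > 0"
  unfolding bump_mass_def by (rule integral_bump_power2_pos)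

lemma sol_diff:
  fixes f g :: "'a::euclidean_space \<Rightarrow> 'b::euclidean_space"
  assumes f: "hoelder_le \<alpha> UNIV C f" and g: "hoelder_le \<alpha> UNIV C' g" and \<alpha>: "0 < \<alpha>" and p: "p * \<alpha> \<ge> 2"
  shows "sol0 p S (\<lambda>x. f x - g x) x = sol0 p S f x - sol0 p S g x"
    and "sol1 p S e (\<lambda>x. f x - g x) x = sol1 p S e f x - sol1 p S e g x"
    and "sol2 p S e e' (\<lambda>x. f x - g x) x = sol2 p S e e' f x - sol2 p S e e' g x"
    and "smoothing p S (\<lambda>x. f x - g x) x = smoothing p S f x - smoothing p S g x"
  unfolding sol0_def sol1_def sol2_def smoothing_def pot_diff[OF f g \<alpha> p]
    moll_diff[OF kernel_bump_power2 hoelder_le_continuous_on[OF f \<alpha>] hoelder_le_continuous_on[OF g \<alpha>]]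
  by (simp_all only: scaleR_diff_right[symmetric]) (simp_all add: algebra_simps)

lemma sol_at_0: "sol0 p S f 0 = 0" "sol1 p S e f 0 = 0"
  by (simp_all add: sol0_def sol1_def pot1_def kern1_def moll_def)

lemma sol2_commute: "sol2 p S e e' f x = sol2 p S e' e f x"
  unfolding sol2_def by (simp only: pot2_commute[of p S e e' f])

lemma sol1_derivative:
  fixes f :: "'a::euclidean_space \<Rightarrow> 'b::euclidean_space"
  assumes f: "hoelder_le \<alpha> UNIV C f" and \<alpha>: "0 < \<alpha>" "\<alpha> < 1" and p: "p * \<alpha> \<ge> 2" and p2: "p \<ge> 2" and S: "S \<ge> 1"
  shows "(sol1 p S e f has_derivative (\<lambda>h. sol2 p S e h f x)) (at x)"
proof -
  have "(pot1 p S e f has_derivative (\<lambda>h. pot2 p S e h f x)) (at x)"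
  proof (rule has_derivative_of_directional_derivatives)
    show "((\<lambda>t. pot1 p S e f (x + t *\<^sub>R e')) has_vector_derivative pot2 p S e e' f (x + t *\<^sub>R e')) (at t)" for x e' t
      by (rule pot1_derivative[OF f \<alpha>(1) p p2])
    show "pot2 p S e e' f x = (\<Sum>b\<in>Basis. (e' \<bullet> b) *\<^sub>R pot2 p S e b f x)" for e' x
      by (rule pot2_sum[OF f \<alpha>(1) p])
    fix b :: 'a assume b: "b \<in> Basis"
    \<comment> \<open>\<open>pot2_hoelder\<close> covers directions of norm at most 1, so an
      arbitrary \<open>e\<close> is expanded in the basis.\<close>
    have "continuous_on UNIV (\<lambda>x. \<Sum>a\<in>Basis. (e \<bullet> a) *\<^sub>R pot2 p S a b f x)"
      by (intro continuous_intros hoelder_le_continuous_on[OF pot2_hoelder[OF f \<alpha> p S] \<alpha>(1)]) (use b in auto)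
    also have "(\<lambda>x. \<Sum>a\<in>Basis. (e \<bullet> a) *\<^sub>R pot2 p S a b f x) = pot2 p S e b f"
      using pot2_sum[OF f \<alpha>(1) p, of S b e] by (simp add: pot2_commute[of p S _ b] fun_eq_iff)
    finally show "continuous_on UNIV (pot2 p S e b f)" .
  qed
  then have "((\<lambda>x. (- 1 / bump_mass TYPE('a)) *\<^sub>R (pot1 p S e f x - pot1 p S e f 0)) has_derivative
      (\<lambda>h. (- 1 / bump_mass TYPE('a)) *\<^sub>R (pot2 p S e h f x - 0))) (at x)"
    by (intro has_derivative_scaleR_right has_derivative_diff has_derivative_const)
  then show ?thesis unfolding sol1_def[abs_def] sol2_def[abs_def] by simp
qed

lemma sol0_derivative:
  fixes f :: "'a::euclidean_space \<Rightarrow> 'b::euclidean_space"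
  assumes f: "hoelder_le \<alpha> UNIV C f" and \<alpha>: "0 < \<alpha>" "\<alpha> < 1" and p: "p * \<alpha> \<ge> 2" and p2: "p \<ge> 2" and S: "S \<ge> 1"
  shows "(sol0 p S f has_derivative (\<lambda>h. sol1 p S h f x)) (at x)"
proof -
  have cf: "continuous_on UNIV f" by (rule hoelder_le_continuous_on[OF f \<alpha>(1)])
  have D: "(pot0 p S f has_derivative (\<lambda>h. pot1 p S h f x)) (at x)" for x
  proof (rule has_derivative_of_directional_derivatives)
    show "((\<lambda>t. pot0 p S f (x + t *\<^sub>R e')) has_vector_derivative pot1 p S e' f (x + t *\<^sub>R e')) (at t)" for x e' t
      by (rule pot0_derivative[OF cf p2])
    show "pot1 p S e' f x = (\<Sum>b\<in>Basis. (e' \<bullet> b) *\<^sub>R pot1 p S b f x)" for e' x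
      by (rule pot1_sum[OF cf])
    fix b :: 'a assume b: "b \<in> Basis"
    show "continuous_on UNIV (pot1 p S b f)"
      unfolding pot1_def cbox_interval[symmetric]
      by (rule integral_continuous_on_param)
       (auto simp: case_prod_unfold intro!: continuous_intros moll_continuous[OF kernel_kern1 cf])
  qed
  have "((\<lambda>x. pot1 p S x f 0) has_derivative (\<lambda>h. pot1 p S h f 0)) (at x)"
    by (rule bounded_linear_imp_has_derivative[OF has_derivative_bounded_linear[OF D]])
  with D have "((\<lambda>x. (- 1 / bump_mass TYPE('a)) *\<^sub>R (pot0 p S f x - pot0 p S f 0 - pot1 p S x f 0)) has_derivative
      (\<lambda>h. (- 1 / bump_mass TYPE('a)) *\<^sub>R (pot1 p S h f x - 0 - pot1 p S h f 0))) (at x)"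
    by (intro has_derivative_scaleR_right has_derivative_diff has_derivative_const)
  then show ?thesis unfolding sol0_def[abs_def] sol1_def[abs_def] by simp
qed

lemma linear_bound_of_unit_bound:
  fixes L :: "'a::real_normed_vector \<Rightarrow> 'b::real_normed_vector"
  assumes "linear L" and M: "\<And>e. norm e \<le> 1 \<Longrightarrow> norm (L e) \<le> M"
  shows "norm (L h) \<le> M * norm h"
proof (cases "h = 0")
  case False
  have "norm (L ((1 / norm h) *\<^sub>R h)) \<le> M" using False by (intro M) simp
  then show ?thesis using False by (simp add: linear_scale[OF assms(1)] field_simps)
qed (simp add: linear_0[OF assms(1)])

text \<open>The last factor bounds the second derivatives. Each integration down costs
  \<open>q = \<rho> + (2 * \<rho>) powr (1 - \<alpha>)\<close>, and \<open>(1 + q)\<^sup>2\<close>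
  dominates 1, \<open>q\<close> and \<open>q * q\<close>, so one constant serves all three
  orders.\<close>

definition sol_const :: "'a::euclidean_space itself \<Rightarrow> real \<Rightarrow> nat \<Rightarrow> real \<Rightarrow> real \<Rightarrow> real" where
  "sol_const _ \<alpha> p S \<rho> = (1 + (\<rho> + (2 * \<rho>) powr (1 - \<alpha>))) ^ 2 * ((1 / bump_mass TYPE('a)) *
     (kernel_box_volume TYPE('a) * (S powr (p * \<alpha>) * 10 / \<alpha> + 40 / (1 - \<alpha>))))"

lemma sol_hoelder:
  fixes f :: "'a::euclidean_space \<Rightarrow> 'b::euclidean_space"
  assumes f: "hoelder_le \<alpha> UNIV C f" and \<alpha>: "0 < \<alpha>" "\<alpha> < 1" and p: "p * \<alpha> \<ge> 2" and p2: "p \<ge> 2" and S: "S \<ge> 1"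
    and \<rho>: "\<rho> > 0"
  shows "norm e \<le> 1 \<Longrightarrow> norm e' \<le> 1 \<Longrightarrow> hoelder_le \<alpha> UNIV (sol_const TYPE('a) \<alpha> p S \<rho> * C) (sol2 p S e e' f)"
    and "norm e \<le> 1 \<Longrightarrow> hoelder_le \<alpha> (cball 0 \<rho>) (sol_const TYPE('a) \<alpha> p S \<rho> * C) (sol1 p S e f)"
    and "hoelder_le \<alpha> (cball 0 \<rho>) (sol_const TYPE('a) \<alpha> p S \<rho> * C) (sol0 p S f)"
proof -
  define q where "q = \<rho> + (2 * \<rho>) powr (1 - \<alpha>)"
  define K where "K = (1 / bump_mass TYPE('a)) * (kernel_box_volume TYPE('a) * (S powr (p * \<alpha>) * 10 / \<alpha> + 40 / (1 - \<alpha>)))"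
  have sc: "sol_const TYPE('a) \<alpha> p S \<rho> = (1 + q)^2 * K" by (simp only: sol_const_def q_def K_def)
  have q: "q \<ge> 0" using \<rho> by (simp add: q_def)
  have C: "C \<ge> 0" using hoelder_leD(1)[OF f, of 0] by (smt (verit) UNIV_I norm_ge_zero)
  have m: "bump_mass TYPE('a) > 0" by (rule bump_mass_pos)
  have K: "K \<ge> 0" unfolding K_def using \<alpha> m by (intro mult_nonneg_nonneg add_nonneg_nonneg measure_nonneg) auto
  then have KC: "K * C \<ge> 0" using C by simp
  have q1: "1 \<le> (1 + q)^2" "q \<le> (1 + q)^2" "q * q \<le> (1 + q)^2" using q by (auto simp: power2_eq_square algebra_simps)
  have h2: "hoelder_le \<alpha> UNIV (K * C) (sol2 p S e e' f)" if "norm e \<le> 1" "norm e' \<le> 1" for e e'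
    using hoelder_le_scaleR[OF pot2_hoelder[OF f \<alpha> p S that], of "- 1 / bump_mass TYPE('a)"] m
    unfolding sol2_def[abs_def] by (simp add: K_def mult.assoc)
  have d1: "(sol1 p S e f has_derivative (\<lambda>h. sol2 p S e h f x)) (at x)" for e x by (rule sol1_derivative[OF f \<alpha> p p2 S])
  have d0: "(sol0 p S f has_derivative (\<lambda>h. sol1 p S h f x)) (at x)" for x by (rule sol0_derivative[OF f \<alpha> p p2 S])
  have h1: "hoelder_le \<alpha> (cball 0 \<rho>) (q * (K * C)) (sol1 p S e f)" if e: "norm e \<le> 1" for e
  proof (rule hoelder_le_of_derivative_bound[OF d1 sol_at_0(2) _ \<alpha> \<rho>, folded q_def])
    show "norm (sol2 p S e h f x) \<le> K * C * norm h" for x h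
      by (rule linear_bound_of_unit_bound[OF has_derivative_linear[OF d1]]) (use hoelder_leD(1)[OF h2[OF e]] in auto)
  qed
  have h0: "hoelder_le \<alpha> (cball 0 \<rho>) (q * (q * (K * C))) (sol0 p S f)"
  proof (rule hoelder_le_of_derivative_bound[OF d0 sol_at_0(1) _ \<alpha> \<rho>, folded q_def])
    show "norm (sol1 p S h f x) \<le> q * (K * C) * norm h" if "x \<in> cball 0 \<rho>" for x h
      by (rule linear_bound_of_unit_bound[OF has_derivative_linear[OF d0]]) (use hoelder_leD(1)[OF h1 that] in auto)
  qed
  show "norm e \<le> 1 \<Longrightarrow> norm e' \<le> 1 \<Longrightarrow> hoelder_le \<alpha> UNIV (sol_const TYPE('a) \<alpha> p S \<rho> * C) (sol2 p S e e' f)"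
    using mult_right_mono[OF q1(1) KC] unfolding sc by (intro hoelder_le_mono[OF h2]) (auto simp: mult.assoc)
  show "norm e \<le> 1 \<Longrightarrow> hoelder_le \<alpha> (cball 0 \<rho>) (sol_const TYPE('a) \<alpha> p S \<rho> * C) (sol1 p S e f)"
    using mult_right_mono[OF q1(2) KC] unfolding sc by (intro hoelder_le_mono[OF h1]) (auto simp: mult.assoc)
  show "hoelder_le \<alpha> (cball 0 \<rho>) (sol_const TYPE('a) \<alpha> p S \<rho> * C) (sol0 p S f)"
    using mult_right_mono[OF q1(3) KC] unfolding sc by (intro hoelder_le_mono[OF h0]) (auto simp: mult.assoc)
qed

lemma sol2_trace:
  fixes f :: "'a::euclidean_space \<Rightarrow> 'b::euclidean_space"
  assumes f: "hoelder_le \<alpha> UNIV C f" and \<alpha>: "0 < \<alpha>" and p: "p * \<alpha> \<ge> 2" and S: "0 \<le> S"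
  shows "(\<Sum>b\<in>Basis. sol2 p S b b f x) = f x - smoothing p S f x"
proof -
  have "(\<Sum>b\<in>Basis. sol2 p S b b f x) = (- 1 / bump_mass TYPE('a)) *\<^sub>R
      (moll (\<lambda>z. (bump z)\<^sup>2) (S ^ p) f x - bump_mass TYPE('a) *\<^sub>R f x)"
    unfolding sol2_def scaleR_sum_right[symmetric] pot2_trace[OF f \<alpha> p S] bump_mass_def ..
  then show ?thesis
    using bump_mass_pos[where 'a = 'a] by (simp add: smoothing_def scaleR_diff_right)
qed

text \<open>The scale is chosen uniformly in the source, so it can be fixed before the nonlinear
  problem is set up. \<open>S\<close> exceeds \<open>2 * \<rho>\<close>, as the decay estimate
  demands, and \<open>A / \<kappa>\<close>, which brings the decaying factor down to \<kappa>;
  \<open>S \<le> S ^ p\<close> carries both to the actual scale.\<close>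

lemma smoothing_hoelder:
  fixes f :: "'a::euclidean_space \<Rightarrow> 'b::euclidean_space"
  assumes "\<kappa> > 0" and \<alpha>: "0 < \<alpha>" "\<alpha> < 1" and \<rho>: "\<rho> > 0" and p: "p \<ge> 1"
  obtains S where "S \<ge> 1" and "\<And>C (f :: 'a::euclidean_space \<Rightarrow> 'b::euclidean_space). hoelder_le \<alpha> UNIV C f \<Longrightarrow> (\<And>x. norm x > \<rho> \<Longrightarrow> f x = 0) \<Longrightarrow>
     hoelder_le \<alpha> (cball 0 \<rho>) (\<kappa> * C) (smoothing p S f)"
proof -
  define A where "A = (1 / bump_mass TYPE('a)) * (2 * \<rho> + 4 * kernel_box_volume TYPE('a) * (2 * \<rho>) powr (1 - \<alpha>))"
  have m: "bump_mass TYPE('a) > 0" by (rule bump_mass_pos)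
  have A: "A \<ge> 0" unfolding A_def using m \<rho> by (intro mult_nonneg_nonneg add_nonneg_nonneg measure_nonneg) auto
  define S where "S = 1 + 2 * \<rho> + A / \<kappa>"
  have S: "S \<ge> 1" using A \<rho> \<open>\<kappa> > 0\<close> by (simp add: S_def)
  have Sp: "S ^ p \<ge> S" using power_increasing[OF p S] by simp
  show thesis
  proof
    show "S \<ge> 1" by fact
    fix C and f :: "'a \<Rightarrow> 'b" assume f: "hoelder_le \<alpha> UNIV C f" and supp: "\<And>x. norm x > \<rho> \<Longrightarrow> f x = 0"
    have C: "C \<ge> 0" using hoelder_leD(1)[OF f, of 0] by (smt (verit) UNIV_I norm_ge_zero)
    have "S \<ge> 2 * \<rho>" using A \<open>\<kappa> > 0\<close> by (simp add: S_def add_increasing2)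
    then have "S ^ p \<ge> 2 * \<rho>" using Sp by linarith
    from hoelder_le_scaleR[OF moll_large_scale_hoelder[OF f supp \<alpha> \<rho> this], of "1 / bump_mass TYPE('a)"]
    have h: "hoelder_le \<alpha> (cball 0 \<rho>) (A / S ^ p * C) (smoothing p S f)"
      using m unfolding smoothing_def[abs_def] by (simp add: A_def)
    have "A / \<kappa> \<le> S ^ p" using Sp \<rho> by (simp add: S_def)
    then have "A / S ^ p \<le> \<kappa>" using \<open>\<kappa> > 0\<close> S by (simp add: field_simps)
    then show "hoelder_le \<alpha> (cball 0 \<rho>) (\<kappa> * C) (smoothing p S f)"
      using C by (intro hoelder_le_mono[OF h] mult_right_mono) auto
  qed
qed

section \<open>Contractions in Hoelder balls\<close>

lemma hoelder_le_nonneg: "hoelder_le \<alpha> X C f \<Longrightarrow> X \<noteq> {} \<Longrightarrow> C \<ge> 0"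
  by (metis all_not_in_conv hoelder_leD(1) norm_ge_zero order_trans)

lemma hoelder_le_add:
  assumes "hoelder_le \<alpha> X C f" "hoelder_le \<alpha> X C' g"
  shows "hoelder_le \<alpha> X (C + C') (\<lambda>x. f x + g x)"
  unfolding hoelder_le_def
proof (intro conjI ballI)
  fix x y assume x: "x \<in> X"
  show "norm (f x + g x) \<le> C + C'"
    using hoelder_leD(1)[OF assms(1) x] hoelder_leD(1)[OF assms(2) x] by (rule norm_triangle_mono)
  assume y: "y \<in> X"
  have "norm ((f x - f y) + (g x - g y)) \<le> C * dist x y powr \<alpha> + C' * dist x y powr \<alpha>"
    using hoelder_leD(2)[OF assms(1) x y] hoelder_leD(2)[OF assms(2) x y] by (rule norm_triangle_mono)
  then show "norm ((f x + g x) - (f y + g y)) \<le> (C + C') * dist x y powr \<alpha>"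
    by (simp add: algebra_simps)
qed

lemma hoelder_le_diff:
  assumes "hoelder_le \<alpha> X C f" "hoelder_le \<alpha> X C' g"
  shows "hoelder_le \<alpha> X (C + C') (\<lambda>x. f x - g x)"
  using hoelder_le_add[OF assms(1) hoelder_le_scaleR[OF assms(2), of "- 1"]] by simp

lemma hoelder_le_const: "hoelder_le \<alpha> X (norm c) (\<lambda>_. c)"
  by (simp add: hoelder_le_def)

lemma hoelder_le_cong: "hoelder_le \<alpha> X C f \<Longrightarrow> (\<And>x. x \<in> X \<Longrightarrow> f x = g x) \<Longrightarrow> hoelder_le \<alpha> X C g"
  by (simp add: hoelder_le_def)

lemma hoelder_le_mult:
  fixes f g :: "'a::metric_space \<Rightarrow> real"
  assumes "hoelder_le \<alpha> X C f" "hoelder_le \<alpha> X C' g"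
  shows "hoelder_le \<alpha> X (2 * C * C') (\<lambda>x. f x * g x)"
  unfolding hoelder_le_def
proof (intro conjI ballI)
  fix x y assume x: "x \<in> X"
  have C: "C \<ge> 0" "C' \<ge> 0" using hoelder_le_nonneg[OF assms(1)] hoelder_le_nonneg[OF assms(2)] x by auto
  have "norm (f x * g x) \<le> C * C'"
    unfolding norm_mult using hoelder_leD(1)[OF assms(1) x] hoelder_leD(1)[OF assms(2) x] C by (intro mult_mono) auto
  then show "norm (f x * g x) \<le> 2 * C * C'" using mult_nonneg_nonneg[OF C] by linarith
  assume y: "y \<in> X"
  have "f x * g x - f y * g y = (f x - f y) * g x + f y * (g x - g y)" by (simp add: algebra_simps)
  also have "norm \<dots> \<le> (C * dist x y powr \<alpha>) * C' + C * (C' * dist x y powr \<alpha>)"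
    using hoelder_leD(2)[OF assms(1) x y] hoelder_leD(1)[OF assms(2) x] hoelder_leD(1)[OF assms(1) y] hoelder_leD(2)[OF assms(2) x y] C
    by (intro norm_triangle_mono) (auto simp: abs_mult intro!: mult_mono)
  finally show "norm (f x * g x - f y * g y) \<le> 2 * C * C' * dist x y powr \<alpha>" by (simp add: algebra_simps)
qed

lemma norm_vec_le_sum: "norm (v :: 'b::real_normed_vector ^ 'n) \<le> (\<Sum>i\<in>UNIV. norm (v $ i))"
  unfolding norm_vec_def by (rule L2_set_le_sum) simp

lemma hoelder_le_vec:
  fixes f :: "'a::metric_space \<Rightarrow> 'b::real_normed_vector ^ 'n"
  assumes "\<And>i. hoelder_le \<alpha> X C (\<lambda>x. f x $ i)"
  shows "hoelder_le \<alpha> X (real CARD('n) * C) f"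
  unfolding hoelder_le_def
proof (intro conjI ballI)
  fix x y assume x: "x \<in> X"
  have "norm (f x) \<le> (\<Sum>i\<in>(UNIV::'n set). C)"
    by (rule order_trans[OF norm_vec_le_sum sum_mono]) (rule hoelder_leD(1)[OF assms x])
  then show "norm (f x) \<le> real CARD('n) * C" by simp
  assume y: "y \<in> X"
  have "norm (f x - f y) \<le> (\<Sum>i\<in>(UNIV::'n set). C * dist x y powr \<alpha>)"
    by (rule order_trans[OF norm_vec_le_sum sum_mono]) (use hoelder_leD(2)[OF assms x y] in simp)
  then show "norm (f x - f y) \<le> real CARD('n) * C * dist x y powr \<alpha>" by simp
qed

lemma hoelder_le_nth:
  assumes "hoelder_le \<alpha> X C f"
  shows "hoelder_le \<alpha> X C (\<lambda>x. f x $ i)"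
  unfolding hoelder_le_def
proof (intro conjI ballI)
  fix x y assume x: "x \<in> X"
  show "norm (f x $ i) \<le> C" by (rule order_trans[OF Finite_Cartesian_Product.norm_nth_le hoelder_leD(1)[OF assms x]])
  assume y: "y \<in> X"
  show "norm (f x $ i - f y $ i) \<le> C * dist x y powr \<alpha>"
    by (rule order_trans[OF Finite_Cartesian_Product.norm_nth_le[of "f x - f y" i, unfolded vector_minus_component] hoelder_leD(2)[OF assms x y]])
qed

lemma hoelder_le_Pair:
  assumes "hoelder_le \<alpha> X C f" "hoelder_le \<alpha> X C' g"
  shows "hoelder_le \<alpha> X (C + C') (\<lambda>x. (f x, g x))"
  unfolding hoelder_le_def
proof (intro conjI ballI)
  fix x y assume x: "x \<in> X"
  show "norm (f x, g x) \<le> C + C'"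
    using norm_Pair_le[of "f x" "g x"] hoelder_leD(1)[OF assms(1) x] hoelder_leD(1)[OF assms(2) x] by linarith
  assume y: "y \<in> X"
  show "norm ((f x, g x) - (f y, g y)) \<le> (C + C') * dist x y powr \<alpha>"
    using norm_Pair_le[of "f x - f y" "g x - g y"] hoelder_leD(2)[OF assms(1) x y] hoelder_leD(2)[OF assms(2) x y]
    by (simp add: distrib_right)
qed

text \<open>Stability under pointwise limits plays the part of completeness of the Hoelder
  space.\<close>

lemma hoelder_le_limit:
  assumes "\<And>k. hoelder_le \<alpha> X C (F k)" "\<And>x. x \<in> X \<Longrightarrow> (\<lambda>k. F k x) \<longlonglongrightarrow> f x"
  shows "hoelder_le \<alpha> X C f"
  unfolding hoelder_le_def
proof (intro conjI ballI)
  fix x y assume x: "x \<in> X"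
  show "norm (f x) \<le> C"
    by (rule LIMSEQ_le_const2[OF tendsto_norm[OF assms(2)[OF x]]]) (use hoelder_leD(1)[OF assms(1) x] in blast)
  assume y: "y \<in> X"
  show "norm (f x - f y) \<le> C * dist x y powr \<alpha>"
    by (rule LIMSEQ_le_const2[OF tendsto_norm[OF tendsto_diff[OF assms(2)[OF x] assms(2)[OF y]]]])
      (use hoelder_leD(2)[OF assms(1) x y] in blast)
qed

text \<open>The support condition belongs to the ball because averages at a large scale are small
  only for compactly supported functions; it survives pointwise limits.\<close>

definition hoelder_ball :: "real \<Rightarrow> real \<Rightarrow> real \<Rightarrow> ('a::real_normed_vector \<Rightarrow> 'b::real_normed_vector) \<Rightarrow> bool" where
  "hoelder_ball \<alpha> \<rho> G f \<longleftrightarrow> hoelder_le \<alpha> UNIV G f \<and> (\<forall>x. norm x > \<rho> \<longrightarrow> f x = 0)"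

text \<open>Banach's fixed point theorem for the Hoelder norm, with distances expressed by
  \<open>hoelder_le\<close> on differences: the iterates of 0 converge pointwise, and their bounds
  pass to the limit.\<close>

lemma hoelder_fixed_point:
  fixes F :: "('a::euclidean_space \<Rightarrow> 'b::euclidean_space) \<Rightarrow> 'a \<Rightarrow> 'b"
  assumes G: "G \<ge> 0"
    and maps: "\<And>f. hoelder_ball \<alpha> \<rho> G f \<Longrightarrow> hoelder_ball \<alpha> \<rho> G (F f)"
    and contr: "\<And>f g D. hoelder_ball \<alpha> \<rho> G f \<Longrightarrow> hoelder_ball \<alpha> \<rho> G g \<Longrightarrow> hoelder_le \<alpha> UNIV D (\<lambda>x. f x - g x) \<Longrightarrow> hoelder_le \<alpha> UNIV (D / 2) (\<lambda>x. F f x - F g x)"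
  obtains f where "hoelder_ball \<alpha> \<rho> G f" "F f = f"
proof -
  define f where "f k = (F ^^ k) (\<lambda>_. 0)" for k
  have f0: "f 0 = (\<lambda>_. 0)" and fS: "f (Suc k) = F (f k)" for k by (simp_all add: f_def)
  have Pf: "hoelder_ball \<alpha> \<rho> G (f k)" for k
    by (induction k) (use G in \<open>auto simp: f0 fS maps\<close>, simp add: hoelder_ball_def hoelder_le_def)
  have step: "hoelder_le \<alpha> UNIV (2 * G / 2 ^ k) (\<lambda>x. f (Suc k) x - f k x)" for k
  proof (induction k)
    case 0
    show ?case using hoelder_le_diff[of \<alpha> UNIV G "f 1" G "f 0"] Pf[of 1] Pf[of 0] by (simp add: hoelder_ball_def)
  next
    case (Suc k)
    from contr[OF Pf[of "Suc k"] Pf[of k] this] show ?case by (simp add: fS)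
  qed
  \<comment> \<open>The exact geometric sum is kept because it makes the induction close; afterwards
    the subtracted term is dropped.\<close>
  have tail: "hoelder_le \<alpha> UNIV (4 * G / 2 ^ k - 4 * G / 2 ^ (k + m)) (\<lambda>x. f (k + m) x - f k x)" for k m
  proof (induction m)
    case 0 show ?case by (simp add: hoelder_le_def)
  next
    case (Suc m)
    have "4 * G / 2 ^ k - 4 * G / 2 ^ (k + m) + 2 * G / 2 ^ (k + m) = 4 * G / 2 ^ k - 4 * G / 2 ^ (k + Suc m)" by simp
    with hoelder_le_add[OF Suc step[of "k + m"]] show ?case by simp
  qed
  have tail': "hoelder_le \<alpha> UNIV (4 * G / 2 ^ k) (\<lambda>x. f (k + m) x - f k x)" for k m
    using G by (intro hoelder_le_mono[OF tail]) auto
  have null: "(\<lambda>k. 4 * G / 2 ^ k) \<longlonglongrightarrow> 0"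
    using tendsto_mult_right_zero[OF LIMSEQ_realpow_zero[of "1/2::real"], of "4 * G"] by (simp add: power_one_over)
  have "Cauchy (\<lambda>k. f k x)" for x
  proof (rule metric_CauchyI)
    fix e :: real assume "e > 0"
    then have "e / 2 > 0" by simp
    from order_tendstoD(2)[OF null this] obtain k where k: "4 * G / 2 ^ k < e / 2"
      by (auto simp: eventually_sequentially)
    have near: "dist (f n x) (f k x) < e / 2" if "n \<ge> k" for n
      using hoelder_leD(1)[OF tail'[of k "n - k"], of x] k that by (simp add: dist_norm)
    show "\<exists>M. \<forall>m\<ge>M. \<forall>n\<ge>M. dist (f m x) (f n x) < e"
      using near dist_triangle_half_l by (metis dist_commute)
  qed
  then have "\<exists>l. (\<lambda>k. f k x) \<longlonglongrightarrow> l" for x by (simp add: Cauchy_convergent_iff convergent_def)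
  then obtain l where l: "\<And>x. (\<lambda>k. f k x) \<longlonglongrightarrow> l x" by metis
  have Pl: "hoelder_ball \<alpha> \<rho> G l"
    unfolding hoelder_ball_def
  proof (intro conjI allI impI)
    show "hoelder_le \<alpha> UNIV G l" by (rule hoelder_le_limit[of _ _ _ f]) (use Pf l in \<open>auto simp: hoelder_ball_def\<close>)
    fix x :: 'a assume "norm x > \<rho>"
    then have "(\<lambda>k. f k x) = (\<lambda>_. 0)" using Pf by (auto simp: hoelder_ball_def)
    then show "l x = 0" using l[of x] by (simp add: LIMSEQ_const_iff)
  qed
  have close: "hoelder_le \<alpha> UNIV (4 * G / 2 ^ k) (\<lambda>x. l x - f k x)" for k
  proof (rule hoelder_le_limit[OF tail'])
    show "(\<lambda>m. f (k + m) x - f k x) \<longlonglongrightarrow> l x - f k x" for x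
      using LIMSEQ_ignore_initial_segment[OF l[of x], of k] by (intro tendsto_intros) (simp add: add.commute)
  qed
  have "F l x = l x" for x
  proof -
    have "(\<lambda>k. F l x - f (Suc k) x) \<longlonglongrightarrow> 0"
    proof (rule Lim_null_comparison[OF _ null])
      have "norm (F l x - f (Suc k) x) \<le> 4 * G / 2 ^ k" for k
      proof -
        have "norm (F l x - f (Suc k) x) \<le> (4 * G / 2 ^ k) / 2"
          using hoelder_leD(1)[OF contr[OF Pl Pf close], of x k] by (simp add: fS)
        also have "\<dots> \<le> 4 * G / 2 ^ k" using G by (simp add: field_simps)
        finally show ?thesis .
      qed
      then show "\<forall>\<^sub>F k in sequentially. norm (F l x - f (Suc k) x) \<le> 4 * G / 2 ^ k" by simp
    qed
    moreover have "(\<lambda>k. F l x - f (Suc k) x) \<longlonglongrightarrow> F l x - l x"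
      using LIMSEQ_Suc[OF l[of x]] by (intro tendsto_intros)
    ultimately show ?thesis using LIMSEQ_unique by fastforce
  qed
  then show thesis using that[OF Pl] by blast
qed

text \<open>The difference of \<open>A \<circ> z\<^sub>1 - A \<circ> z\<^sub>2\<close> at two points is the increment over \<open>t \<in> [0, 1]\<close> of
  \<open>A (w\<^sub>t x) - A (w\<^sub>t y)\<close> along the segments \<open>w\<^sub>t\<close> from \<open>z\<^sub>2\<close> to \<open>z\<^sub>1\<close>.\<close>

lemma hoelder_le_composition_diff:
  fixes A :: "'z::real_normed_vector \<Rightarrow> 'b::real_normed_vector" and z1 z2 :: "'a::metric_space \<Rightarrow> 'z"
  assumes D: "\<And>z. norm z \<le> r \<Longrightarrow> (A has_derivative A' z) (at z)"
    and A0: "\<And>z h. norm z \<le> r \<Longrightarrow> norm (A' z h) \<le> L * norm z * norm h"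
    and A1: "\<And>z w h. norm z \<le> r \<Longrightarrow> norm w \<le> r \<Longrightarrow> norm (A' z h - A' w h) \<le> L * norm (z - w) * norm h"
    and L: "L \<ge> 0" and \<delta>: "\<delta> \<le> r"
    and z1: "hoelder_le \<alpha> X \<delta> z1" and z2: "hoelder_le \<alpha> X \<delta> z2" and d: "hoelder_le \<alpha> X d (\<lambda>x. z1 x - z2 x)"
  shows "hoelder_le \<alpha> X (2 * L * \<delta> * d) (\<lambda>x. A (z1 x) - A (z2 x))"
  unfolding hoelder_le_def
proof (intro conjI ballI)
  fix x assume x: "x \<in> X"
  have \<delta>0: "\<delta> \<ge> 0" and d0: "d \<ge> 0" using hoelder_le_nonneg[OF z1] hoelder_le_nonneg[OF d] x by auto
  have seg: "norm (z2 x + t *\<^sub>R (z1 x - z2 x)) \<le> \<delta>" if "x \<in> X" "t \<in> {0..1}" for x t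
  proof -
    have "z2 x + t *\<^sub>R (z1 x - z2 x) = (1 - t) *\<^sub>R z2 x + t *\<^sub>R z1 x" by (simp add: algebra_simps)
    also have "norm \<dots> \<le> (1 - t) * \<delta> + t * \<delta>"
      using that hoelder_leD(1)[OF z1 that(1)] hoelder_leD(1)[OF z2 that(1)]
      by (intro norm_triangle_mono) (auto intro!: mult_left_mono)
    finally show ?thesis by (simp add: algebra_simps)
  qed
  have der: "((\<lambda>t. A (z2 x + t *\<^sub>R (z1 x - z2 x))) has_derivative (\<lambda>s. A' (z2 x + t *\<^sub>R (z1 x - z2 x)) (s *\<^sub>R (z1 x - z2 x)))) (at t within {0..1})"
    if "x \<in> X" "t \<in> {0..1}" for x t
  proof (rule has_derivative_compose[of "\<lambda>t. z2 x + t *\<^sub>R (z1 x - z2 x)", OF _ D])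
    show "((\<lambda>t. z2 x + t *\<^sub>R (z1 x - z2 x)) has_derivative (\<lambda>s. s *\<^sub>R (z1 x - z2 x))) (at t within {0..1})"
      by (auto intro!: derivative_eq_intros)
    show "norm (z2 x + t *\<^sub>R (z1 x - z2 x)) \<le> r" using seg[OF that] \<delta> by linarith
  qed
  have lin: "A' z (s *\<^sub>R h) = s *\<^sub>R A' z h" if "norm z \<le> r" for z s h
    by (rule linear_scale[OF has_derivative_linear[OF D[OF that]]])
  have b0: "norm (A' (z2 x + t *\<^sub>R (z1 x - z2 x)) h) \<le> L * \<delta> * norm h" if "x \<in> X" "t \<in> {0..1}" for x t h
  proof -
    have "norm (A' (z2 x + t *\<^sub>R (z1 x - z2 x)) h) \<le> L * norm (z2 x + t *\<^sub>R (z1 x - z2 x)) * norm h"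
      using seg[OF that] \<delta> by (intro A0) linarith
    also have "\<dots> \<le> L * \<delta> * norm h" using seg[OF that] L by (intro mult_right_mono mult_left_mono) auto
    finally show ?thesis .
  qed
  have "norm (A (z1 x) - A (z2 x)) = norm (A (z2 x + 1 *\<^sub>R (z1 x - z2 x)) - A (z2 x + 0 *\<^sub>R (z1 x - z2 x)))" by simp
  also have "\<dots> \<le> (L * \<delta> * d) * norm (1 - (0::real))"
  proof (rule differentiable_bound[of "{0..1::real}", OF _ der[OF x]])
    fix t :: real assume t: "t \<in> {0..1}"
    have "norm (A' (z2 x + t *\<^sub>R (z1 x - z2 x)) (s *\<^sub>R (z1 x - z2 x))) \<le> L * \<delta> * d * norm s" for s
    proof -
      have "norm (A' (z2 x + t *\<^sub>R (z1 x - z2 x)) (s *\<^sub>R (z1 x - z2 x))) \<le> L * \<delta> * (\<bar>s\<bar> * norm (z1 x - z2 x))"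
        using b0[OF x t, of "s *\<^sub>R (z1 x - z2 x)"] by simp
      also have "\<dots> \<le> L * \<delta> * (\<bar>s\<bar> * d)" using hoelder_leD(1)[OF d x] L \<delta>0 by (intro mult_left_mono) auto
      finally show ?thesis by (simp add: mult_ac)
    qed
    then show "onorm (\<lambda>s. A' (z2 x + t *\<^sub>R (z1 x - z2 x)) (s *\<^sub>R (z1 x - z2 x))) \<le> L * \<delta> * d"
      by (rule onorm_le)
  qed auto
  also have "\<dots> \<le> 2 * L * \<delta> * d" using L \<delta>0 d0 by simp
  finally show "norm (A (z1 x) - A (z2 x)) \<le> 2 * L * \<delta> * d" .
  fix y assume y: "y \<in> X"
  define q where "q = dist x y powr \<alpha>"
  have q: "q \<ge> 0" by (simp add: q_def)
  let ?w = "\<lambda>x t. z2 x + t *\<^sub>R (z1 x - z2 x)"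
  have wd: "norm (?w x t - ?w y t) \<le> \<delta> * q" if t: "t \<in> {0..1}" for t
  proof -
    have "?w x t - ?w y t = (1 - t) *\<^sub>R (z2 x - z2 y) + t *\<^sub>R (z1 x - z1 y)" by (simp add: algebra_simps)
    also have "norm \<dots> \<le> (1 - t) * (\<delta> * q) + t * (\<delta> * q)"
      using t hoelder_leD(2)[OF z1 x y] hoelder_leD(2)[OF z2 x y]
      by (intro norm_triangle_mono) (auto simp: q_def intro!: mult_left_mono)
    finally show ?thesis by (simp add: algebra_simps)
  qed
  have "norm ((A (z1 x) - A (z2 x)) - (A (z1 y) - A (z2 y))) =
      norm ((A (?w x 1) - A (?w y 1)) - (A (?w x 0) - A (?w y 0)))" by (simp add: algebra_simps)
  also have "\<dots> \<le> (2 * L * \<delta> * d * q) * norm (1 - (0::real))"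
  proof (rule differentiable_bound[of "{0..1::real}", OF _ has_derivative_diff[OF der[OF x] der[OF y]]])
    fix t :: real assume t: "t \<in> {0..1}"
    have nr: "norm (?w x t) \<le> r" "norm (?w y t) \<le> r" using seg[OF x t] seg[OF y t] \<delta> by linarith+
    have main: "norm (A' (?w x t) (z1 x - z2 x) - A' (?w y t) (z1 y - z2 y)) \<le> 2 * L * \<delta> * d * q"
    proof -
      \<comment> \<open>The first term applies one derivative, of size \<open>L * \<delta>\<close>
        by \<open>A0\<close>, to the change of the increment. The second compares derivatives at two
        points whose distance is at most \<open>\<delta> * q\<close>. Both carry the small factor
        \<delta>, and together they account for the 2.\<close>
      have "A' (?w x t) (z1 x - z2 x) - A' (?w y t) (z1 y - z2 y)
         = A' (?w x t) ((z1 x - z2 x) - (z1 y - z2 y)) + (A' (?w x t) (z1 y - z2 y) - A' (?w y t) (z1 y - z2 y))"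
        by (simp add: linear_diff[OF has_derivative_linear[OF D[OF nr(1)]]])
      also have "norm \<dots> \<le> L * \<delta> * (d * q) + L * (\<delta> * q) * d"
      proof (rule norm_triangle_mono)
        have "norm (A' (?w x t) ((z1 x - z2 x) - (z1 y - z2 y))) \<le> L * \<delta> * norm ((z1 x - z2 x) - (z1 y - z2 y))"
          by (rule b0[OF x t])
        also have "\<dots> \<le> L * \<delta> * (d * q)" using hoelder_leD(2)[OF d x y] L \<delta>0 unfolding q_def by (intro mult_left_mono) auto
        finally show "norm (A' (?w x t) ((z1 x - z2 x) - (z1 y - z2 y))) \<le> L * \<delta> * (d * q)" .
        have "norm (A' (?w x t) (z1 y - z2 y) - A' (?w y t) (z1 y - z2 y)) \<le> L * norm (?w x t - ?w y t) * norm (z1 y - z2 y)"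
          by (rule A1[OF nr])
        also have "\<dots> \<le> L * (\<delta> * q) * d"
          using wd[OF t] hoelder_leD(1)[OF d y] L \<delta>0 q by (intro mult_mono mult_left_mono) auto
        finally show "norm (A' (?w x t) (z1 y - z2 y) - A' (?w y t) (z1 y - z2 y)) \<le> L * (\<delta> * q) * d" .
      qed
      finally show ?thesis by (simp add: algebra_simps)
    qed
    have "norm (A' (?w x t) (s *\<^sub>R (z1 x - z2 x)) - A' (?w y t) (s *\<^sub>R (z1 y - z2 y))) \<le> 2 * L * \<delta> * d * q * norm s" for s
    proof -
      have "A' (?w x t) (s *\<^sub>R (z1 x - z2 x)) - A' (?w y t) (s *\<^sub>R (z1 y - z2 y)) = s *\<^sub>R (A' (?w x t) (z1 x - z2 x) - A' (?w y t) (z1 y - z2 y))"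
        unfolding lin[OF nr(1)] lin[OF nr(2)] by (rule scaleR_diff_right[symmetric])
      then show ?thesis using mult_right_mono[OF main, of "norm s"] by (simp add: mult.commute)
    qed
    then show "onorm (\<lambda>s. A' (?w x t) (s *\<^sub>R (z1 x - z2 x)) - A' (?w y t) (s *\<^sub>R (z1 y - z2 y))) \<le> 2 * L * \<delta> * d * q"
      by (rule onorm_le)
  qed auto
  finally show "norm (A (z1 x) - A (z2 x) - (A (z1 y) - A (z2 y))) \<le> 2 * L * \<delta> * d * dist x y powr \<alpha>"
    by (simp add: q_def)
qed

section \<open>Cutoff functions\<close>

definition cutoff :: "real \<Rightarrow> 'a::real_normed_vector \<Rightarrow> real" where
  "cutoff R x = max 0 (min 1 (2 - norm x / R))"

lemma cutoff_bounds: "0 \<le> cutoff R x" "cutoff R x \<le> 1"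
  by (auto simp: cutoff_def)

lemma cutoff_eq_1: "R > 0 \<Longrightarrow> norm x \<le> R \<Longrightarrow> cutoff R x = 1"
  by (simp add: cutoff_def field_simps)

lemma cutoff_eq_0: "R > 0 \<Longrightarrow> norm x > 2 * R \<Longrightarrow> cutoff R x = 0"
  by (simp add: cutoff_def field_simps)

text \<open>The Lipschitz bound \<open>u\<close> and the trivial bound 1 combine, since the smaller
  of \<open>u\<close> and 1 is at most \<open>u powr \<alpha>\<close>.\<close>

lemma cutoff_hoelder:
  assumes R: "R > 0" and \<alpha>: "0 < \<alpha>" "\<alpha> < 1"
  shows "\<bar>cutoff R x - cutoff R y\<bar> \<le> (1 / R) powr \<alpha> * dist x y powr \<alpha>"
proof -
  define u where "u = dist x y / R"
  have u: "u \<ge> 0" using R by (simp add: u_def)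
  have "\<bar>norm x / R - norm y / R\<bar> \<le> u"
    unfolding u_def dist_norm using R norm_triangle_ineq3[of x y] by (simp flip: diff_divide_distrib add: abs_divide divide_right_mono)
  then have c: "\<bar>cutoff R x - cutoff R y\<bar> \<le> u" "\<bar>cutoff R x - cutoff R y\<bar> \<le> 1" unfolding cutoff_def by linarith+
  have "\<bar>cutoff R x - cutoff R y\<bar> \<le> u powr \<alpha>"
  proof (cases "u \<le> 1")
    case True
    show ?thesis
    proof (cases "u = 0")
      case False
      then have "u powr 1 \<le> u powr \<alpha>" using True u \<alpha> by (intro powr_mono') auto
      then show ?thesis using c u by simp
    qed (use c in simp)
  next
    case False
    then have "u powr \<alpha> \<ge> 1" using \<alpha> by (intro ge_one_powr_ge_zero) auto
    then show ?thesis using c by linarith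
  qed
  also have "u powr \<alpha> = (1 / R) powr \<alpha> * dist x y powr \<alpha>"
    using R by (simp add: u_def powr_divide)
  finally show ?thesis .
qed

text \<open>At points outside the ball the product is 0 whatever \<open>f\<close> does there. So it
  is enough to treat pairs with one point inside, taking the increment of the cutoff with the value
  of \<open>f\<close> at that point.\<close>

lemma hoelder_le_cutoff:
  fixes f :: "'a::real_normed_vector \<Rightarrow> 'b::real_normed_vector"
  assumes f: "hoelder_le \<alpha> (cball 0 (2 * R)) C f" and R: "R > 0" and \<alpha>: "0 < \<alpha>" "\<alpha> < 1"
  shows "hoelder_le \<alpha> UNIV ((1 + (1 / R) powr \<alpha>) * C) (\<lambda>x. cutoff R x *\<^sub>R f x)"
proof -
  define Q where "Q = (1 / R) powr \<alpha>"
  have Q: "Q \<ge> 0" by (simp add: Q_def)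
  have C: "C \<ge> 0" using hoelder_le_nonneg[OF f] R by (simp add: not_less)
  have in_or: "x \<in> cball 0 (2 * R) \<or> cutoff R x = 0" for x :: 'a
    using cutoff_eq_0[OF R, of x] by (cases "norm x > 2 * R") auto
  have half: "norm (cutoff R x *\<^sub>R f x - cutoff R y *\<^sub>R f y) \<le> ((1 + Q) * C) * dist x y powr \<alpha>" if x: "x \<in> cball 0 (2 * R)" for x y
  proof -
    have 1: "norm ((cutoff R x - cutoff R y) *\<^sub>R f x) \<le> (Q * dist x y powr \<alpha>) * C"
      unfolding norm_scaleR using cutoff_hoelder[OF R \<alpha>, of x y] hoelder_leD(1)[OF f x] Q
      by (intro mult_mono) (auto simp: Q_def)
    have 2: "norm (cutoff R y *\<^sub>R (f x - f y)) \<le> C * dist x y powr \<alpha>"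
    proof (cases "cutoff R y = 0")
      case False
      then have "norm (f x - f y) \<le> C * dist x y powr \<alpha>" using in_or[of y] hoelder_leD(2)[OF f x] by blast
      then have "\<bar>cutoff R y\<bar> * norm (f x - f y) \<le> 1 * (C * dist x y powr \<alpha>)"
        using cutoff_bounds[of R y] by (intro mult_mono) auto
      then show ?thesis by simp
    qed (use C in simp)
    have "norm ((cutoff R x - cutoff R y) *\<^sub>R f x + cutoff R y *\<^sub>R (f x - f y)) \<le> (Q * dist x y powr \<alpha>) * C + C * dist x y powr \<alpha>"
      using 1 2 by (rule norm_triangle_mono)
    then show ?thesis by (simp add: algebra_simps)
  qed
  show ?thesis
    unfolding hoelder_le_def Q_def[symmetric]
  proof (intro conjI ballI)
    fix x y :: 'a
    show "norm (cutoff R x *\<^sub>R f x) \<le> (1 + Q) * C"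
    proof (cases "cutoff R x = 0")
      case False
      then have "norm (f x) \<le> C" using in_or hoelder_leD(1)[OF f] by blast
      then have "\<bar>cutoff R x\<bar> * norm (f x) \<le> 1 * C" using cutoff_bounds[of R x] by (intro mult_mono) auto
      then show ?thesis using mult_nonneg_nonneg[OF Q C] by (simp add: distrib_right)
    qed (use Q C in simp)
    show "norm (cutoff R x *\<^sub>R f x - cutoff R y *\<^sub>R f y) \<le> (1 + Q) * C * dist x y powr \<alpha>"
    proof (cases "x \<in> cball 0 (2 * R)")
      case False
      note out = this
      then have x0: "cutoff R x = 0" using in_or by blast
      show ?thesis
      proof (cases "y \<in> cball 0 (2 * R)")
        case True
        then show ?thesis using half[OF True, of x] by (simp add: norm_minus_commute dist_commute)
      next
        case False
        then show ?thesis using x0 in_or[of y] Q C by auto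
      qed
    qed (rule half)
  qed
qed

section \<open>Nonlinearities and jets\<close>

text \<open>Relative derivatives are determined on the subspace itself, as restriction to the line
  through \<open>v\<close> shows.\<close>

lemma derivative_zero_on_subspace:
  assumes D: "(f has_derivative f') (at 0 within D)" and D0: "(f has_derivative (\<lambda>h. 0)) (at 0 within D)"
    and sub: "subspace D" and v: "v \<in> D"
  shows "f' v = 0"
proof -
  have p: "((\<lambda>t::real. t *\<^sub>R v) has_derivative (\<lambda>s. s *\<^sub>R v)) (at 0)" by (auto intro!: derivative_eq_intros)
  have im: "range (\<lambda>t::real. t *\<^sub>R v) \<subseteq> D" using subspace_scale[OF sub v] by auto
  have "((\<lambda>t::real. f (t *\<^sub>R v)) has_derivative (\<lambda>s. f' (s *\<^sub>R v))) (at 0)"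
    by (rule has_derivative_in_compose[OF p]) (use has_derivative_subset[OF D im] in simp)
  moreover have "((\<lambda>t::real. f (t *\<^sub>R v)) has_derivative (\<lambda>s. 0)) (at 0)"
    by (rule has_derivative_in_compose[OF p]) (use has_derivative_subset[OF D0 im] in simp)
  ultimately have "(\<lambda>s::real. f' (s *\<^sub>R v)) = (\<lambda>s. 0)" by (rule has_derivative_unique)
  then show ?thesis by (metis scaleR_one)
qed

text \<open>Continuity bounds \<open>f''\<close> near 0, so \<open>f'\<close> is Lipschitz on the
  convex set \<open>D \<inter> ball 0 r0\<close>, and on \<open>D\<close> it vanishes at 0.
  Precomposing with \<open>P\<close> turns derivatives relative to \<open>D\<close> into derivatives
  in the ambient space, at the cost of two factors \<open>N\<close>, a bound for
  \<open>P\<close>.\<close>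

lemma C2_on_quadratic_bounds:
  fixes f :: "'z::real_normed_vector \<Rightarrow> 'b::real_normed_vector"
  assumes f: "C2_on D f" and sub: "subspace D" and P: "bounded_linear P" "range P \<subseteq> D"
    and d0: "(f has_derivative (\<lambda>h. 0)) (at 0 within D)"
  obtains A' r L where "r > 0" "L \<ge> 0"
    "\<And>z. norm z \<le> r \<Longrightarrow> ((\<lambda>z. f (P z)) has_derivative A' z) (at z)"
    "\<And>z h. norm z \<le> r \<Longrightarrow> norm (A' z h) \<le> L * norm z * norm h"
    "\<And>z w h. norm z \<le> r \<Longrightarrow> norm w \<le> r \<Longrightarrow> norm (A' z h - A' w h) \<le> L * norm (z - w) * norm h"
proof -
  obtain f' :: "'z \<Rightarrow> 'z \<Rightarrow>\<^sub>L 'b" and f'' :: "'z \<Rightarrow> 'z \<Rightarrow>\<^sub>L 'z \<Rightarrow>\<^sub>L 'b" where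
    f': "\<And>z. z \<in> D \<Longrightarrow> (f has_derivative blinfun_apply (f' z)) (at z within D)" and
    f'': "\<And>z. z \<in> D \<Longrightarrow> (f' has_derivative blinfun_apply (f'' z)) (at z within D)" and
    cont: "continuous_on D f''"
    using f unfolding C2_on_def by blast
  have 0: "0 \<in> D" by (rule subspace_0[OF sub])
  obtain r0 where r0: "r0 > 0" and near: "\<And>z. z \<in> D \<Longrightarrow> dist z 0 < r0 \<Longrightarrow> dist (f'' z) (f'' 0) < 1"
    using cont 0 unfolding continuous_on_iff by (metis zero_less_one)
  define M where "M = norm (f'' 0) + 1"
  have M: "norm (f'' z) \<le> M" if "z \<in> D" "norm z < r0" for z
  proof -
    have "norm (f'' z - f'' 0) < 1" using near[OF that(1)] that(2) by (simp add: dist_norm)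
    then show ?thesis using norm_triangle_ineq2[of "f'' z" "f'' 0"] by (simp add: M_def)
  qed
  have M0: "M \<ge> 0" by (simp add: M_def)
  have lip: "norm (f' z - f' w) \<le> M * norm (z - w)" if "z \<in> D \<inter> ball 0 r0" "w \<in> D \<inter> ball 0 r0" for z w
  proof (rule differentiable_bound[of "D \<inter> ball 0 r0" f' "\<lambda>z. blinfun_apply (f'' z)"])
    show "convex (D \<inter> ball 0 r0)" by (intro convex_Int subspace_imp_convex[OF sub] convex_ball)
    show "(f' has_derivative blinfun_apply (f'' z)) (at z within D \<inter> ball 0 r0)" if "z \<in> D \<inter> ball 0 r0" for z
      using f''[of z] that by (auto intro: has_derivative_subset)
    show "onorm (blinfun_apply (f'' z)) \<le> M" if "z \<in> D \<inter> ball 0 r0" for z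
      using M[of z] that by (simp add: norm_blinfun.rep_eq[symmetric])
  qed (use that in auto)
  obtain N where N: "N > 0" "\<And>z. norm (P z) \<le> norm z * N" using bounded_linear.pos_bounded[OF P(1)] by blast
  define A' where "A' z h = blinfun_apply (f' (P z)) (P h)" for z h
  have PD: "P z \<in> D" for z using P(2) by auto
  have small: "P z \<in> D \<inter> ball 0 r0" if "norm z \<le> r0 / (2 * N)" for z
  proof -
    have "norm z * N \<le> r0 / (2 * N) * N" using that N by (intro mult_right_mono) auto
    then have "norm (P z) < r0" using N(2)[of z] N(1) r0 by simp
    then show ?thesis using PD by simp
  qed
  have diff: "norm (A' z h - A' w h) \<le> M * N * N * norm (z - w) * norm h"
    if "norm z \<le> r0 / (2 * N)" "norm w \<le> r0 / (2 * N)" for z w h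
  proof -
    have "norm (A' z h - A' w h) = norm (blinfun_apply (f' (P z) - f' (P w)) (P h))"
      by (simp add: A'_def blinfun.diff_left)
    also have "\<dots> \<le> norm (f' (P z) - f' (P w)) * norm (P h)" by (rule norm_blinfun)
    also have "\<dots> \<le> (M * (norm (z - w) * N)) * (norm h * N)"
    proof (intro mult_mono N)
      have "norm (f' (P z) - f' (P w)) \<le> M * norm (P z - P w)" by (rule lip[OF small small]) fact+
      also have "\<dots> \<le> M * (norm (z - w) * N)"
        using N(2)[of "z - w"] M0 by (intro mult_left_mono) (simp_all add: linear_diff[OF bounded_linear.linear[OF P(1)]])
      finally show "norm (f' (P z) - f' (P w)) \<le> M * (norm (z - w) * N)" .
    qed (use M0 N in auto)
    finally show ?thesis by (simp add: mult_ac)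
  qed
  show thesis
  proof
    show "r0 / (2 * N) > 0" using r0 N by simp
    show "M * N * N \<ge> 0" using M0 N by simp
    show "((\<lambda>z. f (P z)) has_derivative A' z) (at z)" for z
      unfolding A'_def[abs_def]
      by (rule has_derivative_in_compose2[where g' = "\<lambda>z. blinfun_apply (f' z)", OF f' P(2)])
        (auto intro: bounded_linear_imp_has_derivative[OF P(1)])
    show "norm (A' z h - A' w h) \<le> M * N * N * norm (z - w) * norm h"
      if "norm z \<le> r0 / (2 * N)" "norm w \<le> r0 / (2 * N)" for z w h
      by (rule diff[OF that])
    have P0: "P 0 = 0" by (rule linear_0[OF bounded_linear.linear[OF P(1)]])
    have "A' 0 h = 0" for h
      unfolding A'_def P0 by (rule derivative_zero_on_subspace[OF f'[OF 0] d0 sub PD])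
    then show "norm (A' z h) \<le> M * N * N * norm z * norm h" if "norm z \<le> r0 / (2 * N)" for z h
      using diff[OF that, of 0 h] r0 N by simp
  qed
qed

section \<open>Projection onto symmetric jets\<close>

text \<open>The projection onto \<open>jet_space\<close>. Composed with it, \<open>a\<close> becomes
  differentiable in all ambient directions, while nothing changes on symmetric jets.\<close>

definition symmetrize :: "(real ^ 'm) \<times> (real ^ 'n ^ 'm) \<times> (real ^ 'n ^ 'n ^ 'm) \<Rightarrow> (real ^ 'm) \<times> (real ^ 'n ^ 'm) \<times> (real ^ 'n ^ 'n ^ 'm)" where
  "symmetrize z = (fst z, fst (snd z), \<chi> k i j. (snd (snd z) $ k $ i $ j + snd (snd z) $ k $ j $ i) / 2)"

lemma bounded_linear_symmetrize: "bounded_linear symmetrize"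
proof -
  have "linear symmetrize"
    by (rule linearI) (auto simp: symmetrize_def prod_eq_iff vec_eq_iff add_divide_distrib distrib_left)
  then show ?thesis by (rule linear_conv_bounded_linear[THEN iffD1])
qed

lemma symmetrize_in_jet_space: "range symmetrize \<subseteq> jet_space"
  by (auto simp: symmetrize_def jet_space_def vec_eq_iff transpose_def add.commute)

lemma subspace_jet_space: "subspace jet_space"
  by (auto simp: subspace_def jet_space_def vec_eq_iff transpose_def zero_prod_def)

lemma symmetrize_ident:
  assumes "\<And>k i j. r $ k $ i $ j = r $ k $ j $ i"
  shows "symmetrize (p, q, r) = (p, q, r)"
  using assms by (simp add: symmetrize_def vec_eq_iff)

section \<open>Derivatives and jets on closed balls\<close>

text \<open>At boundary points only directions into the ball are available. Segments from
  \<open>x\<close> to \<open>y\<close> in the ball show that the difference \<open>L\<close> of the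
  candidates vanishes on \<open>y - x\<close>; taking \<open>y = 0\<close> gives
  \<open>L x = 0\<close>, so \<open>L\<close> vanishes on the whole ball, which spans the
  space.\<close>

lemma has_derivative_within_cball_unique:
  fixes u :: "'a::real_normed_vector \<Rightarrow> 'b::real_normed_vector"
  assumes L1: "(u has_derivative L1) (at x within cball 0 R)" and L2: "(u has_derivative L2) (at x within cball 0 R)"
    and x: "x \<in> cball 0 R" and R: "R > 0"
  shows "L1 = L2"
proof -
  define L where "L h = L1 h - L2 h" for h
  have lin: "linear L" unfolding L_def
    by (intro linear_compose_sub has_derivative_linear[OF L1] has_derivative_linear[OF L2])
  have dir: "L y = L x" if y: "y \<in> cball 0 R" for y
  proof -
    have im: "(\<lambda>t. x + t *\<^sub>R (y - x)) ` {0..1} \<subseteq> cball 0 R"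
    proof
      fix z assume "z \<in> (\<lambda>t. x + t *\<^sub>R (y - x)) ` {0..1}"
      then obtain t where t: "0 \<le> t" "t \<le> 1" "z = (1 - t) *\<^sub>R x + t *\<^sub>R y" by (auto simp: algebra_simps)
      show "z \<in> cball 0 R"
        using convexD_alt[OF convex_cball x y t(1,2)] t(3) by simp
    qed
    have p: "((\<lambda>t. x + t *\<^sub>R (y - x)) has_derivative (\<lambda>s. s *\<^sub>R (y - x))) (at 0 within {0..1})"
      by (auto intro!: derivative_eq_intros)
    have "((\<lambda>t. u (x + t *\<^sub>R (y - x))) has_vector_derivative L' (y - x)) (at 0 within {0..1})"
      if L': "(u has_derivative L') (at x within cball 0 R)" for L'
    proof -
      have "((\<lambda>t. u (x + t *\<^sub>R (y - x))) has_derivative (\<lambda>s. L' (s *\<^sub>R (y - x)))) (at 0 within {0..1})"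
        by (rule has_derivative_in_compose[OF p]) (use has_derivative_subset[OF L' im] in simp)
      then show ?thesis
        by (simp add: has_vector_derivative_def linear_scale[OF has_derivative_linear[OF L']])
    qed
    from vector_derivative_unique_within_closed_interval[of 0 1 0, OF _ _ this[OF L1, folded cbox_interval] this[OF L2, folded cbox_interval]]
    have "L (y - x) = 0" by (simp add: L_def)
    then show ?thesis by (simp add: linear_diff[OF lin])
  qed
  have "L y = 0" if "y \<in> cball 0 R" for y
    using dir[OF that] dir[of 0] R linear_0[OF lin] by simp
  then have z: "L ((R / norm h) *\<^sub>R h) = 0" for h using R by simp
  have "L h = 0" for h
  proof (cases "h = 0")
    case False
    then show ?thesis using z[of h] R by (simp add: linear_scale[OF lin])
  qed (simp add: linear_0[OF lin])
  then show ?thesis by (simp add: L_def fun_eq_iff)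
qed

lemma jacobian_within_cball:
  fixes u :: "real ^ 'n \<Rightarrow> real ^ 'm"
  assumes u: "(u has_derivative L) (at x within cball 0 R)" and "x \<in> cball 0 R" "R > 0"
  shows "jacobian u (at x within cball 0 R) $ k $ i = L (axis i 1) $ k"
proof -
  have "u differentiable at x within cball 0 R" using u by (rule differentiableI)
  then have "(u has_derivative frechet_derivative u (at x within cball 0 R)) (at x within cball 0 R)"
    by (simp add: frechet_derivative_works)
  from has_derivative_within_cball_unique[OF this u assms(2,3)] show ?thesis
    by (simp add: jacobian_def matrix_def)
qed

text \<open>The derivatives are passed explicitly, as functions of directions and point, so that
  jets depend linearly on the data. \<open>u2 e e'\<close> differentiates along \<open>e\<close>
  first and \<open>e'\<close> second, in agreement with the index order of
  \<open>grad2\<close>.\<close>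

definition jet :: "(real ^ 'n \<Rightarrow> real ^ 'm) \<Rightarrow> (real ^ 'n \<Rightarrow> real ^ 'n \<Rightarrow> real ^ 'm) \<Rightarrow> (real ^ 'n \<Rightarrow> real ^ 'n \<Rightarrow> real ^ 'n \<Rightarrow> real ^ 'm) \<Rightarrow>
    real ^ 'n \<Rightarrow> (real ^ 'm) \<times> (real ^ 'n ^ 'm) \<times> (real ^ 'n ^ 'n ^ 'm)" where
  "jet u u1 u2 x = (u x, \<chi> k i. u1 (axis i 1) x $ k, \<chi> k i j. u2 (axis i 1) (axis j 1) x $ k)"

text \<open>Restricting makes a solution extensional, so that distinct solutions differ on the ball
  itself; uniqueness of derivatives within the ball identifies its relative derivatives with those
  of \<open>u\<close>, boundary included.\<close>

lemma jet_of_restriction: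
  fixes u :: "real ^ 'n \<Rightarrow> real ^ 'm"
  assumes u1: "\<And>x. (u has_derivative (\<lambda>h. u1 h x)) (at x)" and u2: "\<And>e x. (u1 e has_derivative (\<lambda>h. u2 e h x)) (at x)"
    and R: "R > 0"
  defines "S \<equiv> cball 0 R"
  defines "v \<equiv> restrict u S"
  shows "x \<in> S \<Longrightarrow> (v x, grad S v x, grad2 S v x) = jet u u1 u2 x"
    and "v differentiable_on S" and "(\<lambda>x. grad S v x $ k) differentiable_on S"
proof -
  have v: "(v has_derivative (\<lambda>h. u1 h x)) (at x within S)" if "x \<in> S" for x
    by (rule has_derivative_transform[OF that _ has_derivative_at_withinI[OF u1]]) (simp add: v_def)
  have g: "grad S v x = (\<chi> k i. u1 (axis i 1) x $ k)" if "x \<in> S" for x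
    using jacobian_within_cball[OF v[unfolded S_def] _ R, of x] that by (simp add: grad_def vec_eq_iff S_def)
  have gd: "((\<lambda>x. grad S v x $ k) has_derivative (\<lambda>h. \<chi> i. u2 (axis i 1) h x $ k)) (at x within S)" if "x \<in> S" for x k
  proof (rule has_derivative_transform[OF that])
    show "grad S v y $ k = (\<chi> i. u1 (axis i 1) y $ k)" if "y \<in> S" for y using g[OF that] by simp
    have c: "((\<lambda>y. u1 e y $ k) has_derivative (\<lambda>h. u2 e h x $ k)) (at x within S)" for e
      by (rule bounded_linear.has_derivative[OF bounded_linear_vec_nth has_derivative_at_withinI[OF u2]])
    show "((\<lambda>y. \<chi> i. u1 (axis i 1) y $ k) has_derivative (\<lambda>h. \<chi> i. u2 (axis i 1) h x $ k)) (at x within S)"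
      by (subst has_derivative_componentwise_within) (auto simp: Basis_vec_def inner_axis intro!: c)
  qed
  have g2: "grad2 S v x = (\<chi> k i j. u2 (axis i 1) (axis j 1) x $ k)" if "x \<in> S" for x
    using jacobian_within_cball[OF gd[unfolded S_def] _ R, of x] that by (simp add: grad2_def vec_eq_iff S_def)
  show "(v x, grad S v x, grad2 S v x) = jet u u1 u2 x" if "x \<in> S"
    using g[OF that] g2[OF that] that by (simp add: jet_def v_def)
  show "v differentiable_on S" unfolding differentiable_on_def using v differentiableI by blast
  show "(\<lambda>x. grad S v x $ k) differentiable_on S" unfolding differentiable_on_def using gd differentiableI by blast
qed

lemma has_vector_derivative_along_line:
  fixes u :: "'a::euclidean_space \<Rightarrow> 'b::real_normed_vector"
  assumes "\<And>x. (u has_derivative (\<lambda>h. u1 h x)) (at x)"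
  shows "((\<lambda>t. u (z + t *\<^sub>R e)) has_vector_derivative u1 e (z + t *\<^sub>R e)) (at t)"
  using vector_derivative_diff_chain_within[OF line_has_vector_derivative has_derivative_at_withinI[OF assms]]
  unfolding o_def .

text \<open>Reflecting coordinate \<open>i\<close> preserves the norm, so near any point of the
  \<open>j\<close>-axis close to the origin \<open>u\<close> is even in the
  \<open>i\<close>-direction. Its \<open>i\<close>-derivative therefore vanishes along that axis,
  and so does the derivative of this along the axis. Coordinates below \<open>R / 2\<close> keep all
  points in the ball.\<close>

lemma radially_symmetric_mixed_derivative:
  fixes u :: "real ^ 'n \<Rightarrow> real ^ 'm"
  assumes u1: "\<And>x. (u has_derivative (\<lambda>h. u1 h x)) (at x)" and u2: "\<And>e x. (u1 e has_derivative (\<lambda>h. u2 e h x)) (at x)"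
    and R: "R > 0" and sym: "radially_symmetric_on (cball 0 R) (restrict u (cball 0 R))" and ij: "i \<noteq> j"
  shows "u2 (axis i 1) (axis j 1) 0 = 0"
proof -
  let ?i = "axis i 1 :: real ^ 'n" and ?j = "axis j 1 :: real ^ 'n"
  have even: "u (t *\<^sub>R ?j + s *\<^sub>R ?i) = u (t *\<^sub>R ?j + (- s) *\<^sub>R ?i)" if "\<bar>t\<bar> < R / 2" "\<bar>s\<bar> < R / 2" for t s
  proof -
    have n: "norm (t *\<^sub>R ?j + s *\<^sub>R ?i) \<le> R" if "\<bar>s\<bar> < R / 2" for s
      using norm_triangle_ineq[of "t *\<^sub>R ?j" "s *\<^sub>R ?i"] that \<open>\<bar>t\<bar> < R / 2\<close> by simp
    have "orthogonal (t *\<^sub>R ?j) (s *\<^sub>R ?i)" for s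
      using ij by (simp add: orthogonal_def inner_axis_axis)
    then have P: "(norm (t *\<^sub>R ?j + s *\<^sub>R ?i))\<^sup>2 = (norm (t *\<^sub>R ?j))\<^sup>2 + (norm (s *\<^sub>R ?i))\<^sup>2" for s
      by (rule norm_add_Pythagorean)
    have "(norm (t *\<^sub>R ?j + s *\<^sub>R ?i))\<^sup>2 = (norm (t *\<^sub>R ?j + (- s) *\<^sub>R ?i))\<^sup>2"
      unfolding P by simp
    then have "norm (t *\<^sub>R ?j + s *\<^sub>R ?i) = norm (t *\<^sub>R ?j + (- s) *\<^sub>R ?i)"
      by (simp only: power2_eq_iff_nonneg norm_ge_zero)
    moreover have m: "t *\<^sub>R ?j + s *\<^sub>R ?i \<in> cball 0 R" "t *\<^sub>R ?j + (- s) *\<^sub>R ?i \<in> cball 0 R"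
      unfolding mem_cball_0 by (rule n, use that(2) in simp)+
    ultimately have "restrict u (cball 0 R) (t *\<^sub>R ?j + s *\<^sub>R ?i) = restrict u (cball 0 R) (t *\<^sub>R ?j + (- s) *\<^sub>R ?i)"
      using sym unfolding radially_symmetric_on_def by blast
    then show ?thesis by (simp only: restrict_apply m if_True)
  qed
  have zero: "u1 ?i (t *\<^sub>R ?j) = 0" if t: "\<bar>t\<bar> < R / 2" for t
  proof -
    let ?\<phi> = "\<lambda>s. u (t *\<^sub>R ?j + s *\<^sub>R ?i)"
    have lin: "linear (\<lambda>h. u1 h x)" for x by (rule has_derivative_linear[OF u1])
    have d: "(?\<phi> has_vector_derivative u1 ?i (t *\<^sub>R ?j)) (at 0)"
      using has_vector_derivative_along_line[OF u1, of "t *\<^sub>R ?j" ?i 0] by simp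
    have "((?\<phi> \<circ> uminus) has_vector_derivative (- 1) *\<^sub>R u1 ?i (t *\<^sub>R ?j)) (at 0)"
      by (rule vector_diff_chain_at) (use d in \<open>auto intro!: derivative_eq_intros\<close>)
    then have "(?\<phi> has_vector_derivative (- 1) *\<^sub>R u1 ?i (t *\<^sub>R ?j)) (at 0)"
      by (rule has_vector_derivative_transform_within_open[of _ _ _ "{- (R/2) <..< R/2}"])
        (use R even[OF t] in \<open>auto simp: abs_less_iff\<close>)
    from vector_derivative_unique_at[OF d this]
    have "2 *\<^sub>R u1 ?i (t *\<^sub>R ?j) = 0"
      by (metis scaleR_2 scaleR_minus1_left add.right_inverse)
    then show ?thesis by (simp only: scaleR_eq_0_iff) simp
  qed
  have "((\<lambda>t. u1 ?i (0 + t *\<^sub>R ?j)) has_vector_derivative u2 ?i ?j 0) (at 0)"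
    using has_vector_derivative_along_line[OF u2, of ?i 0 ?j 0] by simp
  moreover have "((\<lambda>t. u1 ?i (0 + t *\<^sub>R ?j)) has_vector_derivative 0) (at 0)"
    by (rule has_vector_derivative_transform_within_open[of "\<lambda>_. 0" _ _ "{- (R/2) <..< R/2}"])
      (use R zero in auto)
  ultimately show ?thesis by (rule vector_derivative_unique_at)
qed

lemma hoelder_le_jet:
  fixes u :: "real ^ 'n \<Rightarrow> real ^ 'm"
  assumes "hoelder_le \<alpha> X C u" "\<And>e. norm e \<le> 1 \<Longrightarrow> hoelder_le \<alpha> X C (u1 e)"
    and "\<And>e e'. norm e \<le> 1 \<Longrightarrow> norm e' \<le> 1 \<Longrightarrow> hoelder_le \<alpha> X C (u2 e e')"
  shows "hoelder_le \<alpha> X ((1 + real CARD('m) * real CARD('n) * (1 + real CARD('n))) * C) (jet u u1 u2)"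
proof -
  have 1: "hoelder_le \<alpha> X (real CARD('m) * (real CARD('n) * C)) (\<lambda>x. \<chi> k i. u1 (axis i 1) x $ k)"
    using assms(2) by (intro hoelder_le_vec) (simp add: hoelder_le_nth)
  have 2: "hoelder_le \<alpha> X (real CARD('m) * (real CARD('n) * (real CARD('n) * C))) (\<lambda>x. \<chi> k i j. u2 (axis i 1) (axis j 1) x $ k)"
    using assms(3) by (intro hoelder_le_vec) (simp add: hoelder_le_nth)
  have "C + (real CARD('m) * (real CARD('n) * C) + real CARD('m) * (real CARD('n) * (real CARD('n) * C)))
     = (1 + real CARD('m) * real CARD('n) * (1 + real CARD('n))) * C" by (simp add: algebra_simps)
  with hoelder_le_Pair[OF assms(1) hoelder_le_Pair[OF 1 2]] show ?thesis
    unfolding jet_def[abs_def] by simp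
qed

lemma jet_add_scaleR:
  "jet (\<lambda>x. c *\<^sub>R v x + u x) (\<lambda>e x. c *\<^sub>R v1 e x + u1 e x) (\<lambda>e e' x. c *\<^sub>R v2 e e' x + u2 e e' x) x
    = c *\<^sub>R jet v v1 v2 x + jet u u1 u2 x"
  by (simp add: jet_def vec_eq_iff)

section \<open>The harmonic quadratic map\<close>

text \<open>The vector \<open>1\<close> has all entries 1, so every component is the same product of
  coordinates; for \<open>i \<noteq> j\<close> it is harmonic, with mixed derivative 1 in each
  component.\<close>

definition mixed0 :: "'n \<Rightarrow> 'n \<Rightarrow> real ^ 'n \<Rightarrow> real ^ 'm" where
  "mixed0 i j x = (x $ i * x $ j) *\<^sub>R 1"

definition mixed1 :: "'n \<Rightarrow> 'n \<Rightarrow> real ^ 'n \<Rightarrow> real ^ 'n \<Rightarrow> real ^ 'm" where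
  "mixed1 i j e x = (e $ i * x $ j + x $ i * e $ j) *\<^sub>R 1"

definition mixed2 :: "'n \<Rightarrow> 'n \<Rightarrow> real ^ 'n \<Rightarrow> real ^ 'n \<Rightarrow> real ^ 'n \<Rightarrow> real ^ 'm" where
  "mixed2 i j e e' x = (e $ i * e' $ j + e' $ i * e $ j) *\<^sub>R 1"

lemma mixed0_derivative: "(mixed0 i j has_derivative (\<lambda>h. mixed1 i j h x)) (at x)"
  unfolding mixed0_def[abs_def] mixed1_def
  by (rule has_derivative_scaleR_left, rule has_derivative_eq_rhs[OF has_derivative_mult[OF
        bounded_linear_imp_has_derivative[OF bounded_linear_vec_nth] bounded_linear_imp_has_derivative[OF bounded_linear_vec_nth]]])
    (auto simp: fun_eq_iff)

lemma mixed1_derivative: "(mixed1 i j e has_derivative (\<lambda>h. mixed2 i j e h x)) (at x)"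
  unfolding mixed1_def[abs_def] mixed2_def
  by (rule has_derivative_scaleR_left, rule has_derivative_add[OF has_derivative_mult_right[OF
        bounded_linear_imp_has_derivative[OF bounded_linear_vec_nth]] has_derivative_mult_left[OF bounded_linear_imp_has_derivative[OF bounded_linear_vec_nth]]])

lemma sum_Basis_axis:
  fixes f :: "real ^ 'n \<Rightarrow> 'b::comm_monoid_add"
  shows "(\<Sum>b\<in>Basis. f b) = (\<Sum>i\<in>UNIV. f (axis i 1))"
proof -
  have B: "(Basis :: (real ^ 'n) set) = (\<lambda>i. axis i 1) ` UNIV" by (auto simp: Basis_vec_def)
  have inj: "inj (\<lambda>i::'n. axis i (1::real))" by (auto simp: inj_on_def axis_eq_axis)
  show ?thesis unfolding B by (subst sum.reindex[OF inj]) (simp add: o_def)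
qed

lemma mixed2_trace: "i \<noteq> j \<Longrightarrow> (\<Sum>b\<in>Basis. mixed2 i j b b x) = 0"
  by (auto simp: sum_Basis_axis mixed2_def axis_def intro!: sum.neutral)

lemma hoelder_le_mixed_jet:
  assumes \<alpha>: "0 < \<alpha>" "\<alpha> < 1" and \<rho>: "\<rho> > 0"
  obtains C where "hoelder_le \<alpha> (cball 0 \<rho>) C (jet (mixed0 i j) (mixed1 i j) (mixed2 i j) :: real ^ 'n \<Rightarrow> (real ^ 'm) \<times> _)"
proof -
  define c where "c = norm (1 :: real ^ 'm)"
  define q where "q = (\<rho> + (2 * \<rho>) powr (1 - \<alpha>)) * 1"
  have q: "q \<ge> 0" using \<rho> by (simp add: q_def)
  have c: "c \<ge> 0" by (simp add: c_def)
  have coord: "hoelder_le \<alpha> (cball 0 \<rho>) q (\<lambda>x::real ^ 'n. x $ i)" for i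
    unfolding q_def
    by (rule hoelder_le_of_derivative_bound[OF bounded_linear_imp_has_derivative[OF bounded_linear_vec_nth] _ _ \<alpha> \<rho>])
      (auto simp: component_le_norm_cart)
  have vec: "hoelder_le \<alpha> (cball 0 \<rho>) (2 * C * c) (\<lambda>x. f x *\<^sub>R (1 :: real ^ 'm))"
    if "hoelder_le \<alpha> (cball 0 \<rho>) C f" "C \<ge> 0" for C and f :: "real ^ 'n \<Rightarrow> real"
    unfolding hoelder_le_def
  proof (intro conjI ballI)
    fix x y :: "real ^ 'n" assume x: "x \<in> cball 0 \<rho>"
    have "norm (f x *\<^sub>R (1 :: real ^ 'm)) \<le> C * c" using hoelder_leD(1)[OF that(1) x] c by (simp add: c_def mult_right_mono)
    also have "\<dots> \<le> 2 * C * c" using c that(2) by simp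
    finally show "norm (f x *\<^sub>R (1 :: real ^ 'm)) \<le> 2 * C * c" .
    assume y: "y \<in> cball 0 \<rho>"
    have "norm (f x *\<^sub>R 1 - f y *\<^sub>R (1 :: real ^ 'm)) = \<bar>f x - f y\<bar> * c" by (simp add: c_def flip: scaleR_diff_left)
    also have "\<dots> \<le> C * dist x y powr \<alpha> * c" using hoelder_leD(2)[OF that(1) x y] c by (intro mult_right_mono) auto
    also have "\<dots> \<le> 2 * C * c * dist x y powr \<alpha>" using c that(2) by (simp add: mult_ac)
    finally show "norm (f x *\<^sub>R 1 - f y *\<^sub>R (1 :: real ^ 'm)) \<le> 2 * C * c * dist x y powr \<alpha>" .
  qed
  have unit: "\<bar>e $ i\<bar> \<le> 1" if "norm e \<le> 1" for e :: "real ^ 'n" and i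
    using component_le_norm_cart[of e i] that by linarith
  \<comment> \<open>The summands dominate the three orders of the jet: a product of coordinates, a
    sum of two coordinates with coefficients of size at most 1, and a constant of size at most
    2.\<close>
  define B where "B = 2 * q * q + (q + q) + 2"
  have B: "B \<ge> 0" using q by (simp add: B_def)
  have scaled: "hoelder_le \<alpha> (cball 0 \<rho>) q (\<lambda>x::real ^ 'n. a * x $ i)" if "\<bar>a\<bar> \<le> 1" for a i
  proof (rule hoelder_le_mono[OF hoelder_le_scaleR[OF coord, of a, unfolded real_scaleR_def]])
    show "\<bar>a\<bar> * q \<le> q" using that q by (simp add: mult_left_le_one_le)
  qed simp
  have "hoelder_le \<alpha> (cball 0 \<rho>) (2 * B * c) (mixed0 i j :: real ^ 'n \<Rightarrow> real ^ 'm)"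
    unfolding mixed0_def[abs_def] using q
    by (intro vec B hoelder_le_mono[OF hoelder_le_mult[OF coord coord]]) (auto simp: B_def)
  moreover have "hoelder_le \<alpha> (cball 0 \<rho>) (2 * B * c) (mixed1 i j e :: real ^ 'n \<Rightarrow> real ^ 'm)" if "norm e \<le> 1" for e
    unfolding mixed1_def[abs_def] using q hoelder_le_add[OF scaled[OF unit[OF that]] scaled[OF unit[OF that]], of i j j i]
    by (intro vec B) (auto simp: B_def mult.commute intro: hoelder_le_mono)
  moreover have "hoelder_le \<alpha> (cball 0 \<rho>) (2 * B * c) (mixed2 i j e e' :: real ^ 'n \<Rightarrow> real ^ 'm)" if "norm e \<le> 1" "norm e' \<le> 1" for e e'
  proof -
    have "\<bar>e $ i * e' $ j + e' $ i * e $ j\<bar> \<le> 1 * 1 + 1 * 1"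
      by (intro order_trans[OF abs_triangle_ineq] add_mono) (auto simp: abs_mult intro!: mult_le_one unit that)
    moreover have "2 \<le> B" unfolding B_def using q by (intro add_increasing) auto
    ultimately have "norm (e $ i * e' $ j + e' $ i * e $ j) \<le> B" by simp
    then show ?thesis unfolding mixed2_def[abs_def]
      by (intro vec B hoelder_le_mono[OF hoelder_le_const]) auto
  qed
  ultimately show thesis using that[OF hoelder_le_jet] by blast
qed

section \<open>Small solutions\<close>

text \<open>The order of choices matters: \<kappa> determines \<open>S\<close>, \<open>S\<close>
  determines \<open>K\<close>, and \<open>K\<close> determines \<eta>. The nonlinearity enters,
  through \<open>L\<close> and \<open>r\<close>, only in the final constant \<open>W\<close>, whose
  reciprocal bounds \<epsilon>.\<close>

lemma small_solutions:
  fixes A :: "(real ^ 'm) \<times> (real ^ 'n ^ 'm) \<times> (real ^ 'n ^ 'n ^ 'm) \<Rightarrow> real ^ 'm"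
  assumes D: "\<And>z. norm z \<le> r \<Longrightarrow> (A has_derivative A' z) (at z)"
    and A0: "\<And>z h. norm z \<le> r \<Longrightarrow> norm (A' z h) \<le> L * norm z * norm h"
    and A1: "\<And>z w h. norm z \<le> r \<Longrightarrow> norm w \<le> r \<Longrightarrow> norm (A' z h - A' w h) \<le> L * norm (z - w) * norm h"
    and L: "L \<ge> 0" and r: "r > 0" and A00: "A 0 = 0"
    and \<alpha>: "0 < \<alpha>" "\<alpha> < 1" and R: "R > 0" and ij: "i \<noteq> j"
  obtains \<epsilon>0 where "\<epsilon>0 > 0" "\<And>\<epsilon>. 0 < \<epsilon> \<Longrightarrow> \<epsilon> \<le> \<epsilon>0 \<Longrightarrow>
    \<exists>(u :: real ^ 'n \<Rightarrow> real ^ 'm) u1 u2 C. (\<forall>x. (u has_derivative (\<lambda>h. u1 h x)) (at x)) \<and>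
      (\<forall>e x. (u1 e has_derivative (\<lambda>h. u2 e h x)) (at x)) \<and>
      (\<forall>e e' x. u2 e e' x = u2 e' e x) \<and> u 0 = 0 \<and> (\<forall>e. u1 e 0 = 0) \<and>
      hoelder_le \<alpha> (cball 0 R) C (jet u u1 u2) \<and>
      (\<forall>x\<in>cball 0 R. (\<Sum>b\<in>Basis. u2 b b x) = A (jet u u1 u2 x)) \<and>
      (\<forall>k. \<bar>u2 (axis i 1) (axis j 1) 0 $ k - \<epsilon>\<bar> \<le> \<epsilon> / 2)"
proof -
  define \<rho> where "\<rho> = 2 * R"
  have \<rho>: "\<rho> > 0" using R by (simp add: \<rho>_def)
  define c where "c = 1 + (1 / R) powr \<alpha>"
  have c: "c > 0" by (simp add: c_def add_pos_nonneg)
  \<comment> \<open>Multiplication by the cutoff costs \<open>c\<close>, so the averaging term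
    retains a factor 1/4.\<close>
  define \<kappa> where "\<kappa> = 1 / (4 * c)"
  have \<kappa>: "\<kappa> > 0" using c by (simp add: \<kappa>_def)
  \<comment> \<open>The choice gives \<open>p * \<alpha> \<ge> 2\<close>, the condition for
    continuity of the scale integrand at 0; since \<alpha> is below 1 it also yields
    \<open>p \<ge> 2\<close>.\<close>
  define p where "p = nat \<lceil>2 / \<alpha>\<rceil>"
  have "real p \<ge> 2 / \<alpha>" unfolding p_def by (simp add: real_nat_ceiling_ge)
  then have p: "p * \<alpha> \<ge> 2" using \<alpha> by (simp add: field_simps)
  have "real p \<ge> 2" using p \<alpha> mult_left_mono[of \<alpha> 1 "real p"] by linarith
  then have p2: "p \<ge> 2" by simp
  then have p1: "p \<ge> 1" by simp
  obtain S where S: "S \<ge> 1" and smooth: "\<And>C (f :: real ^ 'n \<Rightarrow> real ^ 'm). hoelder_le \<alpha> UNIV C f \<Longrightarrow> (\<And>x. norm x > \<rho> \<Longrightarrow> f x = 0) \<Longrightarrow>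
     hoelder_le \<alpha> (cball 0 \<rho>) (\<kappa> * C) (smoothing p S f)"
    using smoothing_hoelder[OF \<kappa> \<alpha> \<rho> p1] by metis
  define K where "K = max 0 (sol_const TYPE(real ^ 'n) \<alpha> p S \<rho>)"
  have K: "K \<ge> 0" "sol_const TYPE(real ^ 'n) \<alpha> p S \<rho> \<le> K" by (simp_all add: K_def)
  define N where "N = 1 + real CARD('m) * real CARD('n) * (1 + real CARD('n))"
  have N: "N \<ge> 0" by (simp add: N_def)
  let ?J = "\<lambda>g :: real ^ 'n \<Rightarrow> real ^ 'm. jet (sol0 p S g) (\<lambda>e. sol1 p S e g) (\<lambda>e e'. sol2 p S e e' g)"
  have solK: "hoelder_le \<alpha> UNIV (K * C) (sol2 p S e e' g)" if g: "hoelder_le \<alpha> UNIV C g" and "norm e \<le> 1" "norm e' \<le> 1"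
    for C e e' and g :: "real ^ 'n \<Rightarrow> real ^ 'm"
    by (rule hoelder_le_mono[OF sol_hoelder(1)[OF g \<alpha> p p2 S \<rho> that(2,3)]])
      (use K(2) hoelder_le_nonneg[OF g] in \<open>auto intro: mult_right_mono\<close>)
  have J: "hoelder_le \<alpha> (cball 0 \<rho>) (N * (K * C)) (?J g)" if g: "hoelder_le \<alpha> UNIV C g" for C and g :: "real ^ 'n \<Rightarrow> real ^ 'm"
  proof -
    have KC: "sol_const TYPE(real ^ 'n) \<alpha> p S \<rho> * C \<le> K * C" using K(2) hoelder_le_nonneg[OF g] by (intro mult_right_mono) auto
    show ?thesis unfolding N_def
      by (rule hoelder_le_jet; rule hoelder_le_mono[OF _ KC order_refl] hoelder_le_mono[OF _ KC subset_UNIV])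
        (rule sol_hoelder[OF g \<alpha> p p2 S \<rho>]; assumption)+
  qed
  let ?H = "jet (mixed0 i j) (mixed1 i j) (mixed2 i j) :: real ^ 'n \<Rightarrow> (real ^ 'm) \<times> (real ^ 'n ^ 'm) \<times> (real ^ 'n ^ 'n ^ 'm)"
  obtain CH where H: "hoelder_le \<alpha> (cball 0 \<rho>) CH ?H" by (rule hoelder_le_mixed_jet[OF \<alpha> \<rho>])
  have CH: "CH \<ge> 0" using hoelder_le_nonneg[OF H] \<rho> by (simp add: not_less)
  \<comment> \<open>Sources will have Hoelder constant \<open>\<epsilon> * \<eta>\<close>. Then
    \<open>K * \<eta> \<le> 1 / 2\<close> keeps the second derivatives they generate below
    \<open>\<epsilon> / 2\<close>, so they cannot cancel the harmonic part at the origin.\<close>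
  define \<eta> where "\<eta> = 1 / (2 * (K + 1))"
  have \<eta>: "\<eta> > 0" "K * \<eta> \<le> 1 / 2" using K by (simp_all add: \<eta>_def field_simps)
  \<comment> \<open>\<open>\<epsilon> * B\<close> will bound the whole jet: \<open>CH\<close> for
    the harmonic part, the other summand for the correction.\<close>
  define B where "B = CH + N * (K * \<eta>)"
  have B: "B \<ge> 0" using CH N K \<eta> by (simp add: B_def)
  \<comment> \<open>The three summands after 1 encode three smallness conditions on \<epsilon>: jets
    stay within radius \<open>r\<close>, the nonlinear part contracts by 1/4, and the source it
    produces takes up at most half of \<open>\<epsilon> * \<eta>\<close>.\<close>
  define W where "W = 1 + B / r + 8 * c * L * (N * K) * B + 4 * c * L * B * B / \<eta>"
  have Wt: "B / r \<ge> 0" "8 * c * L * (N * K) * B \<ge> 0" "4 * c * L * B * B / \<eta> \<ge> 0"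
    using B r c L N K \<eta> by auto
  have W: "W > 0" unfolding W_def using Wt by linarith
  have main: "\<exists>(u :: real ^ 'n \<Rightarrow> real ^ 'm) u1 u2 C. (\<forall>x. (u has_derivative (\<lambda>h. u1 h x)) (at x)) \<and>
      (\<forall>e x. (u1 e has_derivative (\<lambda>h. u2 e h x)) (at x)) \<and>
      (\<forall>e e' x. u2 e e' x = u2 e' e x) \<and> u 0 = 0 \<and> (\<forall>e. u1 e 0 = 0) \<and>
      hoelder_le \<alpha> (cball 0 R) C (jet u u1 u2) \<and>
      (\<forall>x\<in>cball 0 R. (\<Sum>b\<in>Basis. u2 b b x) = A (jet u u1 u2 x)) \<and>
      (\<forall>k. \<bar>u2 (axis i 1) (axis j 1) 0 $ k - \<epsilon>\<bar> \<le> \<epsilon> / 2)"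
    if \<epsilon>: "0 < \<epsilon>" "\<epsilon> \<le> 1 / W" for \<epsilon>
  proof -
    have "\<epsilon> * W \<le> 1" using \<epsilon> W by (simp add: field_simps)
    moreover have "\<epsilon> * W = \<epsilon> + \<epsilon> * (B / r) + \<epsilon> * (8 * c * L * (N * K) * B) + \<epsilon> * (4 * c * L * B * B / \<eta>)"
      by (simp add: W_def distrib_left)
    moreover have "\<epsilon> * (B / r) \<ge> 0" "\<epsilon> * (8 * c * L * (N * K) * B) \<ge> 0" "\<epsilon> * (4 * c * L * B * B / \<eta>) \<ge> 0"
      using Wt \<epsilon>(1) by (auto intro!: mult_nonneg_nonneg simp del: times_divide_eq_right)
    ultimately have e1: "\<epsilon> * (B / r) \<le> 1" "\<epsilon> * (8 * c * L * (N * K) * B) \<le> 1" "\<epsilon> * (4 * c * L * B * B / \<eta>) \<le> 1"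
      using \<epsilon>(1) by linarith+
    define \<delta> where "\<delta> = \<epsilon> * B"
    have \<delta>: "0 \<le> \<delta>" "\<delta> \<le> r" using \<epsilon> B e1(1) r by (simp_all add: \<delta>_def field_simps)
    have e2: "c * (2 * L * \<delta> * (N * K)) \<le> 1 / 4" using e1(2) by (simp add: \<delta>_def algebra_simps)
    have e3: "c * (2 * L * \<delta> * \<delta>) \<le> \<epsilon> * \<eta> / 2"
    proof -
      have "\<epsilon> * (4 * c * L * B * B) \<le> \<eta>" using e1(3) \<eta>(1) by (simp add: field_simps)
      then have "\<epsilon> * (\<epsilon> * (4 * c * L * B * B)) \<le> \<epsilon> * \<eta>" using \<epsilon> by (intro mult_left_mono) auto
      then show ?thesis by (simp add: \<delta>_def algebra_simps)
    qed
    define G where "G = \<epsilon> * \<eta>"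
    have G: "G > 0" using \<epsilon> \<eta> by (simp add: G_def)
    let ?Z = "\<lambda>g x. \<epsilon> *\<^sub>R ?H x + ?J g x"
    define F where "F g x = cutoff R x *\<^sub>R (A (?Z g x) + smoothing p S g x)" for g x
    have Z: "hoelder_le \<alpha> (cball 0 \<rho>) \<delta> (?Z g)" if g: "hoelder_le \<alpha> UNIV G g" for g
    proof -
      have "\<bar>\<epsilon>\<bar> * CH + N * (K * G) = \<delta>" using \<epsilon> by (simp add: \<delta>_def B_def G_def algebra_simps)
      with hoelder_le_add[OF hoelder_le_scaleR[OF H, of \<epsilon>] J[OF g]] show ?thesis by simp
    qed
    have cut: "hoelder_le \<alpha> UNIV (c * C) (\<lambda>x. cutoff R x *\<^sub>R f x)" if "hoelder_le \<alpha> (cball 0 \<rho>) C f" for C and f :: "real ^ 'n \<Rightarrow> real ^ 'm"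
      using hoelder_le_cutoff[OF that[unfolded \<rho>_def] R \<alpha>] by (simp add: c_def)
    have maps: "hoelder_ball \<alpha> \<rho> G (F g)" if "hoelder_ball \<alpha> \<rho> G g" for g
    proof -
      have g: "hoelder_le \<alpha> UNIV G g" "\<And>x. norm x > \<rho> \<Longrightarrow> g x = 0" using that by (auto simp: hoelder_ball_def)
      \<comment> \<open>Comparison with the zero jet turns the difference estimate into a quadratic
        bound for \<open>A\<close> itself.\<close>
      have zero: "hoelder_le \<alpha> (cball 0 \<rho>) \<delta> (\<lambda>_. 0 :: (real ^ 'm) \<times> (real ^ 'n ^ 'm) \<times> (real ^ 'n ^ 'n ^ 'm))"
        using \<delta> by (simp add: hoelder_le_def)
      have "hoelder_le \<alpha> (cball 0 \<rho>) (2 * L * \<delta> * \<delta>) (\<lambda>x. A (?Z g x) - A 0)"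
        by (rule hoelder_le_composition_diff[OF D A0 A1 L \<delta>(2) Z[OF g(1)] zero]) (use Z[OF g(1)] in simp_all)
      from cut[OF hoelder_le_add[OF this smooth[OF g]]]
      have h: "hoelder_le \<alpha> UNIV (c * (2 * L * \<delta> * \<delta> + \<kappa> * G)) (F g)" by (simp add: F_def[abs_def] A00)
      have "c * (2 * L * \<delta> * \<delta> + \<kappa> * G) = c * (2 * L * \<delta> * \<delta>) + G / 4" using c by (simp add: \<kappa>_def distrib_left)
      also have "\<dots> \<le> G" using e3 G by (simp add: G_def)
      finally have "hoelder_le \<alpha> UNIV G (F g)" using hoelder_le_mono[OF h] by blast
      then show ?thesis by (simp add: cutoff_eq_0[OF R] hoelder_ball_def F_def \<rho>_def)
    qed
    have contr: "hoelder_le \<alpha> UNIV (d / 2) (\<lambda>x. F f x - F g x)"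
      if "hoelder_ball \<alpha> \<rho> G f" "hoelder_ball \<alpha> \<rho> G g" "hoelder_le \<alpha> UNIV d (\<lambda>x. f x - g x)" for f g d
    proof -
      have f: "hoelder_le \<alpha> UNIV G f" and g: "hoelder_le \<alpha> UNIV G g" and supp: "\<And>x. norm x > \<rho> \<Longrightarrow> f x - g x = 0"
        using that by (auto simp: hoelder_ball_def)
      have d: "d \<ge> 0" using hoelder_le_nonneg[OF that(3)] by simp
      note sd = sol_diff[OF f g \<alpha>(1) p, of S]
      \<comment> \<open>The harmonic part cancels and the solution operators are linear, so the
        difference of the jets is the jet of a single potential.\<close>
      have "?J (\<lambda>x. f x - g x) x = ?Z f x - ?Z g x" for x
        by (simp add: jet_def sd vec_eq_iff)
      then have "hoelder_le \<alpha> (cball 0 \<rho>) (N * (K * d)) (\<lambda>x. ?Z f x - ?Z g x)"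
        by (rule hoelder_le_cong[OF J[OF that(3)]])
      from hoelder_le_composition_diff[OF D A0 A1 L \<delta>(2) Z[OF f] Z[OF g] this]
      have "hoelder_le \<alpha> (cball 0 \<rho>) (2 * L * \<delta> * (N * (K * d))) (\<lambda>x. A (?Z f x) - A (?Z g x))" by simp
      from cut[OF hoelder_le_add[OF this smooth[OF that(3) supp]]]
      have "hoelder_le \<alpha> UNIV (c * (2 * L * \<delta> * (N * (K * d)) + \<kappa> * d))
         (\<lambda>x. cutoff R x *\<^sub>R (A (?Z f x) - A (?Z g x) + smoothing p S (\<lambda>x. f x - g x) x))" .
      then have h: "hoelder_le \<alpha> UNIV (c * (2 * L * \<delta> * (N * (K * d)) + \<kappa> * d)) (\<lambda>x. F f x - F g x)"
        by (rule hoelder_le_cong) (simp add: F_def sd scaleR_diff_right scaleR_add_right)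
      \<comment> \<open>A quarter comes from the nonlinearity and a quarter from the averaging,
        which gives the contraction factor 1/2.\<close>
      have "c * (2 * L * \<delta> * (N * (K * d)) + \<kappa> * d) = (c * (2 * L * \<delta> * (N * K))) * d + d / 4"
        using c by (simp add: \<kappa>_def distrib_left mult_ac)
      also have "\<dots> \<le> 1 / 4 * d + d / 4" using mult_right_mono[OF e2 d] by simp
      finally show ?thesis using hoelder_le_mono[OF h] by simp
    qed
    obtain g where gB: "hoelder_ball \<alpha> \<rho> G g" and Fg: "F g = g"
      by (rule hoelder_fixed_point[of G \<alpha> \<rho> F, OF less_imp_le[OF G] maps contr])
    then have g: "hoelder_le \<alpha> UNIV G g" by (simp add: hoelder_ball_def)
    define u where "u x = \<epsilon> *\<^sub>R mixed0 i j x + sol0 p S g x" for x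
    define u1 where "u1 e x = \<epsilon> *\<^sub>R mixed1 i j e x + sol1 p S e g x" for e x
    define u2 where "u2 e e' x = \<epsilon> *\<^sub>R mixed2 i j e e' x + sol2 p S e e' g x" for e e' x
    have jet_eq: "jet u u1 u2 = ?Z g"
      by (rule ext) (simp add: u_def[abs_def] u1_def[abs_def] u2_def[abs_def] jet_add_scaleR)
    have c1: "(u has_derivative (\<lambda>h. u1 h x)) (at x)" for x
      unfolding u_def[abs_def] u1_def
      by (intro has_derivative_add has_derivative_scaleR_right mixed0_derivative sol0_derivative[OF g \<alpha> p p2 S])
    have c2: "(u1 e has_derivative (\<lambda>h. u2 e h x)) (at x)" for e x
      unfolding u1_def[abs_def] u2_def
      by (intro has_derivative_add has_derivative_scaleR_right mixed1_derivative sol1_derivative[OF g \<alpha> p p2 S])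
    have c3: "u2 e e' x = u2 e' e x" for e e' x
      unfolding u2_def mixed2_def by (subst sol2_commute) (simp add: algebra_simps)
    have c4: "u 0 = 0" "u1 e 0 = 0" for e
      by (simp_all add: u_def u1_def sol_at_0 mixed0_def mixed1_def)
    have c5: "hoelder_le \<alpha> (cball 0 R) \<delta> (jet u u1 u2)"
      unfolding jet_eq by (rule hoelder_le_mono[OF Z[OF g]]) (use R in \<open>auto simp: \<rho>_def\<close>)
    have c6: "(\<Sum>b\<in>Basis. u2 b b x) = A (jet u u1 u2 x)" if "x \<in> cball 0 R" for x
    proof -
      \<comment> \<open>Where the cutoff is 1, the fixed point equation gives \<open>g\<close> as
        nonlinearity plus average, while the trace of the second derivatives is \<open>g\<close>
        minus the same average. The averages cancel exactly.\<close>
      have "cutoff R x = 1" using cutoff_eq_1[OF R] that by simp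
      then have h1: "A (?Z g x) + smoothing p S g x = g x" using fun_cong[OF Fg, of x] by (simp add: F_def)
      have h2: "(\<Sum>b\<in>Basis. u2 b b x) = g x - smoothing p S g x"
        using sol2_trace[OF g \<alpha>(1) p, of S x] S
        by (simp add: mixed2_trace[OF ij] u2_def sum.distrib flip: scaleR_sum_right)
      show ?thesis unfolding jet_eq h2 h1[symmetric] by simp
    qed
    have c7: "\<bar>u2 (axis i 1) (axis j 1) 0 $ k - \<epsilon>\<bar> \<le> \<epsilon> / 2" for k
    proof -
      have "u2 (axis i 1) (axis j 1) 0 $ k - \<epsilon> = sol2 p S (axis i 1) (axis j 1) g 0 $ k"
        using ij by (simp add: u2_def mixed2_def axis_def)
      also have "\<bar>\<dots>\<bar> \<le> norm (sol2 p S (axis i 1) (axis j 1) g 0)" by (rule component_le_norm_cart)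
      also have "\<dots> \<le> K * G" by (rule hoelder_leD(1)[OF solK[OF g]]) auto
      also have "\<dots> = \<epsilon> * (K * \<eta>)" by (simp add: G_def)
      also have "\<dots> \<le> \<epsilon> * (1 / 2)" using \<eta> \<epsilon> by (intro mult_left_mono) auto
      finally show ?thesis by simp
    qed
    show ?thesis
      by (intro exI[of _ u] exI[of _ u1] exI[of _ u2] exI[of _ \<delta>] conjI allI ballI c1 c2 c3 c4 c5 c6 c7)
  qed
  show thesis
    by (rule that[of "1 / W"]) (use W main in auto)
qed

text \<open>The values lie in intervals from one half to three halves of
  \<open>\<epsilon>0 / 4 ^ k\<close>. With ratio 4 these are disjoint, since three halves of a
  quarter is less than one half.\<close>

lemma infinite_of_geometric_values:
  fixes val :: "'u \<Rightarrow> real"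
  assumes "\<epsilon>0 > 0" and val: "\<And>k::nat. \<bar>val (s k) - \<epsilon>0 / 4 ^ k\<bar> \<le> \<epsilon>0 / 4 ^ k / 2"
  shows "infinite (range s)"
proof -
  have neq: "s k \<noteq> s l" if "k < l" for k l
  proof
    assume eq: "s k = s l"
    have "(4::real) ^ k * 4 \<le> 4 ^ l" using power_increasing[of "Suc k" l "4::real"] that by simp
    then have "\<epsilon>0 / 4 ^ l \<le> \<epsilon>0 / (4 ^ k * 4)" using \<open>\<epsilon>0 > 0\<close> by (intro divide_left_mono) auto
    also have "\<dots> = \<epsilon>0 / 4 ^ k / 4" by simp
    finally have "\<epsilon>0 / 4 ^ l \<le> \<epsilon>0 / 4 ^ k / 4" .
    moreover have "\<epsilon>0 / 4 ^ k > 0" using \<open>\<epsilon>0 > 0\<close> by simp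
    moreover have False if "q \<le> p / 4" "p > 0" "\<bar>v - p\<bar> \<le> p / 2" "\<bar>v - q\<bar> \<le> q / 2" for p q v :: real
      using that by linarith
    ultimately show False using val[of k] val[of l] unfolding eq by blast
  qed
  have "inj s"
    by (rule injI) (metis neq nat_neq_iff)
  then show ?thesis by (rule range_inj_infinite)
qed

theorem theorem1p3:
  fixes a :: "(real ^ 'm) \<times> (real ^ 'n ^ 'm) \<times> (real ^ 'n ^ 'n ^ 'm) \<Rightarrow> real ^ 'm"
    and \<alpha> R :: real
  assumes "CARD('n) \<ge> 2"
    and "0 < \<alpha>" and "\<alpha> < 1"
    and "C2_on jet_space a"
    and "a (0, 0, 0) = 0"
    and "(a has_derivative (\<lambda>h. 0)) (at (0, 0, 0) within jet_space)"
    and "R > 0"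
  shows "\<exists>U :: (real ^ 'n \<Rightarrow> real ^ 'm) set.
           infinite U \<and>
           U \<subseteq> extensional (cball 0 R) \<and>
           (\<forall>u\<in>U. C2_holder_on \<alpha> (cball 0 R) u \<and>
                   (\<forall>x\<in>cball 0 R. laplacian (cball 0 R) u x =
                      a (u x, grad (cball 0 R) u x, grad2 (cball 0 R) u x)) \<and>
                   vanishing_order_two (cball 0 R) u) \<and>
           (\<forall>u\<in>U. \<not> radially_symmetric_on (cball 0 R) u)"
proof -
  let ?S = "cball (0 :: real ^ 'n) R"
  obtain i j :: 'n where ij: "i \<noteq> j"
    using assms(1) card_le_Suc0_iff_eq[of "UNIV :: 'n set"] by fastforce
  have d0: "(a has_derivative (\<lambda>h. 0)) (at 0 within jet_space)" using assms(6) by (simp add: zero_prod_def)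
  obtain A' r L where r: "r > 0" and L: "L \<ge> 0"
    and D: "\<And>z. norm z \<le> r \<Longrightarrow> ((\<lambda>z. a (symmetrize z)) has_derivative A' z) (at z)"
    and A0: "\<And>z h. norm z \<le> r \<Longrightarrow> norm (A' z h) \<le> L * norm z * norm h"
    and A1: "\<And>z w h. norm z \<le> r \<Longrightarrow> norm w \<le> r \<Longrightarrow> norm (A' z h - A' w h) \<le> L * norm (z - w) * norm h"
    by (rule C2_on_quadratic_bounds[OF assms(4) subspace_jet_space bounded_linear_symmetrize symmetrize_in_jet_space d0]) blast
  have "symmetrize 0 = (0 :: (real ^ 'm) \<times> (real ^ 'n ^ 'm) \<times> (real ^ 'n ^ 'n ^ 'm))"
    by (rule linear_0[OF bounded_linear.linear[OF bounded_linear_symmetrize]])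
  then have A00: "a (symmetrize 0) = 0" using assms(5) by (simp add: zero_prod_def)
  obtain \<epsilon>0 where "\<epsilon>0 > 0" and sol: "\<And>\<epsilon>. 0 < \<epsilon> \<Longrightarrow> \<epsilon> \<le> \<epsilon>0 \<Longrightarrow>
    \<exists>(u :: real ^ 'n \<Rightarrow> real ^ 'm) u1 u2 C. (\<forall>x. (u has_derivative (\<lambda>h. u1 h x)) (at x)) \<and>
      (\<forall>e x. (u1 e has_derivative (\<lambda>h. u2 e h x)) (at x)) \<and>
      (\<forall>e e' x. u2 e e' x = u2 e' e x) \<and> u 0 = 0 \<and> (\<forall>e. u1 e 0 = 0) \<and>
      hoelder_le \<alpha> ?S C (jet u u1 u2) \<and>
      (\<forall>x\<in>?S. (\<Sum>b\<in>Basis. u2 b b x) = a (symmetrize (jet u u1 u2 x))) \<and>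
      (\<forall>k. \<bar>u2 (axis i 1) (axis j 1) 0 $ k - \<epsilon>\<bar> \<le> \<epsilon> / 2)"
  proof (rule small_solutions[OF D A0 A1 L r A00 assms(2,3,7) ij], goal_cases)
    case (5 \<epsilon>0)
    show ?case by (rule 5(1)) (fact 5)+
  qed
  \<comment> \<open>Any component will do for telling the solutions apart by their mixed
    derivative.\<close>
  obtain k0 :: 'm where True by blast
  have ex: "\<exists>v :: real ^ 'n \<Rightarrow> real ^ 'm. v \<in> extensional ?S \<and> C2_holder_on \<alpha> ?S v \<and>
      (\<forall>x\<in>?S. laplacian ?S v x = a (v x, grad ?S v x, grad2 ?S v x)) \<and>
      vanishing_order_two ?S v \<and> \<not> radially_symmetric_on ?S v \<and>
      \<bar>grad2 ?S v 0 $ k0 $ i $ j - \<epsilon>\<bar> \<le> \<epsilon> / 2"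
    if \<epsilon>: "0 < \<epsilon>" "\<epsilon> \<le> \<epsilon>0" for \<epsilon>
  proof -
    obtain u :: "real ^ 'n \<Rightarrow> real ^ 'm" and u1 u2 C where
      u: "\<forall>x. (u has_derivative (\<lambda>h. u1 h x)) (at x)"
        "\<forall>e x. (u1 e has_derivative (\<lambda>h. u2 e h x)) (at x)"
        "\<forall>e e' x. u2 e e' x = u2 e' e x" and zero: "u 0 = 0" "\<forall>e. u1 e 0 = 0" and
      hoelder: "hoelder_le \<alpha> ?S C (jet u u1 u2)" and
      eq: "\<forall>x\<in>?S. (\<Sum>b\<in>Basis. u2 b b x) = a (symmetrize (jet u u1 u2 x))" and
      near: "\<forall>k. \<bar>u2 (axis i 1) (axis j 1) 0 $ k - \<epsilon>\<bar> \<le> \<epsilon> / 2"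
      using sol[OF \<epsilon>] by (elim exE conjE) (rule that)
    note u1 = u(1)[rule_format] and u2 = u(2)[rule_format] and sym = u(3)[rule_format]
    define v where "v = restrict u ?S"
    note J = jet_of_restriction[OF u1 u2 assms(7), folded v_def]
    have g2: "grad2 ?S v x = (\<chi> k i j. u2 (axis i 1) (axis j 1) x $ k)" if "x \<in> ?S" for x
      using J(1)[OF that] by (simp add: jet_def)
    have 0: "0 \<in> ?S" using assms(7) by simp
    have near': "\<bar>grad2 ?S v 0 $ k0 $ i $ j - \<epsilon>\<bar> \<le> \<epsilon> / 2" using spec[OF near, of k0] by (simp add: g2[OF 0])
    have nz: "u2 (axis i 1) (axis j 1) 0 \<noteq> 0"
    proof
      assume "u2 (axis i 1) (axis j 1) 0 = 0"
      with spec[OF near, of k0] \<epsilon>(1) show False by simp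
    qed
    have "C2_holder_on \<alpha> ?S v"
      unfolding C2_holder_on_def holder_on_def
    proof (intro conjI allI J(2,3) exI[of _ C] ballI)
      fix x y assume x: "x \<in> ?S" and y: "y \<in> ?S"
      have "dist (grad2 ?S v x) (grad2 ?S v y) \<le> dist (jet u u1 u2 x) (jet u u1 u2 y)"
        using order_trans[OF dist_snd_le dist_snd_le, of "jet u u1 u2 x" "jet u u1 u2 y"]
        by (simp only: J(1)[OF x, symmetric] J(1)[OF y, symmetric] snd_conv)
      also have "\<dots> \<le> C * dist x y powr \<alpha>"
        using hoelder_leD(2)[OF hoelder x y] by (simp add: dist_norm)
      finally show "dist (grad2 ?S v x) (grad2 ?S v y) \<le> C * dist x y powr \<alpha>" .
    qed
    moreover have "laplacian ?S v x = a (v x, grad ?S v x, grad2 ?S v x)" if x: "x \<in> ?S" for x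
    proof -
      have "laplacian ?S v x = (\<Sum>b\<in>Basis. u2 b b x)"
        by (simp add: laplacian_def g2[OF x] sum_Basis_axis vec_eq_iff)
      also have "\<dots> = a (symmetrize (v x, grad ?S v x, grad2 ?S v x))" unfolding J(1)[OF x] by (rule eq[rule_format, OF x])
      \<comment> \<open>The second derivatives of the solution commute, so the projection disappears
        and \<open>a\<close> is evaluated at the true jet.\<close>
      also have "symmetrize (v x, grad ?S v x, grad2 ?S v x) = (v x, grad ?S v x, grad2 ?S v x)"
      proof (rule symmetrize_ident)
        show "grad2 ?S v x $ k $ l $ l' = grad2 ?S v x $ k $ l' $ l" for k l l'
          unfolding g2[OF x] vec_lambda_beta by (subst sym) (rule refl)
      qed
      finally show ?thesis .
    qed
    moreover have "vanishing_order_two ?S v"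
    proof -
      have "grad2 ?S v 0 \<noteq> 0"
      proof
        assume "grad2 ?S v 0 = 0"
        with near' \<epsilon>(1) show False by simp
      qed
      moreover have "v 0 = 0" "grad ?S v 0 = 0" using J(1)[OF 0] by (simp_all add: jet_def zero vec_eq_iff)
      ultimately show ?thesis by (simp add: vanishing_order_two_def)
    qed
    moreover have "\<not> radially_symmetric_on ?S v"
      using radially_symmetric_mixed_derivative[OF u1 u2 assms(7) _ ij] nz unfolding v_def by blast
    moreover have "v \<in> extensional ?S" by (simp add: v_def)
    ultimately show ?thesis using near' by blast
  qed
  have "0 < \<epsilon>0 / 4 ^ k" "\<epsilon>0 / 4 ^ k \<le> \<epsilon>0" for k :: nat
    using \<open>\<epsilon>0 > 0\<close> by (simp_all add: divide_le_eq mult_le_cancel_left1)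
  from ex[OF this] obtain s :: "nat \<Rightarrow> real ^ 'n \<Rightarrow> real ^ 'm" where
    s: "\<And>k. s k \<in> extensional ?S \<and> C2_holder_on \<alpha> ?S (s k) \<and>
      (\<forall>x\<in>?S. laplacian ?S (s k) x = a (s k x, grad ?S (s k) x, grad2 ?S (s k) x)) \<and>
      vanishing_order_two ?S (s k) \<and> \<not> radially_symmetric_on ?S (s k) \<and>
      \<bar>grad2 ?S (s k) 0 $ k0 $ i $ j - \<epsilon>0 / 4 ^ k\<bar> \<le> \<epsilon>0 / 4 ^ k / 2"
    by metis
  have "infinite (range s)"
    by (rule infinite_of_geometric_values[OF \<open>\<epsilon>0 > 0\<close>, of "\<lambda>v. grad2 ?S v 0 $ k0 $ i $ j"]) (use s in blast)
  then show ?thesis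
    using s by (intro exI[of _ "range s"]) auto
qed

end
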